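(* There are a deterministic algorithm and an absolute constant $C$ such that the following holds. Let $V$ be a set of $n$ items with an unknown total order, let the input be the outcomes of $m$ pre-existing comparisons between pairs of items of $V$ (all consistent with the unknown total order), and suppose that at least two total orders of $V$ are consistent with these outcomes. Then the algorithm outputs all the items in sorted (increasing) order in at most $C\,(m+\mathrm{OPT})$ time, using at most $C\cdot\mathrm{OPT}$ additional comparisons.
   Context: The pre-existing comparison outcomes are represented by a directed graph $G$ on vertex set $V$, with an arc $vw$ for each outcome $v<w$. The graph $G$ is acyclic and is given, for example, as a list of its $m$ arcs in arbitrary order; it need not be transitively closed or transitively reduced. An algorithm learns more about the unknown total order only by making additional binary comparisons "is $x<y$?" between items. Each comparison takes unit time, and other computation is charged in the standard unit-cost RAM model. A topological order of $G$ is a total order of $V$ such that $v<w$ for every arc $vw$; the total orders consistent with the pre-existing outcomes are exactly the topological orders of $G$. $\mathrm{OPT}$ denotes the minimum, over all algorithms (comparison decision trees) that correctly determine the unknown total order given $G$, of the worst-case number of additional comparisons made, the worst case being over all topological orders of the fixed graph $G$. *)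

theory Defs
  imports Main
begin

section \<open>Total orders consistent with the known outcomes\<close>

text \<open>
  Orders are strict and relational: \<open>(v, w) \<in> r\<close> means \<open>v < w\<close>.  The graph is given by its
  vertex set \<open>V\<close> and its arc set \<open>E\<close>.  The inclusion in \<open>V \<times> V\<close> makes distinct members of
  \<open>topological_orders V E\<close> differ on \<open>V\<close>.
\<close>

definition topological_orders :: "'a set \<Rightarrow> ('a \<times> 'a) set \<Rightarrow> ('a \<times> 'a) set set" where
  "topological_orders V E = {r. r \<subseteq> V \<times> V \<and> strict_linear_order_on V r \<and> E \<subseteq> r}"

text \<open>Repetitions in \<open>xs\<close> are excluded by the irreflexivity of \<open>r\<close>.\<close>

definition lists_in_order :: "'a set \<Rightarrow> ('a \<times> 'a) set \<Rightarrow> 'a list \<Rightarrow> bool" where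
  "lists_in_order V r xs \<longleftrightarrow> set xs = V \<and> sorted_wrt (\<lambda>x y. (x, y) \<in> r) xs"


section \<open>Comparison decision trees and OPT\<close>

text \<open>\<open>Query x y t u\<close> asks ``is \<open>x < y\<close>?'' and continues with \<open>t\<close> if so, otherwise with \<open>u\<close>.\<close>

datatype 'a dtree = Leaf "'a list" | Query 'a 'a "'a dtree" "'a dtree"

fun answer :: "'a dtree \<Rightarrow> ('a \<times> 'a) set \<Rightarrow> 'a list" where
  "answer (Leaf xs) r = xs"
| "answer (Query x y t u) r = (if (x, y) \<in> r then answer t r else answer u r)"

fun queries :: "'a dtree \<Rightarrow> ('a \<times> 'a) set \<Rightarrow> nat" where
  "queries (Leaf xs) r = 0"
| "queries (Query x y t u) r = Suc (if (x, y) \<in> r then queries t r else queries u r)"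

definition sorts :: "'a dtree \<Rightarrow> 'a set \<Rightarrow> ('a \<times> 'a) set \<Rightarrow> bool" where
  "sorts t V E \<longleftrightarrow> (\<forall>r \<in> topological_orders V E. lists_in_order V r (answer t r))"

definition worst_case_queries :: "'a dtree \<Rightarrow> 'a set \<Rightarrow> ('a \<times> 'a) set \<Rightarrow> nat" where
  "worst_case_queries t V E = Max (queries t ` topological_orders V E)"

definition OPT :: "'a set \<Rightarrow> ('a \<times> 'a) set \<Rightarrow> nat" where
  "OPT V E = (INF t \<in> {t. sorts t V E}. worst_case_queries t V E)"

text \<open>
  For finite \<open>V\<close> the infimum in \<open>OPT\<close> is over a nonempty set and the maximum is over a finite
  set, which is nonempty as soon as \<open>E\<close> is consistent with some total order of \<open>V\<close>.
\<close>

lemma finite_topological_orders: "finite V \<Longrightarrow> finite (topological_orders V E)"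
  by (rule finite_subset[of _ "Pow (V \<times> V)"]) (auto simp: topological_orders_def)

lemma ex_lists_in_order:
  assumes "finite V" "trans r" "irrefl r" "total_on V r"
  shows "\<exists>xs. lists_in_order V r xs"
  using assms
proof (induction V rule: finite_psubset_induct)
  case (psubset V)
  show ?case
  proof (cases "V = {}")
    case True
    then show ?thesis by (simp add: lists_in_order_def)
  next
    case False
    have "acyclic r"
      using psubset.prems by (simp add: acyclic_irrefl)
    then have "acyclic (r \<inter> V \<times> V)"
      by (rule acyclic_subset) blast
    then have wf: "wf (r \<inter> V \<times> V)"
      using psubset.hyps by (simp add: finite_acyclic_wf)
    obtain v where "v \<in> V"
      using False by blast
    from wfE_min[OF wf this] obtain x
      where x: "x \<in> V" "\<And>y. (y, x) \<in> r \<inter> V \<times> V \<Longrightarrow> y \<notin> V"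
      by blast
    have "total_on (V - {x}) r"
      using psubset.prems by (auto simp: total_on_def)
    moreover have "V - {x} \<subset> V"
      using x(1) by blast
    ultimately obtain xs where xs: "lists_in_order (V - {x}) r xs"
      using psubset.IH psubset.prems(1,2) by meson
    have "(x, y) \<in> r" if "y \<in> V - {x}" for y
      using that x psubset.prems(3) unfolding total_on_def by blast
    then have "lists_in_order V r (x # xs)"
      using xs x(1) by (auto simp: lists_in_order_def)
    then show ?thesis ..
  qed
qed

lemma ex_sorts:
  assumes "finite V"
  shows "\<exists>t. sorts t V E"
proof -
  have "\<exists>t. \<forall>r \<in> S. lists_in_order V r (answer t r)"
    if "finite S" "S \<subseteq> topological_orders V E" for S
    using that
  proof (induction S rule: finite_psubset_induct)
    case (psubset S)
    consider "S = {}" | r where "S = {r}" | r r' where "r \<in> S" "r' \<in> S" "\<not> r \<subseteq> r'"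
      by blast
    then show ?case
    proof cases
      case (2 r)
      then have "trans r" "irrefl r" "total_on V r"
        using psubset.prems by (simp_all add: topological_orders_def strict_linear_order_on_def)
      then obtain xs where "lists_in_order V r xs"
        using ex_lists_in_order assms by blast
      then have "\<forall>r \<in> S. lists_in_order V r (answer (Leaf xs) r)"
        using 2 by simp
      then show ?thesis ..
    next
      case (3 r r')
      then obtain a b where ab: "(a, b) \<in> r" "(a, b) \<notin> r'"
        by auto
      let ?T = "{r \<in> S. (a, b) \<in> r}" and ?U = "{r \<in> S. (a, b) \<notin> r}"
      have "?T \<subset> S" "?U \<subset> S"
        using 3 ab by blast+
      moreover have "?T \<subseteq> topological_orders V E" "?U \<subseteq> topological_orders V E"
        using psubset.prems by blast+
      ultimately obtain t u where
        "\<forall>r \<in> ?T. lists_in_order V r (answer t r)" "\<forall>r \<in> ?U. lists_in_order V r (answer u r)"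
        using psubset.IH[of ?T] psubset.IH[of ?U] by auto
      then have "\<forall>r \<in> S. lists_in_order V r (answer (Query a b t u) r)"
        by auto
      then show ?thesis ..
    qed simp
  qed
  from this[OF finite_topological_orders[OF assms] subset_refl] show ?thesis
    by (simp add: sorts_def)
qed


section \<open>The unit-cost RAM\<close>

text \<open>
  A program is a list of instructions.  Operands name registers, except for the constant of
  \<open>Const\<close> and the jump targets.  There is one indirectly addressed memory, every cell holds a
  natural number, and \<open>Sub\<close> is truncated subtraction.  \<open>Compare d a b\<close> is the only access to the
  unknown order \<open>r\<close> of the items, which are named by numbers.
\<close>

datatype instr =
    Const nat nat
  | Add nat nat nat
  | Sub nat nat nat
  | Load nat nat
  | Store nat nat
  | Jump nat
  | JumpZero nat nat
  | Compare nat nat nat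
  | Print nat

record config =
  pc :: nat
  reg :: "nat \<Rightarrow> nat"
  mem :: "nat \<Rightarrow> nat"
  printed :: "nat list"
  comparisons :: nat

fun exec :: "(nat \<times> nat) set \<Rightarrow> instr \<Rightarrow> config \<Rightarrow> config" where
  "exec r (Const d k) c = c\<lparr>pc := pc c + 1, reg := (reg c)(d := k)\<rparr>"
| "exec r (Add d a b) c = c\<lparr>pc := pc c + 1, reg := (reg c)(d := reg c a + reg c b)\<rparr>"
| "exec r (Sub d a b) c = c\<lparr>pc := pc c + 1, reg := (reg c)(d := reg c a - reg c b)\<rparr>"
| "exec r (Load d a) c = c\<lparr>pc := pc c + 1, reg := (reg c)(d := mem c (reg c a))\<rparr>"
| "exec r (Store a s) c = c\<lparr>pc := pc c + 1, mem := (mem c)(reg c a := reg c s)\<rparr>"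
| "exec r (Jump l) c = c\<lparr>pc := l\<rparr>"
| "exec r (JumpZero a l) c = c\<lparr>pc := (if reg c a = 0 then l else pc c + 1)\<rparr>"
| "exec r (Compare d a b) c =
     c\<lparr>pc := pc c + 1,
       reg := (reg c)(d := (if (reg c a, reg c b) \<in> r then 1 else 0)),
       comparisons := comparisons c + 1\<rparr>"
| "exec r (Print a) c = c\<lparr>pc := pc c + 1, printed := printed c @ [reg c a]\<rparr>"

definition halted :: "instr list \<Rightarrow> config \<Rightarrow> bool" where
  "halted P c \<longleftrightarrow> length P \<le> pc c"

definition step :: "instr list \<Rightarrow> (nat \<times> nat) set \<Rightarrow> config \<Rightarrow> config" where
  "step P r c = (if halted P c then c else exec r (P ! pc c) c)"

text \<open>
  The input \<open>n, m, v\<^sub>1, w\<^sub>1, \<dots>, v\<^sub>m, w\<^sub>m\<close> occupies the first \<open>2 m + 2\<close> memory cells;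
  all other cells and all registers are initially zero.
\<close>

definition input_words :: "nat \<Rightarrow> (nat \<times> nat) list \<Rightarrow> nat list" where
  "input_words n arcs = n # length arcs # concat (map (\<lambda>(v, w). [v, w]) arcs)"

definition initial :: "nat \<Rightarrow> (nat \<times> nat) list \<Rightarrow> config" where
  "initial n arcs =
     \<lparr>pc = 0,
      reg = (\<lambda>_. 0),
      mem = (\<lambda>a. if a < length (input_words n arcs) then input_words n arcs ! a else 0),
      printed = [],
      comparisons = 0\<rparr>"

text \<open>
  One step is one unit of time.  A halted configuration no longer changes, so being halted after
  \<open>t\<close> steps means that the running time is at most \<open>t\<close>.
\<close>

definition run :: "instr list \<Rightarrow> (nat \<times> nat) set \<Rightarrow> nat \<Rightarrow> config \<Rightarrow> config" where
  "run P r t c = (step P r ^^ t) c"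

end

(*
Arrange the items in levels by the length of the longest path ending in them and fix a longest path
P.  If k items lie outside P, then every one of them can be placed before or after the item of P on
its level, so there are at least 2 ^ k consistent orders.  Hence k <= OPT, and as the number of arcs
is at least that of P, the number n of items is O(m + OPT).

The k items are sorted by topological heapsort, in which an item of P is deleted for free as soon as
it is available.  Deleting x from the queue costs O(1 + log w(x)) comparisons, where w(x) counts the
insertions while x is in the queue.  Lifetimes of comparable items are disjoint, so independent
choices of a point in each lifetime give consistent orders; counting them yields
prod w(x) <= T * 4 ^ k, where T is the number of consistent orders.

Finally the k sorted items are merged into P by exponential search, each starting at the last
position known to lie before it.  Again these ranges can be used independently, so that the product
of their lengths is at most T.  As T <= 2 ^ OPT, all the costs are O(OPT).  All bounds are kept in
  the
exponential form 2 ^ cost <= product, which avoids logarithms.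
*)

theory Submission
  imports Defs "HOL-Library.FuncSet"
begin

section \<open>A structured language for the RAM\<close>

text \<open>A comparison budget proportional to OPT leaves no room for a term in n, since OPT can be
  far below n. So the items of the path are never queued: their order is known, and they matter only
  for the items that they release. Deleting one of them while smaller items still wait is harmless,
  because the heapsort records only the order of the k other items; the merge restores the true
  places. An ordinary heap would still cost too much: it pays for the size of the queue, whose
  logarithms may sum to far more than log T. What the number of orders does control is the product
  of the w(x), so the queue has to be cheap for items inserted recently. The factor 4 ^ k arises
  since different choices of points may yield the same order. A choice is recovered from the order
  together with a set of numbers below 2 * k, and there are 4 ^ k such sets. Additive constants are
  absorbed by 1 <= OPT, which two consistent orders guarantee.\<close>

datatype var =
  VN | VM | VX | VU | VW | VE | VT | VL | VJ | VO | VK | VF | VC | VA | VB | VZ | VI | VH | VG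

datatype arr =
  AHead | ANxt | ATgt | ASrc | ADegA | ADegB | AOrd | APar | ALev | AP | APidx | ALp | AIns | ADel
| AMn | ALft | ARgt | AUp | ASA | ASB | AS | AQ | APw

text \<open>
  \<open>VO\<close> and \<open>VJ\<close> are path positions: the one before the first item of the path, and that of
  the last item processed.  \<open>VK\<close> counts the items sorted so far, \<open>VC\<close> the insertions into the
  priority queue, whose last node is \<open>VF\<close>; the queue \<open>AOrd\<close> extends from \<open>VH\<close> to \<open>VG\<close>.
\<close>

datatype com =
  Skip
| Set var nat
| Inc var
| Dec var
| Copy var var
| Plus var var var
| Minus var var var
| Inp var var
| Rd var arr var
| Wr arr var var
| Mini var var var
| Less var var var
| Pr var
| Seq com com (infixr ";;" 60)
| Cond var com com
| Loop var com

text \<open>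
  Items are coded by positive numbers, item \<open>v\<close> as \<open>v + 1\<close>, so that the initial memory content 0
  can serve as null.
\<close>

definition lt :: "(nat \<times> nat) set \<Rightarrow> nat \<Rightarrow> nat \<Rightarrow> bool" where
  "lt r a b \<longleftrightarrow> a \<noteq> 0 \<and> b \<noteq> 0 \<and> (a - 1, b - 1) \<in> r"

definition mn2 :: "(nat \<times> nat) set \<Rightarrow> nat \<Rightarrow> nat \<Rightarrow> nat" where
  "mn2 r a b = (if a = 0 then b else if b = 0 then a else if (a - 1, b - 1) \<in> r then a else b)"

type_synonym st = "(var \<Rightarrow> nat) \<times> (arr \<Rightarrow> nat \<Rightarrow> nat) \<times> nat list \<times> nat \<times> nat"

text \<open>
  The last two state components are cost counters: an upper bound on the comparisons, and the
  number of loop iterations.  Up to a factor that depends on the program only, the latter bounds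
  the running time on the RAM.
\<close>

inductive big :: "(nat \<times> nat) set \<Rightarrow> nat list \<Rightarrow> com \<Rightarrow> st \<Rightarrow> st \<Rightarrow> bool"
  for r :: "(nat \<times> nat) set" and inp :: "nat list" where
  Skip: "big r inp Skip s s"
| Set: "big r inp (Set x v) (R, A, out, k, t) (R(x := v), A, out, k, t)"
| Inc: "big r inp (Inc x) (R, A, out, k, t) (R(x := Suc (R x)), A, out, k, t)"
| Dec: "big r inp (Dec x) (R, A, out, k, t) (R(x := R x - 1), A, out, k, t)"
| Copy: "big r inp (Copy x y) (R, A, out, k, t) (R(x := R y), A, out, k, t)"
| Plus: "big r inp (Plus x y z) (R, A, out, k, t) (R(x := R y + R z), A, out, k, t)"
| Minus: "big r inp (Minus x y z) (R, A, out, k, t) (R(x := R y - R z), A, out, k, t)"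
| Inp: "R y < length inp \<Longrightarrow>
    big r inp (Inp x y) (R, A, out, k, t) (R(x := inp ! R y), A, out, k, t)"
| Rd: "big r inp (Rd x f y) (R, A, out, k, t) (R(x := A f (R y)), A, out, k, t)"
| Wr: "big r inp (Wr f x y) (R, A, out, k, t) (R, A(f := (A f)(R x := R y)), out, k, t)"
| Mini: "big r inp (Mini x y z) (R, A, out, k, t) (R(x := mn2 r (R y) (R z)), A, out, Suc k, t)"
| Less: "big r inp (Less x y z) (R, A, out, k, t)
    (R(x := (if lt r (R y) (R z) then 1 else 0)), A, out, Suc k, t)"
| Pr: "big r inp (Pr x) (R, A, out, k, t) (R, A, out @ [R x - 1], k, t)"
| Seq: "big r inp c s s' \<Longrightarrow> big r inp d s' s'' \<Longrightarrow> big r inp (c ;; d) s s''"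
| CondT: "R x \<noteq> 0 \<Longrightarrow> big r inp c (R, A, out, k, t) s' \<Longrightarrow> big r inp (Cond x c d) (R, A, out, k, t) s'"
| CondF: "R x = 0 \<Longrightarrow> big r inp d (R, A, out, k, t) s' \<Longrightarrow> big r inp (Cond x c d) (R, A, out, k, t) s'"
| LoopF: "R x = 0 \<Longrightarrow> big r inp (Loop x c) (R, A, out, k, t) (R, A, out, k, t)"
| LoopT: "R x \<noteq> 0 \<Longrightarrow> big r inp c (R, A, out, k, Suc t) s' \<Longrightarrow> big r inp (Loop x c) s' s'' \<Longrightarrow>
    big r inp (Loop x c) (R, A, out, k, t) s''"

inductive_cases SkipE: "big r inp Skip s s'"
inductive_cases SetE: "big r inp (Set x v) s s'"
inductive_cases IncE: "big r inp (Inc x) s s'"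
inductive_cases DecE: "big r inp (Dec x) s s'"
inductive_cases CopyE: "big r inp (Copy x y) s s'"
inductive_cases PlusE: "big r inp (Plus x y z) s s'"
inductive_cases MinusE: "big r inp (Minus x y z) s s'"
inductive_cases InpE: "big r inp (Inp x y) s s'"
inductive_cases RdE: "big r inp (Rd x f y) s s'"
inductive_cases WrE: "big r inp (Wr f x y) s s'"
inductive_cases MiniE: "big r inp (Mini x y z) s s'"
inductive_cases LessE: "big r inp (Less x y z) s s'"
inductive_cases PrE: "big r inp (Pr x) s s'"
inductive_cases SeqE: "big r inp (c ;; d) s s'"
inductive_cases CondE: "big r inp (Cond x c d) s s'"

section \<open>Total correctness of programs, with cost counters\<close>

text \<open>Asking for an execution to exist makes this total correctness. The state is passed in
  curried form so that \<open>simp\<close> can execute straight-line code symbolically with the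
  equations below.\<close>

definition wp where
  "wp r inp c Q R A out k t \<longleftrightarrow>
     (\<exists>R' A' out' k' t'. big r inp c (R, A, out, k, t) (R', A', out', k', t') \<and> Q R' A' out' k' t')"

lemma wp_simps [simp]:
  "wp r inp Skip Q R A out k t = Q R A out k t"
  "wp r inp (Set x v) Q R A out k t = Q (R(x := v)) A out k t"
  "wp r inp (Inc x) Q R A out k t = Q (R(x := Suc (R x))) A out k t"
  "wp r inp (Dec x) Q R A out k t = Q (R(x := R x - 1)) A out k t"
  "wp r inp (Copy x y) Q R A out k t = Q (R(x := R y)) A out k t"
  "wp r inp (Plus x y z) Q R A out k t = Q (R(x := R y + R z)) A out k t"
  "wp r inp (Minus x y z) Q R A out k t = Q (R(x := R y - R z)) A out k t"
  "wp r inp (Inp x y) Q R A out k t = (R y < length inp \<and> Q (R(x := inp ! R y)) A out k t)"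
  "wp r inp (Rd x f y) Q R A out k t = Q (R(x := A f (R y))) A out k t"
  "wp r inp (Wr f x y) Q R A out k t = Q R (A(f := (A f)(R x := R y))) out k t"
  "wp r inp (Mini x y z) Q R A out k t = Q (R(x := mn2 r (R y) (R z))) A out (Suc k) t"
  "wp r inp (Less x y z) Q R A out k t =
     Q (R(x := (if lt r (R y) (R z) then 1 else 0))) A out (Suc k) t"
  "wp r inp (Pr x) Q R A out k t = Q R A (out @ [R x - 1]) k t"
  "wp r inp (c ;; d) Q R A out k t = wp r inp c (wp r inp d Q) R A out k t"
  "wp r inp (Cond x c d) Q R A out k t =
     (if R x \<noteq> 0 then wp r inp c Q R A out k t else wp r inp d Q R A out k t)"
proof -
  have det: "wp r inp c Q R A out k t = Q R' A' out' k' t'"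
    if "\<And>s'. big r inp c (R, A, out, k, t) s' \<longleftrightarrow> s' = (R', A', out', k', t')" for c R' A' out' k' t'
    unfolding wp_def that by simp
  note [simp] = big.Skip big.Set big.Inc big.Dec big.Copy big.Plus big.Minus big.Inp big.Rd big.Wr
    big.Mini big.Less big.Pr
    big.Dec[unfolded One_nat_def] big.Pr[unfolded One_nat_def]
  show "wp r inp Skip Q R A out k t = Q R A out k t" by (rule det) (auto elim: SkipE)
  show "wp r inp (Set x v) Q R A out k t = Q (R(x := v)) A out k t"
    by (rule det) (auto elim: SetE)
  show "wp r inp (Inc x) Q R A out k t = Q (R(x := Suc (R x))) A out k t"
    by (rule det) (auto elim: IncE)
  show "wp r inp (Dec x) Q R A out k t = Q (R(x := R x - 1)) A out k t"
    unfolding One_nat_def by (rule det) (auto elim: DecE)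
  show "wp r inp (Copy x y) Q R A out k t = Q (R(x := R y)) A out k t"
    by (rule det) (auto elim: CopyE)
  show "wp r inp (Plus x y z) Q R A out k t = Q (R(x := R y + R z)) A out k t"
    by (rule det) (auto elim: PlusE)
  show "wp r inp (Minus x y z) Q R A out k t = Q (R(x := R y - R z)) A out k t"
    by (rule det) (auto elim: MinusE)
  show "wp r inp (Inp x y) Q R A out k t = (R y < length inp \<and> Q (R(x := inp ! R y)) A out k t)"
    unfolding wp_def by (auto elim!: InpE intro!: exI big.Inp)
  show "wp r inp (Rd x f y) Q R A out k t = Q (R(x := A f (R y))) A out k t"
    by (rule det) (auto elim: RdE)
  show "wp r inp (Wr f x y) Q R A out k t = Q R (A(f := (A f)(R x := R y))) out k t"
    by (rule det) (auto elim: WrE)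
  show "wp r inp (Mini x y z) Q R A out k t = Q (R(x := mn2 r (R y) (R z))) A out (Suc k) t"
    by (rule det) (auto elim: MiniE)
  show "wp r inp (Less x y z) Q R A out k t =
      Q (R(x := (if lt r (R y) (R z) then 1 else 0))) A out (Suc k) t"
    by (rule det) (blast elim: LessE intro: big.Less)
  show "wp r inp (Pr x) Q R A out k t = Q R A (out @ [R x - 1]) k t"
    unfolding One_nat_def by (rule det) (auto elim: PrE)
  show "wp r inp (c ;; d) Q R A out k t = wp r inp c (wp r inp d Q) R A out k t"
    unfolding wp_def by (fast elim: SeqE intro: big.Seq)
  show "wp r inp (Cond x c d) Q R A out k t =
      (if R x \<noteq> 0 then wp r inp c Q R A out k t else wp r inp d Q R A out k t)"
  proof -
    have "big r inp (Cond x c d) (R, A, out, k, t) s' \<longleftrightarrow>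
        (if R x \<noteq> 0 then big r inp c (R, A, out, k, t) s' else big r inp d (R, A, out, k, t) s')"
          for s'
      by (auto elim: CondE intro: big.CondT big.CondF)
    then show ?thesis unfolding wp_def by simp
  qed
qed

lemma wp_mono:
  assumes "wp r inp c P R A out k t"
    and "\<And>R' A' out' k' t'. P R' A' out' k' t' \<Longrightarrow> Q R' A' out' k' t'"
  shows "wp r inp c Q R A out k t"
  using assms unfolding wp_def by blast

lemma wp_Loop_exit:
  "R x = 0 \<Longrightarrow> Q R A out k t \<Longrightarrow> wp r inp (Loop x c) Q R A out k t"
  unfolding wp_def using big.LoopF by blast

text \<open>The decreasing measure yields termination. The body starts with \<open>Suc t\<close>
  because the tick of an iteration is charged before its body is executed.\<close>

lemma wp_Loop:
  fixes \<mu> :: "(var \<Rightarrow> nat) \<Rightarrow> (arr \<Rightarrow> nat \<Rightarrow> nat) \<Rightarrow> nat"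
  assumes "I R A out k t"
    and step: "\<And>R A out k t. I R A out k t \<Longrightarrow> R x \<noteq> 0 \<Longrightarrow>
      wp r inp c (\<lambda>R' A' out' k' t'. I R' A' out' k' t' \<and> \<mu> R' A' < \<mu> R A) R A out k (Suc t)"
    and exit: "\<And>R A out k t. I R A out k t \<Longrightarrow> R x = 0 \<Longrightarrow> Q R A out k t"
  shows "wp r inp (Loop x c) Q R A out k t"
  using assms(1)
proof (induction "\<mu> R A" arbitrary: R A out k t rule: less_induct)
  case less
  show ?case
  proof (cases "R x = 0")
    case True
    then show ?thesis by (intro wp_Loop_exit exit less.prems)
  next
    case False
    from step[OF less.prems False] obtain R' A' out' k' t' where
      *: "big r inp c (R, A, out, k, Suc t) (R', A', out', k', t')" "I R' A' out' k' t'"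
        "\<mu> R' A' < \<mu> R A"
      unfolding wp_def by blast
    show ?thesis
      using less.hyps[OF *(3,2)] *(1) big.LoopT[of R x r inp c A out k t] False
      unfolding wp_def by blast
  qed
qed

subsection \<open>Translation to RAM programs\<close>

text \<open>
  Registers 2 to 4 are scratch; 5 holds the address of the first cell behind the input, 6 holds 1
  and 7 holds 0.  The arrays are interleaved behind the input, with stride 32.
\<close>

primrec var_no :: "var \<Rightarrow> nat" where
  "var_no VN = 8" | "var_no VM = 9" | "var_no VX = 10" | "var_no VU = 11" | "var_no VW = 12"
| "var_no VE = 13" | "var_no VT = 14" | "var_no VL = 15" | "var_no VJ = 16" | "var_no VO = 17"
| "var_no VK = 18" | "var_no VF = 19" | "var_no VC = 20" | "var_no VA = 21" | "var_no VB = 22"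
| "var_no VZ = 23" | "var_no VI = 24" | "var_no VH = 25" | "var_no VG = 26"

primrec arr_no :: "arr \<Rightarrow> nat" where
  "arr_no AHead = 0" | "arr_no ANxt = 1" | "arr_no ATgt = 2" | "arr_no ASrc = 3"
| "arr_no ADegA = 4" | "arr_no ADegB = 5" | "arr_no AOrd = 6" | "arr_no APar = 7"
| "arr_no ALev = 8" | "arr_no AP = 9" | "arr_no APidx = 10" | "arr_no ALp = 11"
| "arr_no AIns = 12" | "arr_no ADel = 13" | "arr_no AMn = 14" | "arr_no ALft = 15"
| "arr_no ARgt = 16" | "arr_no AUp = 17" | "arr_no ASA = 18" | "arr_no ASB = 19"
| "arr_no AS = 20" | "arr_no AQ = 21" | "arr_no APw = 22"

lemma var_no_ge: "8 \<le> var_no x"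
  by (cases x) simp_all

lemma var_no_neq [simp]: "n < 8 \<Longrightarrow> var_no x \<noteq> n" "n < 8 \<Longrightarrow> n \<noteq> var_no x"
  using var_no_ge[of x] by auto

text \<open>An explicit left inverse takes one case per variable instead of one per pair of
  variables.\<close>

lemma var_no_eq [simp]: "var_no x = var_no y \<longleftrightarrow> x = y"
proof -
  have "inj var_no"
    by (rule inj_on_inverseI[where g = "\<lambda>n. [VN, VM, VX, VU, VW, VE, VT, VL, VJ, VO, VK, VF, VC,
          VA, VB, VZ, VI, VH, VG] ! (n - 8)"]) (case_tac x; simp)
  then show ?thesis by (auto dest: injD)
qed

lemma arr_no_less: "arr_no f < 32"
  by (cases f) simp_all

lemma arr_no_eq: "arr_no f = arr_no g \<longleftrightarrow> f = g"
proof -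
  have "inj arr_no"
    by (rule inj_on_inverseI[where g = "\<lambda>n. [AHead, ANxt, ATgt, ASrc, ADegA, ADegB, AOrd, APar,
          ALev, AP, APidx, ALp, AIns, ADel, AMn, ALft, ARgt, AUp, ASA, ASB, AS, AQ, APw] ! n"])
      (case_tac x; simp)
  then show ?thesis by (auto dest: injD)
qed

text \<open>The RAM cannot multiply, so the stride of 32 comes from five doublings.\<close>

definition addr_code :: "arr \<Rightarrow> nat \<Rightarrow> instr list" where
  "addr_code f a =
     [Add 2 a a, Add 2 2 2, Add 2 2 2, Add 2 2 2, Add 2 2 2, Const 3 (arr_no f), Add 2 2 3, Add 2 2
       5]"

lemma length_addr_code: "length (addr_code f a) = 8"
  by (simp add: addr_code_def)

text \<open>\<open>l\<close> is the address at which the code is placed, as jump targets are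
  absolute. The lengths needed for the targets are taken of code placed at 0, since placement does
  not affect length.\<close>

fun code :: "nat \<Rightarrow> com \<Rightarrow> instr list" where
  "code l Skip = []"
| "code l (Set x v) = [Const (var_no x) v]"
| "code l (Inc x) = [Add (var_no x) (var_no x) 6]"
| "code l (Dec x) = [Sub (var_no x) (var_no x) 6]"
| "code l (Copy x y) = [Add (var_no x) (var_no y) 7]"
| "code l (Plus x y z) = [Add (var_no x) (var_no y) (var_no z)]"
| "code l (Minus x y z) = [Sub (var_no x) (var_no y) (var_no z)]"
| "code l (Inp x y) = [Load (var_no x) (var_no y)]"
| "code l (Rd x f y) = addr_code f (var_no y) @ [Load (var_no x) 2]"
| "code l (Wr f x y) = addr_code f (var_no x) @ [Store 2 (var_no y)]"
| "code l (Mini x y z) =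
     [JumpZero (var_no y) (l + 7), JumpZero (var_no z) (l + 9), Sub 2 (var_no y) 6,
      Sub 3 (var_no z) 6, Compare 4 2 3, JumpZero 4 (l + 7), Jump (l + 9),
      Add (var_no x) (var_no z) 7, Jump (l + 10), Add (var_no x) (var_no y) 7]"
| "code l (Less x y z) =
     [JumpZero (var_no y) (l + 6), JumpZero (var_no z) (l + 6), Sub 2 (var_no y) 6,
      Sub 3 (var_no z) 6, Compare (var_no x) 2 3, Jump (l + 7), Const (var_no x) 0]"
| "code l (Pr x) = [Sub 2 (var_no x) 6, Print 2]"
| "code l (c ;; d) = code l c @ code (l + length (code l c)) d"
| "code l (Cond x c d) =
     (let lc = length (code 0 c); ld = length (code 0 d)
      in JumpZero (var_no x) (l + lc + 2) # code (l + 1) c @ Jump (l + lc + ld + 2)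
         # code (l + lc + 2) d)"
| "code l (Loop x c) =
     (let lc = length (code 0 c)
      in JumpZero (var_no x) (l + lc + 2) # code (l + 1) c @ [Jump l])"

lemma length_code: "length (code l c) = length (code l' c)"
proof (induction c arbitrary: l l')
  case (Seq c d)
  show ?case
    using Seq.IH(1)[of l l'] Seq.IH(2)[of "l + length (code l c)" "l' + length (code l' c)"] by simp
next
  case (Cond x c d)
  show ?case
    using Cond.IH(1)[of "Suc l" "Suc l'"]
      Cond.IH(2)[of "Suc (Suc (l + length (code 0 c)))" "Suc (Suc (l' + length (code 0 c)))"]
    by (simp add: Let_def)
next
  case (Loop x c)
  show ?case using Loop.IH[of "Suc l" "Suc l'"] by (simp add: Let_def)
qed simp_all

text \<open>Bounds the RAM steps of one pass apart from loop iterations: a basic command takes at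
  most 9, attained by an array access, and the 2 of \<open>Cond\<close> and \<open>Loop\<close> pay
  for the test and the jump.\<close>

fun weight :: "com \<Rightarrow> nat" where
  "weight Skip = 0"
| "weight (c ;; d) = weight c + weight d"
| "weight (Cond x c d) = weight c + weight d + 2"
| "weight (Loop x c) = weight c + 2"
| "weight _ = 9"

section \<open>Simulation of structured programs by their code\<close>

definition code_at :: "instr list \<Rightarrow> nat \<Rightarrow> instr list \<Rightarrow> bool" where
  "code_at P l xs \<longleftrightarrow> (\<forall>i < length xs. l + i < length P \<and> P ! (l + i) = xs ! i)"

lemma code_at_append:
  assumes "code_at P l (xs @ ys)"
  shows "code_at P l xs" "code_at P (l + length xs) ys"
proof -
  show "code_at P l xs"
    using assms unfolding code_at_def by (metis length_append nth_append trans_less_add1)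
  have "l + (length xs + i) < length P \<and> P ! (l + (length xs + i)) = ys ! i" if "i < length ys" for
    i
    using assms that unfolding code_at_def by (metis add_less_cancel_left length_append
      nth_append_length_plus)
  then show "code_at P (l + length xs) ys" unfolding code_at_def by (simp add: add.assoc)
qed

lemma code_at_Cons:
  assumes "code_at P l (x # xs)"
  shows "l < length P" "P ! l = x" "code_at P (Suc l) xs"
  using assms[unfolded code_at_def, rule_format, of 0]
    assms[unfolded code_at_def, rule_format, of "Suc _"]
  unfolding code_at_def by simp_all

text \<open>The comparisons are only bounded above, because a \<open>Mini\<close> or
  \<open>Less\<close> with a null argument is counted in \<open>k\<close> but skips the instruction
  \<open>Compare\<close>. The scratch registers are left unconstrained.\<close>

definition rel :: "nat list \<Rightarrow> st \<Rightarrow> config \<Rightarrow> bool" where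
  "rel inp = (\<lambda>(R, A, out, k, t) c.
     reg c 5 = length inp \<and> reg c 6 = 1 \<and> reg c 7 = 0 \<and> (\<forall>x. reg c (var_no x) = R x) \<and>
     (\<forall>a < length inp. mem c a = inp ! a) \<and>
     (\<forall>f i. mem c (length inp + 32 * i + arr_no f) = A f i) \<and>
     printed c = out \<and> comparisons c \<le> k)"

lemma step_code [simp]:
  "pc c < length P \<Longrightarrow> step P r c = exec r (P ! pc c) c"
  by (simp add: step_def halted_def)

lemma run_0 [simp]: "run P r 0 c = c"
  by (simp add: run_def)

lemma run_Suc [simp]: "run P r (Suc i) c = run P r i (step P r c)"
  by (simp add: run_def funpow_swap1)

lemma run_add: "run P r (i + j) c = run P r j (run P r i c)"
  by (simp add: run_def funpow_add add.commute[of i j])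

definition reaches :: "instr list \<Rightarrow> (nat \<times> nat) set \<Rightarrow> nat list \<Rightarrow> config \<Rightarrow> nat \<Rightarrow> nat \<Rightarrow> st \<Rightarrow> bool"
  where
  "reaches P r inp c w l s \<longleftrightarrow>
     (\<exists>i \<le> w. pc (run P r i c) = l \<and> rel inp s (run P r i c))"

lemma reachesI:
  "i \<le> w \<Longrightarrow> pc (run P r i c) = l \<Longrightarrow> rel inp s (run P r i c) \<Longrightarrow> reaches P r inp c w l s"
  unfolding reaches_def by blast

text \<open>Array numbers are below the stride 32, so residues modulo 32 separate the
  arrays.\<close>

lemma addr_eq: "length inp + 32 * i + arr_no f = length inp + 32 * j + arr_no g \<longleftrightarrow> f = g \<and> i = j"
proof -
  have "f = g \<and> i = j" if "32 * i + arr_no f = 32 * j + arr_no g"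
  proof -
    have "i = j" using that arr_no_less[of f] arr_no_less[of g] by presburger
    then show ?thesis using that arr_no_eq by simp
  qed
  then show ?thesis by auto
qed

lemma code_at_Cons_iff:
  "code_at P l (x # xs) \<longleftrightarrow> l < length P \<and> P ! l = x \<and> code_at P (Suc l) xs"
proof -
  have "code_at P l (x # xs)" if "l < length P" "P ! l = x" "code_at P (Suc l) xs"
    using that unfolding code_at_def by (auto simp: nth_Cons split: nat.split)
  then show ?thesis using code_at_Cons[of P l x xs] by blast
qed

lemma code_at_append_iff:
  "code_at P l (xs @ ys) \<longleftrightarrow> code_at P l xs \<and> code_at P (l + length xs) ys"
  by (induction xs arbitrary: l) (auto simp: code_at_Cons_iff code_at_def[of _ _ "[]"])

lemma run_addr_code:
  assumes "code_at P l (addr_code f a)" "pc c = l" "a \<noteq> 2" "a \<noteq> 3"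
  shows "run P r 8 c = c\<lparr>pc := l + 8,
    reg := (reg c)(3 := arr_no f, 2 := reg c 5 + 32 * reg c a + arr_no f)\<rparr>"
proof -
  have 8: "(8::nat) = Suc (Suc (Suc (Suc (Suc (Suc (Suc (Suc 0)))))))" by simp
  show ?thesis
    using assms unfolding addr_code_def code_at_Cons_iff 8
    by (intro config.equality) (auto simp: fun_eq_iff)
qed

definition ticks :: "st \<Rightarrow> nat" where
  "ticks = (\<lambda>(R, A, out, k, t). t)"

lemma ticks_simp [simp]: "ticks (R, A, out, k, t) = t"
  by (simp add: ticks_def)

lemma reaches_trans:
  assumes "reaches P r inp c w l s"
    and "\<And>c'. pc c' = l \<Longrightarrow> rel inp s c' \<Longrightarrow> reaches P r inp c' w' l' s'"
    and "w + w' \<le> w''"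
  shows "reaches P r inp c w'' l' s'"
proof -
  obtain i where i: "i \<le> w" "pc (run P r i c) = l" "rel inp s (run P r i c)"
    using assms(1) unfolding reaches_def by blast
  obtain j where j: "j \<le> w'" "pc (run P r j (run P r i c)) = l'" "rel inp s' (run P r j (run P r i
    c))"
    using assms(2)[OF i(2,3)] unfolding reaches_def by blast
  show ?thesis using i(1) j assms(3) by (intro reachesI[of "i + j"]) (simp_all add: run_add)
qed

lemma reaches_refl: "rel inp s c \<Longrightarrow> pc c = l \<Longrightarrow> reaches P r inp c w l s"
  by (rule reachesI[of 0]) simp_all

lemma reaches_ex: "reaches P r inp c w l s \<Longrightarrow> \<exists>c'. pc c' = l \<and> rel inp s c'"
  unfolding reaches_def by auto

lemma reaches_weaken: "reaches P r inp c w l s \<Longrightarrow> w \<le> w' \<Longrightarrow> reaches P r inp c w' l s"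
  unfolding reaches_def by (blast intro: le_trans)

lemma reaches_step:
  assumes "pc c < length P" "pc (exec r (P ! pc c) c) = l" "rel inp s (exec r (P ! pc c) c)" "1 \<le> w"
  shows "reaches P r inp c w l s"
  using assms by (intro reachesI[of 1]) simp_all

lemma rel_mem: "rel inp (R, A, out, k, t) c \<Longrightarrow> mem c (length inp + 32 * i + arr_no f) = A f i"
  unfolding rel_def by auto

lemma rel_write:
  assumes "rel inp (R, A, out, k, t) c"
  shows "rel inp (R, A(f := (A f)(i := v)), out, k, t)
    (c\<lparr>mem := (mem c)(length inp + 32 * i + arr_no f := v)\<rparr>)"
  using assms unfolding rel_def by (auto simp: addr_eq)

lemma rel_pc: "rel inp s (c\<lparr>pc := l\<rparr>) = rel inp s c"
  unfolding rel_def by (auto split: prod.splits)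

text \<open>Straight-line code runs without any tick, hence the \<open>+ 1\<close> in the bound;
  every pass through a loop body is paid by the tick of its iteration. Monotonicity of the ticks is
  proved along with the bound because it gives the truncated differences their meaning.\<close>

lemma code_correct:
  assumes "big r inp c s s'"
    and "code_at P l (code l c)" "rel inp s cf" "pc cf = l"
  shows "ticks s \<le> ticks s' \<and>
    reaches P r inp cf (weight c * (ticks s' - ticks s + 1)) (l + length (code l c)) s'"
  using assms
proof (induction arbitrary: l cf rule: big.induct)
  case (Skip s)
  then show ?case by (auto intro: reaches_refl)
next
  case (Set x v R A out k t)
  then show ?case by (auto simp: code_at_Cons_iff rel_def intro!: reaches_step)
next
  case (Inc x R A out k t)
  then show ?case by (auto simp: code_at_Cons_iff rel_def intro!: reaches_step)
next
  case (Dec x R A out k t)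
  then show ?case by (auto simp: code_at_Cons_iff rel_def intro!: reaches_step)
next
  case (Copy x y R A out k t)
  then show ?case by (auto simp: code_at_Cons_iff rel_def intro!: reaches_step)
next
  case (Plus x y z R A out k t)
  then show ?case by (auto simp: code_at_Cons_iff rel_def intro!: reaches_step)
next
  case (Minus x y z R A out k t)
  then show ?case by (auto simp: code_at_Cons_iff rel_def intro!: reaches_step)
next
  case (Inp R y x A out k t)
  then show ?case by (auto simp: code_at_Cons_iff rel_def intro!: reaches_step)
next
  case (Rd x f y R A out k t)
  let ?c = "run P r 8 cf"
  have *: "?c = cf\<lparr>pc := l + 8,
      reg := (reg cf)(3 := arr_no f, 2 := reg cf 5 + 32 * reg cf (var_no y) + arr_no f)\<rparr>"
    using Rd code_at_append by (intro run_addr_code) auto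
  have at: "code_at P (l + 8) [Load (var_no x) 2]"
    using Rd(1) code_at_append(2)[of P l "addr_code f (var_no y)" "[Load (var_no x) 2]"]
    by (simp add: length_addr_code)
  have r8: "reg ?c 2 = length inp + 32 * R y + arr_no f" "pc ?c = l + 8" "rel inp (R, A, out, k, t)
    ?c"
    using Rd(2) unfolding * by (auto simp: rel_def)
  have "reaches P r inp ?c 1 (l + 9) (R(x := A f (R y)), A, out, k, t)"
    using at r8(3) r8(1,2) rel_mem[OF r8(3)]
    by (intro reaches_step) (auto simp: code_at_Cons_iff rel_def)
  then have "reaches P r inp cf 9 (l + 9) (R(x := A f (R y)), A, out, k, t)"
    using reaches_trans[OF reachesI[OF _ r8(2,3)], of 8] unfolding reaches_def
    by (metis One_nat_def Suc_1 add_le_mono le_refl numeral_plus_one run_add semiring_norm(5))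
  then show ?case by (simp add: length_addr_code)
next
  case (Wr f x y R A out k t)
  let ?c = "run P r 8 cf"
  have *: "?c = cf\<lparr>pc := l + 8,
      reg := (reg cf)(3 := arr_no f, 2 := reg cf 5 + 32 * reg cf (var_no x) + arr_no f)\<rparr>"
    using Wr code_at_append by (intro run_addr_code) auto
  have at: "code_at P (l + 8) [Store 2 (var_no y)]"
    using Wr(1) code_at_append(2)[of P l "addr_code f (var_no x)" "[Store 2 (var_no y)]"]
    by (simp add: length_addr_code)
  have r8: "reg ?c 2 = length inp + 32 * R x + arr_no f" "pc ?c = l + 8" "rel inp (R, A, out, k, t)
    ?c"
    using Wr(2) unfolding * by (auto simp: rel_def)
  have ry: "reg ?c (var_no y) = R y" using r8(3) by (simp add: rel_def)
  have "reaches P r inp ?c 1 (l + 9) (R, A(f := (A f)(R x := R y)), out, k, t)"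
    using at r8(1,2) rel_write[OF r8(3), of f "R x" "R y"] ry
    by (intro reaches_step) (auto simp: code_at_Cons_iff rel_def)
  then have "reaches P r inp cf 9 (l + 9) (R, A(f := (A f)(R x := R y)), out, k, t)"
    unfolding reaches_def
    by (metis One_nat_def Suc_1 add_le_mono le_refl numeral_plus_one run_add semiring_norm(5))
  then show ?case by (simp add: length_addr_code)
next
  case (Mini x y z R A out k t)
  have l: "l + 7 = Suc (Suc (Suc (Suc (Suc (Suc (Suc l))))))"
    "l + 9 = Suc (Suc (Suc (Suc (Suc (Suc (Suc (Suc (Suc l))))))))"
    "l + 10 = Suc (Suc (Suc (Suc (Suc (Suc (Suc (Suc (Suc (Suc l)))))))))"
    by simp_all
  note at = Mini(1)[unfolded code.simps code_at_Cons_iff l]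
  have "reaches P r inp cf 9 (l + 10) (R(x := mn2 r (R y) (R z)), A, out, Suc k, t)"
  proof (cases "R y = 0 \<or> R z = 0")
    case True
    then show ?thesis
      using at Mini(2,3) unfolding l
      by (cases "R y = 0"; intro reachesI[of "Suc (Suc (Suc 0))"] reachesI[of "Suc (Suc (Suc 0))"])
        (auto simp: rel_def mn2_def)
  next
    case False
    have "reaches P r inp cf 9 (l + 10) (R(x := (if (R y - 1, R z - 1) \<in> r then R y else R z)), A,
      out, Suc k, t)"
      using at Mini(2,3) False unfolding l
      by (intro reachesI[of "Suc (Suc (Suc (Suc (Suc (Suc (Suc (Suc 0)))))))"]) (auto simp: rel_def)
    then show ?thesis using False by (simp add: mn2_def)
  qed
  then show ?case by (simp add: l)
next
  case (Less x y z R A out k t)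
  have l: "l + 7 = Suc (Suc (Suc (Suc (Suc (Suc (Suc l))))))"
    "l + 6 = Suc (Suc (Suc (Suc (Suc (Suc l)))))"
    by simp_all
  note at = Less(1)[unfolded code.simps code_at_Cons_iff l]
  consider "R y = 0" | "R y \<noteq> 0" "R z = 0" | "R y \<noteq> 0" "R z \<noteq> 0"
    by blast
  then have "reaches P r inp cf 9 (l + 7)
      (R(x := (if lt r (R y) (R z) then 1 else 0)), A, out, Suc k, t)"
  proof cases
    case 1
    then show ?thesis
      using at Less(2,3) unfolding l
      by (intro reachesI[of "Suc (Suc 0)"]) (auto simp: rel_def lt_def)
  next
    case 2
    then show ?thesis
      using at Less(2,3) unfolding l
      by (intro reachesI[of "Suc (Suc (Suc 0))"]) (auto simp: rel_def lt_def)
  next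
    case 3
    then show ?thesis
      using at Less(2,3) unfolding l
      by (intro reachesI[of "Suc (Suc (Suc (Suc (Suc (Suc 0)))))"]) (auto simp: rel_def lt_def)
  qed
  then show ?case by (simp add: l)
next
  case (Pr x R A out k t)
  then show ?case
    by (intro conjI reachesI[of "Suc (Suc 0)"]) (auto simp: code_at_Cons_iff rel_def)
next
  case (Seq c s s' d s'')
  note at = Seq.prems(1)[unfolded code.simps, THEN code_at_append(1)]
    Seq.prems(1)[unfolded code.simps, THEN code_at_append(2)]
  have 1: "ticks s \<le> ticks s'"
    "reaches P r inp cf (weight c * (ticks s' - ticks s + 1)) (l + length (code l c)) s'"
    using Seq.IH(1)[OF at(1) Seq.prems(2,3)] by blast+
  obtain c1 where "rel inp s' c1" "pc c1 = l + length (code l c)"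
    using reaches_ex[OF 1(2)] by blast
  then have 2: "ticks s' \<le> ticks s''" using Seq.IH(2)[OF at(2)] by blast
  have "weight c * (ticks s' - ticks s + 1) + weight d * (ticks s'' - ticks s' + 1)
      \<le> weight c * (ticks s'' - ticks s + 1) + weight d * (ticks s'' - ticks s + 1)"
    using 1 2 by (intro add_mono mult_left_mono) auto
  then have "reaches P r inp cf (weight (c ;; d) * (ticks s'' - ticks s + 1))
      (l + length (code l c) + length (code (l + length (code l c)) d)) s''"
    using Seq.IH(2)[OF at(2)] by (intro reaches_trans[OF 1(2)]) (auto simp: add_mult_distrib)
  then show ?case using 1 2 by (simp add: add.assoc)
next
  case (CondT R x c A out k t s' d)
  let ?s = "(R, A, out, k, t)" and ?m = "l + length (code 0 c)"
  note at = CondT.prems(1)[unfolded code.simps Let_def code_at_Cons_iff code_at_append_iff]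
  have at1: "code_at P (l + 1) (code (l + 1) c)" using at by simp
  have at2: "?m + 1 < length P" "P ! (?m + 1) = Jump (?m + length (code 0 d) + 2)"
    using at by (auto simp: length_code[of "Suc l" c 0])
  have 1: "reaches P r inp cf 1 (l + 1) ?s"
    using at CondT by (intro reaches_step) (auto simp: rel_pc rel_def)
  have IH: "pc c' = l + 1 \<Longrightarrow> rel inp ?s c' \<Longrightarrow> t \<le> ticks s' \<and>
      reaches P r inp c' (weight c * (ticks s' - t + 1)) (?m + 1) s'" for c'
    using CondT.IH[OF at1] by (simp add: length_code[of "Suc l" c 0])
  have 2: "reaches P r inp cf (1 + weight c * (ticks s' - t + 1)) (?m + 1) s'"
    using IH by (intro reaches_trans[OF 1]) auto
  have 3: "reaches P r inp cf (2 + weight c * (ticks s' - t + 1)) (?m + length (code 0 d) + 2) s'"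
    using at2 by (intro reaches_trans[OF 2, where w' = 1] reaches_step) (auto simp: rel_pc)
  have "2 + weight c * (ticks s' - t + 1) \<le> (weight c + weight d + 2) * (ticks s' - t + 1)"
    by (simp add: algebra_simps)
  then have "reaches P r inp cf ((weight c + weight d + 2) * (ticks s' - t + 1))
      (?m + length (code 0 d) + 2) s'"
    by (rule reaches_weaken[OF 3])
  moreover have "t \<le> ticks s'" using reaches_ex[OF 1] IH by blast
  ultimately show ?case
    by (simp add: Let_def length_code[of "Suc l" c 0] length_code[of "Suc (Suc ?m)" d 0] add.assoc)
next
  case (CondF R x d A out k t s' c)
  let ?s = "(R, A, out, k, t)" and ?m = "l + length (code 0 c)"
  note at = CondF.prems(1)[unfolded code.simps Let_def code_at_Cons_iff code_at_append_iff]
  have at1: "code_at P (?m + 2) (code (?m + 2) d)"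
    using at by (auto simp: length_code[of "Suc l" c 0])
  have 1: "reaches P r inp cf 1 (?m + 2) ?s"
    using at CondF by (intro reaches_step) (auto simp: rel_pc rel_def)
  have IH: "pc c' = ?m + 2 \<Longrightarrow> rel inp ?s c' \<Longrightarrow> t \<le> ticks s' \<and>
      reaches P r inp c' (weight d * (ticks s' - t + 1)) (?m + length (code 0 d) + 2) s'" for c'
    using CondF.IH[OF at1] by (simp add: length_code[of "Suc (Suc ?m)" d 0])
  have 2: "reaches P r inp cf (1 + weight d * (ticks s' - t + 1)) (?m + length (code 0 d) + 2) s'"
    using IH by (intro reaches_trans[OF 1]) auto
  have "1 + weight d * (ticks s' - t + 1) \<le> (weight c + weight d + 2) * (ticks s' - t + 1)"
    by (simp add: algebra_simps)
  then have "reaches P r inp cf ((weight c + weight d + 2) * (ticks s' - t + 1))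
      (?m + length (code 0 d) + 2) s'"
    by (rule reaches_weaken[OF 2])
  moreover have "t \<le> ticks s'" using reaches_ex[OF 1] IH by blast
  ultimately show ?case
    by (simp add: Let_def length_code[of "Suc l" c 0] length_code[of "Suc (Suc ?m)" d 0] add.assoc)
next
  case (LoopF R x c A out k t)
  then show ?case by (intro conjI reaches_step)
      (auto simp: code_at_Cons_iff rel_pc Let_def rel_def length_code[of "Suc l" c 0])
next
  case (LoopT R x c A out k t s' s'')
  let ?s = "(R, A, out, k, t)" and ?s1 = "(R, A, out, k, Suc t)" and ?m = "l + length (code 0 c)"
  note at = LoopT.prems(1)[unfolded code.simps Let_def code_at_Cons_iff code_at_append_iff]
  have at1: "code_at P (l + 1) (code (l + 1) c)" using at by simp
  have at2: "?m + 1 < length P" "P ! (?m + 1) = Jump l"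
    using at by (auto simp: length_code[of "Suc l" c 0])
  have 1: "reaches P r inp cf 1 (l + 1) ?s1"
    using at LoopT by (intro reaches_step) (auto simp: rel_pc rel_def)
  have IH: "pc c' = l + 1 \<Longrightarrow> rel inp ?s1 c' \<Longrightarrow> Suc t \<le> ticks s' \<and>
      reaches P r inp c' (weight c * (ticks s' - Suc t + 1)) (?m + 1) s'" for c'
    using LoopT.IH(1)[OF at1] by (simp add: length_code[of "Suc l" c 0])
  have IH2: "pc c' = l \<Longrightarrow> rel inp s' c' \<Longrightarrow> ticks s' \<le> ticks s'' \<and>
      reaches P r inp c' ((weight c + 2) * (ticks s'' - ticks s' + 1)) (?m + 2) s''" for c'
    using LoopT.IH(2)[OF LoopT.prems(1)]
    by (simp add: Let_def length_code[of "Suc l" c 0] del: mult_Suc_right mult_Suc)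
  have 2: "reaches P r inp cf (1 + weight c * (ticks s' - Suc t + 1)) (?m + 1) s'"
    using IH by (intro reaches_trans[OF 1]) auto
  have 3: "reaches P r inp cf (2 + weight c * (ticks s' - Suc t + 1)) l s'"
    using at2 by (intro reaches_trans[OF 2, where w' = 1] reaches_step) (auto simp: rel_pc)
  have t: "Suc t \<le> ticks s'" "ticks s' \<le> ticks s''"
    using reaches_ex[OF 1] reaches_ex[OF 3] IH IH2 by blast+
  \<comment> \<open>With \<open>i\<close> ticks inside the body and \<open>j\<close> in the
    remaining iterations the loop has \<open>i + j + 1\<close>; its own tick pays for the second
    \<open>+ 1\<close> that arises from adding two bounds.\<close>
  define i j where "i = ticks s' - Suc t" and "j = ticks s'' - ticks s'"
  have "ticks s'' - t + 1 = i + 1 + (j + 1)" "ticks s' - Suc t = i" "ticks s'' - ticks s' = j"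
    using t unfolding i_def j_def by auto
  then have "2 + weight c * (ticks s' - Suc t + 1) + (weight c + 2) * (ticks s'' - ticks s' + 1)
      \<le> (weight c + 2) * (ticks s'' - t + 1)"
    by (simp add: algebra_simps)
  then have "reaches P r inp cf ((weight c + 2) * (ticks s'' - t + 1)) (?m + 2) s''"
    using IH2 by (blast intro: reaches_trans[OF 3])
  then show ?case using t by (simp add: Let_def length_code[of "Suc l" c 0])
qed

section \<open>Lower bounds for OPT\<close>

text \<open>Positions in the list determine the order: irreflexivity and transitivity exclude a pair
  that runs against the list.\<close>

lemma lists_in_order_unique:
  assumes "lists_in_order V r xs" "lists_in_order V r' xs"
    and "r \<in> topological_orders V E" "r' \<in> topological_orders V E'"
  shows "r = r'"
proof -
  have "r1 \<subseteq> r2"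
    if r1: "lists_in_order V r1 xs" "r1 \<in> topological_orders V E1" and r2: "lists_in_order V r2 xs"
    for r1 r2 E1
  proof (rule subrelI)
    fix u v
    assume uv: "(u, v) \<in> r1"
    have ir: "irrefl r1" "trans r1" "r1 \<subseteq> V \<times> V"
      using r1(2) by (auto simp: topological_orders_def strict_linear_order_on_def)
    have "u \<in> set xs" "v \<in> set xs" using uv ir(3) r1(1) by (auto simp: lists_in_order_def)
    then obtain i j where ij: "i < length xs" "xs ! i = u" "j < length xs" "xs ! j = v"
      by (auto simp: in_set_conv_nth)
    have "\<not> j \<le> i"
    proof
      assume "j \<le> i"
      then have "u = v \<or> (v, u) \<in> r1"
        using ij r1(1) by (cases "i = j") (auto simp: lists_in_order_def sorted_wrt_iff_nth_less)
      then show False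
        using uv ir(1,2) by (metis irreflD transD)
    qed
    then show "(u, v) \<in> r2"
      using ij r2 by (auto simp: lists_in_order_def sorted_wrt_iff_nth_less)
  qed
  then show ?thesis using assms by (metis subset_antisym)
qed

text \<open>A query splits \<open>S\<close> into two parts, and each subtree separates the orders of
  its part with one query less.\<close>

lemma card_le_two_pow_queries:
  assumes "finite S" "inj_on (answer t) S" "\<And>r. r \<in> S \<Longrightarrow> queries t r \<le> d"
  shows "card S \<le> 2 ^ d"
  using assms
proof (induction t arbitrary: S d)
  case (Leaf xs)
  then have "card S \<le> 1" by (auto simp: card_le_Suc0_iff_eq inj_on_def)
  then show ?case using le_trans one_le_numeral one_le_power by blast
next
  case (Query x y t u)
  let ?T = "{r \<in> S. (x, y) \<in> r}" and ?U = "{r \<in> S. (x, y) \<notin> r}"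
  show ?case
  proof (cases "S = {}")
    case False
    then obtain d' where d: "d = Suc d'"
      using Query.prems(3) by (metis Suc_le_D all_not_in_conv queries.simps(2))
    have "card ?T \<le> 2 ^ d'"
    proof (rule Query.IH(1))
      show "inj_on (answer t) ?T" using Query.prems(2) by (auto simp: inj_on_def)
      show "queries t r \<le> d'" if "r \<in> ?T" for r
        using Query.prems(3)[of r] that by (simp add: d)
    qed (use Query.prems(1) in simp)
    moreover have "card ?U \<le> 2 ^ d'"
    proof (rule Query.IH(2))
      show "inj_on (answer u) ?U" using Query.prems(2) by (auto simp: inj_on_def)
      show "queries u r \<le> d'" if "r \<in> ?U" for r
        using Query.prems(3)[of r] that by (simp add: d)
    qed (use Query.prems(1) in simp)
    moreover have "S = ?T \<union> ?U" by blast
    then have "card S = card (?T \<union> ?U)" by (rule arg_cong)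
    then have "card S \<le> card ?T + card ?U" using card_Un_le[of ?T ?U] by linarith
    ultimately show ?thesis by (simp add: d)
  qed simp
qed

text \<open>The infimum is attained, being over a nonempty set of naturals. An optimal tree answers
  differently for different orders, since an answer determines its order.\<close>

lemma card_topological_orders_le:
  assumes "finite V"
  shows "card (topological_orders V E) \<le> 2 ^ OPT V E"
proof -
  let ?S = "topological_orders V E"
  have "(\<lambda>t. worst_case_queries t V E) ` {t. sorts t V E} \<noteq> {}"
    using ex_sorts[OF assms] by blast
  from Inf_nat_def1[OF this] obtain t where t: "sorts t V E" "OPT V E = worst_case_queries t V E"
    unfolding OPT_def by auto
  have "inj_on (answer t) ?S"
  proof (rule inj_onI)
    fix r r'
    assume *: "r \<in> ?S" "r' \<in> ?S" "answer t r = answer t r'"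
    then have "lists_in_order V r (answer t r)" "lists_in_order V r' (answer t r)"
      using t(1) by (auto simp: sorts_def)
    then show "r = r'" using lists_in_order_unique * by blast
  qed
  moreover have "queries t r \<le> OPT V E" if "r \<in> ?S" for r
    unfolding t(2) worst_case_queries_def using that finite_topological_orders[OF assms] by simp
  ultimately show ?thesis
    using card_le_two_pow_queries finite_topological_orders[OF assms] by blast
qed

section \<open>Constructing many consistent orders\<close>

text \<open>Ties are broken by item number, so any key function yields a total order, and
  consistency only asks for strict increase along the arcs.\<close>

definition key_order :: "nat \<Rightarrow> (nat \<Rightarrow> nat) \<Rightarrow> (nat \<times> nat) set" where
  "key_order n f = {(u, v). u < n \<and> v < n \<and> (f u < f v \<or> f u = f v \<and> u < v)}"

lemma key_order_topological:
  assumes "E \<subseteq> {..<n} \<times> {..<n}" "\<And>u v. (u, v) \<in> E \<Longrightarrow> f u < f v"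
  shows "key_order n f \<in> topological_orders {..<n} E"
proof -
  have "trans (key_order n f)" by (auto simp: key_order_def trans_def)
  moreover have "irrefl (key_order n f)" by (auto simp: key_order_def irrefl_def)
  moreover have "total_on {..<n} (key_order n f)" by (auto simp: key_order_def total_on_def)
  ultimately show ?thesis
    using assms by (auto simp: topological_orders_def strict_linear_order_on_def key_order_def)
qed

text \<open>The value at an item is the element of the image that has as many smaller ones as the
  rank of the item, so image and order determine the map.\<close>

lemma strict_mono_image_unique:
  fixes f g :: "'a \<Rightarrow> nat"
  assumes "finite K" "total_on K r" "irrefl r"
    and f: "\<And>x y. x \<in> K \<Longrightarrow> y \<in> K \<Longrightarrow> (x, y) \<in> r \<Longrightarrow> f x < f y"
    and g: "\<And>x y. x \<in> K \<Longrightarrow> y \<in> K \<Longrightarrow> (x, y) \<in> r \<Longrightarrow> g x < g y"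
    and "f ` K = g ` K" "x \<in> K"
  shows "f x = g x"
proof -
  have rank: "card {s \<in> h ` K. s < h x} = card {y \<in> K. (y, x) \<in> r}"
    if h: "\<And>x y. x \<in> K \<Longrightarrow> y \<in> K \<Longrightarrow> (x, y) \<in> r \<Longrightarrow> h x < h y" for h :: "'a \<Rightarrow> nat"
  proof -
    have "(y, x) \<in> r" if "y \<in> K" "h y < h x" for y
    proof (rule ccontr)
      assume "(y, x) \<notin> r"
      then have "(x, y) \<in> r" using that assms(2,7) by (metis less_irrefl total_on_def)
      then show False
        using h[of x y] that assms(7) by simp
    qed
    then have "{s \<in> h ` K. s < h x} = h ` {y \<in> K. (y, x) \<in> r}" using h assms(7) by auto
    moreover have "inj_on h {y \<in> K. (y, x) \<in> r}"
    proof (rule inj_onI)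
      fix y z
      assume "y \<in> {y \<in> K. (y, x) \<in> r}" "z \<in> {y \<in> K. (y, x) \<in> r}" "h y = h z"
      then show "y = z"
        using h[of y z] h[of z y] assms(2) by (metis (no_types, lifting) less_irrefl mem_Collect_eq
          total_on_def)
    qed
    ultimately show ?thesis by (simp add: card_image)
  qed
  let ?B = "\<lambda>h. {s \<in> h ` K. s < h x}"
  have "card (?B f) = card (?B g)" using rank[of f, OF f] rank[of g, OF g] by simp
  moreover have sub: "{s \<in> f ` K. s < f x} \<subset> {s \<in> g ` K. s < g x}"
    if "f x < g x" "f ` K = g ` K" for f g :: "'a \<Rightarrow> nat"
  proof
    show "{s \<in> f ` K. s < f x} \<subseteq> {s \<in> g ` K. s < g x}" using that by auto
    have "f x \<in> {s \<in> g ` K. s < g x}"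
      using that assms(7) by (metis (no_types, lifting) imageI mem_Collect_eq)
    then show "{s \<in> f ` K. s < f x} \<noteq> {s \<in> g ` K. s < g x}"
      by (metis (no_types, lifting) less_irrefl mem_Collect_eq)
  qed
  moreover have "finite (?B f)" "finite (?B g)" using assms(1) by simp_all
  ultimately show ?thesis
    using sub[of f g] sub[of g f] assms(6) psubset_card_mono[of "?B f" "?B g"]
      psubset_card_mono[of "?B g" "?B f"]
    by (cases "f x" "g x" rule: linorder_cases) auto
qed

lemma card_PiE_interval:
  "finite K \<Longrightarrow> card (PiE K (\<lambda>x. {a x..b x})) = (\<Prod>x\<in>K. Suc (b x) - a x)"
  by (simp add: card_PiE)

text \<open>
  Every item of \<open>K\<close> can be placed before or after the item outside \<open>K\<close> on its level, independently
  of the others.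
\<close>

lemma two_pow_le_card_topological_orders:
  fixes n :: nat and lev :: "nat \<Rightarrow> nat"
  assumes E: "E \<subseteq> {..<n} \<times> {..<n}" "\<And>u v. (u, v) \<in> E \<Longrightarrow> lev u < lev v"
    and K: "K \<subseteq> {..<n}" "\<And>x. x \<in> K \<Longrightarrow> \<exists>y<n. y \<notin> K \<and> lev y = lev x"
  shows "2 ^ card K \<le> card (topological_orders {..<n} E)"
proof -
  \<comment> \<open>Each level is split into three slots: the items of \<open>S\<close>, then the
    items outside \<open>K\<close>, then the rest of \<open>K\<close>. The item outside
    \<open>K\<close> on the level of \<open>x\<close> thus reveals whether \<open>x\<close> is in
    \<open>S\<close>.\<close>
  define f where "f S v = 3 * lev v + (if v \<in> K then if v \<in> S then 0 else 2 else 1)" for S v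
  have "key_order n (f S) \<in> topological_orders {..<n} E" for S
    using E by (intro key_order_topological) (fastforce simp: f_def)+
  moreover have "inj_on (\<lambda>S. key_order n (f S)) (Pow K)"
  proof -
    have "S \<subseteq> S'" if S: "S \<subseteq> K" "key_order n (f S) = key_order n (f S')" for S S'
    proof
      fix x
      assume x: "x \<in> S"
      then obtain y where y: "y < n" "y \<notin> K" "lev y = lev x" using K(2)[of x] S by blast
      then have "(x, y) \<in> key_order n (f S)"
        using x K(1) S(1) by (auto simp: key_order_def f_def)
      then have "(x, y) \<in> key_order n (f S')" using S(2) by simp
      then have "f S' x \<le> f S' y" by (auto simp: key_order_def)
      then show "x \<in> S'" using x y S(1) by (auto simp: f_def split: if_splits)
    qed
    note sub = this
    show ?thesis
    proof (rule inj_onI)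
      fix S S'
      assume "S \<in> Pow K" "S' \<in> Pow K" "key_order n (f S) = key_order n (f S')"
      then show "S = S'" using sub[of S S'] sub[of S' S] by auto
    qed
  qed
  ultimately have "card (Pow K) \<le> card (topological_orders {..<n} E)"
    by (intro card_inj_on_le finite_topological_orders) auto
  then show ?thesis using finite_subset[OF K(1)] by (simp add: card_Pow)
qed

text \<open>
  The intervals of two comparable items are disjoint, so any choice of one point in each interval
  yields a consistent order.  The order and the set of the numbers \<open>g x + rank x\<close> determine the
  choice \<open>g\<close>.
\<close>

lemma prod_lifetimes_le:
  fixes n :: nat and a b p :: "nat \<Rightarrow> nat"
  assumes E: "E \<subseteq> {..<n} \<times> {..<n}" and K: "K \<subseteq> {..<n}"
    and KK: "\<And>u v. (u, v) \<in> E \<Longrightarrow> u \<in> K \<Longrightarrow> v \<in> K \<Longrightarrow> b u < a v"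
    and KP: "\<And>u v. (u, v) \<in> E \<Longrightarrow> u \<in> K \<Longrightarrow> v \<notin> K \<Longrightarrow> b u \<le> b v"
    and PK: "\<And>u v. (u, v) \<in> E \<Longrightarrow> u \<notin> K \<Longrightarrow> v \<in> K \<Longrightarrow> b u < a v"
    and PP: "\<And>u v. (u, v) \<in> E \<Longrightarrow> u \<notin> K \<Longrightarrow> v \<notin> K \<Longrightarrow> b u \<le> b v \<and> p u < p v"
    and p: "\<And>u. p u \<le> n" and b: "\<And>x. x \<in> K \<Longrightarrow> b x \<le> card K"
  shows "(\<Prod>x\<in>K. Suc (b x) - a x) \<le> card (topological_orders {..<n} E) * 2 ^ (2 * card K)"
proof -
  have fin: "finite K" using K by (rule finite_subset) simp
  define G where "G = PiE K (\<lambda>x. {a x..b x})"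
  \<comment> \<open>Keys consist of a high part, in steps of \<open>Suc n\<close>, and a low part of
    at most n. The high part is even for items of \<open>K\<close> and odd for the others, which
    puts the latter right after all choices up to \<open>b v\<close>; the low part \<open>p\<close>
    orders those that share a high part.\<close>
  define f where "f g v = (if v \<in> K then 2 * Suc n * g v else (2 * b v + 1) * Suc n + p v)" for g v
  define o' where "o' g = key_order n (f g)" for g
  \<comment> \<open>\<open>g\<close> may take the same value on different items; adding the rank
    within \<open>K\<close> makes it strictly increasing along the order, with values below
    \<open>2 * card K\<close>.\<close>
  define rk where "rk g x = card {y \<in> K. (y, x) \<in> o' g}" for g x
  \<comment> \<open>The second component has at most \<open>2 ^ (2 * card K)\<close> values. This is
    the price for recovering \<open>g\<close>, which the order alone may not determine.\<close>
  define \<phi> where "\<phi> g = (o' g, (\<lambda>x. g x + rk g x) ` K)" for g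
  have G: "a x \<le> g x" "g x \<le> b x" if "g \<in> G" "x \<in> K" for g x
    using that by (auto simp: G_def PiE_iff)
  have f_less: "f g u < f g v" if g: "g \<in> G" and uv: "(u, v) \<in> E" for g u v
  proof -
    have mono: "i < j \<Longrightarrow> i * Suc n + n < j * Suc n" for i j
      using mult_le_mono1[of "Suc i" j "Suc n"] by simp
    consider "u \<in> K" "v \<in> K" | "u \<in> K" "v \<notin> K" | "u \<notin> K" "v \<in> K" | "u \<notin> K" "v \<notin> K"
      by blast
    then show ?thesis
    proof cases
      case 1
      then have "2 * g u < 2 * g v"
        using KK[OF uv] G[OF g] by (meson le_less_trans less_le_trans mult_less_mono2
          zero_less_numeral)
      then show ?thesis using 1 mono[of "2 * g u" "2 * g v"] by (simp add: f_def ac_simps)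
    next
      case 2
      then have "2 * g u < 2 * b v + 1" using KP[OF uv] G[OF g, of u] by simp
      then show ?thesis using 2 mono[of "2 * g u" "2 * b v + 1"] by (simp add: f_def ac_simps)
    next
      case 3
      then have "2 * b u + 1 < 2 * g v" using PK[OF uv] G[OF g, of v] by simp
      then show ?thesis
        using 3 mono[of "2 * b u + 1" "2 * g v"] p[of u] by (simp add: f_def ac_simps)
    next
      case 4
      then have "(2 * b u + 1) * Suc n \<le> (2 * b v + 1) * Suc n"
        using PP[OF uv] by (intro mult_le_mono1) simp
      then show ?thesis using 4 PP[OF uv] by (simp add: f_def)
    qed
  qed
  then have o': "o' g \<in> topological_orders {..<n} E" if "g \<in> G" for g
    using E that unfolding o'_def by (intro key_order_topological) auto
  have strict: "g x + rk g x < g y + rk g y"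
    if "x \<in> K" "y \<in> K" "(x, y) \<in> o' g" for g x y
  proof -
    have "f g x \<le> f g y" using that(3) by (auto simp: o'_def key_order_def)
    then have "g x \<le> g y" using that by (simp add: f_def del: mult_Suc mult_Suc_right)
    moreover have "rk g x < rk g y"
      unfolding rk_def
    proof (rule psubset_card_mono)
      have "x \<in> {z \<in> K. (z, y) \<in> o' g}" "x \<notin> {z \<in> K. (z, x) \<in> o' g}"
        using that by (auto simp: o'_def key_order_def)
      moreover have "{z \<in> K. (z, x) \<in> o' g} \<subseteq> {z \<in> K. (z, y) \<in> o' g}"
        using that by (auto simp: o'_def key_order_def)
      ultimately show "{z \<in> K. (z, x) \<in> o' g} \<subset> {z \<in> K. (z, y) \<in> o' g}" by blast
    qed (use fin in simp)
    ultimately show ?thesis by simp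
  qed
  have "inj_on \<phi> G"
  proof (rule inj_onI)
    fix g h
    assume gh: "g \<in> G" "h \<in> G" "\<phi> g = \<phi> h"
    then have o: "o' g = o' h" and im: "(\<lambda>x. g x + rk g x) ` K = (\<lambda>x. h x + rk h x) ` K"
      by (auto simp: \<phi>_def)
    have "total_on K (o' g)" "irrefl (o' g)"
      using K by (auto simp: o'_def key_order_def total_on_def irrefl_def)
    then have "g x + rk g x = h x + rk h x" if "x \<in> K" for x
      using strict[of _ _ g] strict[of _ _ h] o
      by (intro strict_mono_image_unique[OF fin _ _ _ _ im that]) auto
    moreover have "rk g = rk h" using o by (auto simp: rk_def fun_eq_iff)
    ultimately have "g x = h x" if "x \<in> K" for x
      using that by simp
    then show "g = h" using gh(1,2) unfolding G_def by (intro PiE_ext[of g K _ h]) auto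
  qed
  moreover have "\<phi> ` G \<subseteq> topological_orders {..<n} E \<times> Pow {..<2 * card K}"
  proof -
    have "g x + rk g x < 2 * card K" if "g \<in> G" "x \<in> K" for g x
    proof -
      have "x \<notin> {y \<in> K. (y, x) \<in> o' g}" by (simp add: o'_def key_order_def)
      then have "rk g x < card K"
        unfolding rk_def using that fin by (intro psubset_card_mono) auto
      then show ?thesis using G[OF that] b[OF that(2)] by simp
    qed
    then show ?thesis using o' by (auto simp: \<phi>_def)
  qed
  ultimately have "card G \<le> card (topological_orders {..<n} E \<times> Pow {..<2 * card K})"
    by (intro card_inj_on_le finite_cartesian_product finite_topological_orders) auto
  then show ?thesis
    unfolding G_def card_PiE_interval[OF fin] by (simp add: card_cartesian_product card_Pow)
qed

text \<open>The items outside \<open>K\<close> serve as markers: between two different gaps in the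
  range of an item lies one of them, so a choice of gaps is recovered from the order itself and no
  extra factor arises. Items of \<open>K\<close> that choose the same gap are ordered by
  \<open>q\<close>.\<close>

lemma prod_gaps_le:
  fixes n :: nat and a b p q :: "nat \<Rightarrow> nat"
  assumes E: "E \<subseteq> {..<n} \<times> {..<n}" and K: "K \<subseteq> {..<n}"
    and KK: "\<And>u v. (u, v) \<in> E \<Longrightarrow> u \<in> K \<Longrightarrow> v \<in> K \<Longrightarrow> q u < q v \<and> b u \<le> a v"
    and KP: "\<And>u v. (u, v) \<in> E \<Longrightarrow> u \<in> K \<Longrightarrow> v \<notin> K \<Longrightarrow> b u < p v"
    and PK: "\<And>u v. (u, v) \<in> E \<Longrightarrow> u \<notin> K \<Longrightarrow> v \<in> K \<Longrightarrow> p u \<le> a v"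
    and PP: "\<And>u v. (u, v) \<in> E \<Longrightarrow> u \<notin> K \<Longrightarrow> v \<notin> K \<Longrightarrow> p u < p v"
    and q: "\<And>x. x \<in> K \<Longrightarrow> 1 \<le> q x \<and> q x \<le> m"
    and p: "\<And>x j. x \<in> K \<Longrightarrow> a x < j \<Longrightarrow> j \<le> b x \<Longrightarrow> \<exists>y<n. y \<notin> K \<and> p y = j"
  shows "(\<Prod>x\<in>K. Suc (b x) - a x) \<le> card (topological_orders {..<n} E)"
proof -
  have fin: "finite K" using K by (rule finite_subset) simp
  define G where "G = PiE K (\<lambda>x. {a x..b x})"
  \<comment> \<open>As \<open>q\<close> is positive on \<open>K\<close>, an item that chooses gap
    \<open>j\<close> comes strictly after the marker of position \<open>j\<close>, and as
    \<open>q\<close> is at most \<open>m\<close> it comes before the next one.\<close>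
  define f where "f g v = (if v \<in> K then g v * Suc m + q v else p v * Suc m)" for g v
  have G: "a x \<le> g x" "g x \<le> b x" if "g \<in> G" "x \<in> K" for g x
    using that by (auto simp: G_def PiE_iff)
  have mono: "i < j \<Longrightarrow> i * Suc m + m < j * Suc m" for i j
    using mult_le_mono1[of "Suc i" j "Suc m"] by simp
  have f_less: "f g u < f g v" if g: "g \<in> G" and uv: "(u, v) \<in> E" for g u v
  proof -
    have le: "i \<le> j \<Longrightarrow> i * Suc m \<le> j * Suc m" for i j
      by (rule mult_le_mono1)
    consider "u \<in> K" "v \<in> K" | "u \<in> K" "v \<notin> K" | "u \<notin> K" "v \<in> K" | "u \<notin> K" "v \<notin> K"
      by blast
    then show ?thesis
    proof cases
      case 1
      then show ?thesis
        using le[of "g u" "g v"] KK[OF uv] G[OF g, of u] G[OF g, of v] by (simp add: f_def)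
    next
      case 2
      then show ?thesis
        using mono[of "g u" "p v"] KP[OF uv] G[OF g, of u] q[of u] by (simp add: f_def)
    next
      case 3
      then show ?thesis
        using le[of "p u" "g v"] PK[OF uv] G[OF g, of v] q[of v] by (simp add: f_def)
    next
      case 4
      then show ?thesis using mono[of "p u" "p v"] PP[OF uv] by (simp add: f_def)
    qed
  qed
  have inj: "g x \<le> h x" if gh: "g \<in> G" "h \<in> G" "x \<in> K" "key_order n (f g) = key_order n (f h)" for g
    h x
  proof (rule ccontr)
    assume "\<not> ?thesis"
    \<comment> \<open>Under \<open>g\<close> this marker precedes \<open>x\<close>, under
      \<open>h\<close> it follows \<open>x\<close>.\<close>
    then obtain y where y: "y < n" "y \<notin> K" "p y = g x" "h x < g x"
      using p[of x "g x"] G[of g x] G[of h x] gh by auto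
    then have "(y, x) \<in> key_order n (f g)"
      using q[of x] gh(3) K by (auto simp: key_order_def f_def)
    then have "(y, x) \<in> key_order n (f h)" using gh(4) by simp
    then have "f h y \<le> f h x" by (auto simp: key_order_def)
    then show False
      using y gh(3) q[of x] mono[of "h x" "g x"] by (simp add: f_def)
  qed
  have "inj_on (\<lambda>g. key_order n (f g)) G"
  proof (rule inj_onI)
    fix g h
    assume gh: "g \<in> G" "h \<in> G" "key_order n (f g) = key_order n (f h)"
    then have "g x = h x" if "x \<in> K" for x
      using inj[of g h x] inj[of h g x] that by simp
    then show "g = h" using gh(1,2) unfolding G_def by (intro PiE_ext[of g K _ h]) auto
  qed
  moreover have "(\<lambda>g. key_order n (f g)) ` G \<subseteq> topological_orders {..<n} E"
    using key_order_topological[OF E] f_less by blast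
  ultimately have "card G \<le> card (topological_orders {..<n} E)"
    by (intro card_inj_on_le finite_topological_orders) auto
  then show ?thesis
    unfolding G_def card_PiE_interval[OF fin] .
qed

section \<open>A priority queue whose deletions are cheap for recently inserted items\<close>

text \<open>
  The queue is a list of levels.  Level \<open>i\<close> consists of at most two complete binary tournament trees
  of height \<open>i\<close>, the older one in \<open>sA i\<close> and the newer one in \<open>sB i\<close>; \<open>S i\<close> is the minimum over the
  levels from \<open>i\<close> on.  When level \<open>i\<close> overflows, its two older trees are merged into a tree of the
  next level.  As one tree stays behind, an item on level \<open>i\<close> is followed by at least \<open>2 ^ i - 1\<close>
  later insertions.  Leaves are the items \<open>1..n\<close>, inner nodes are \<open>n + 1..F\<close>.
\<close>

definition suffix_loop :: com where
  "suffix_loop = Loop VI (Rd VT AS VI ;; Dec VI ;; Rd VA ASA VI ;; Rd VA AMn VA ;; Rd VB ASB VI ;;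
     Rd VB AMn VB ;; Mini VA VA VB ;; Mini VT VT VA ;; Wr AS VI VT)"

text \<open>A binary counter with digits up to 2: a full level keeps the incoming tree as its older
  one and passes the merger of its two previous trees upwards. A carry therefore never empties a
  level.\<close>

definition carry_loop :: com where
  "carry_loop = Loop VB (Rd VA ASA VI ;; Inc VF ;; Wr ALft VF VA ;; Wr ARgt VF VB ;; Wr AUp VA VF ;;
     Wr AUp VB VF ;; Rd VT AMn VA ;; Rd VL AMn VB ;; Mini VT VT VL ;; Wr AMn VF VT ;; Wr ASA VI VZ
       ;;
     Set VT 0 ;; Wr ASB VI VT ;; Copy VZ VF ;; Inc VI ;; Rd VB ASB VI)"

text \<open>The carry stops at level \<open>VI\<close>, and no slot above has changed. As
  \<open>suffix_loop\<close> reads entry \<open>VI\<close> before it decrements, the final increment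
  lets it start from an entry that is still valid.\<close>

definition insert_item :: com where
  "insert_item = Inc VC ;; Wr AIns VW VC ;; Wr AMn VW VW ;; Copy VZ VW ;; Set VI 0 ;; Rd VB ASB VI
    ;;
     carry_loop ;; Rd VA ASA VI ;; Cond VA (Wr ASB VI VZ) (Wr ASA VI VZ) ;; Inc VI ;; suffix_loop"

definition climb_loop :: com where
  "climb_loop = Loop VZ (Rd VA ALft VZ ;; Rd VA AMn VA ;; Rd VB ARgt VZ ;; Rd VB AMn VB ;;
     Mini VA VA VB ;; Wr AMn VZ VA ;; Inc VI ;; Rd VZ AUp VZ)"

text \<open>The leaf is emptied instead of removed, so the shape of the forest depends on the
  insertions alone and the height bounds survive deletions.\<close>

definition delete_item :: com where
  "delete_item = Set VT 0 ;; Wr AMn VU VT ;; Set VI 0 ;; Rd VZ AUp VU ;; climb_loop ;; Inc VI ;;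
     suffix_loop"

section \<open>Shape of the forest and ages of its trees\<close>

text \<open>The number of leaves on the levels below \<open>i\<close> when each of these has its
  older tree, as is the case below an occupied slot. In the invariant they stand for insertions
  later than those of level \<open>i\<close>.\<close>

definition newer_span :: "(nat \<Rightarrow> nat) \<Rightarrow> nat \<Rightarrow> nat" where
  "newer_span sB i = (\<Sum>j<i. 2 ^ j * (if sB j \<noteq> 0 then 2 else 1))"

lemma newer_span_upd_ge [simp]: "i \<le> I \<Longrightarrow> newer_span (sB(I := v)) i = newer_span sB i"
  unfolding newer_span_def by (rule sum.cong) auto

lemma newer_span_upd:
  assumes "I < i" "sB I = 0" "v \<noteq> 0"
  shows "newer_span (sB(I := v)) i = newer_span sB i + 2 ^ I"
proof -
  have "newer_span s i = 2 ^ I * (if s I \<noteq> 0 then 2 else 1) +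
      (\<Sum>j\<in>{..<i} - {I}. 2 ^ j * (if s j \<noteq> 0 then 2 else 1))" for s :: "nat \<Rightarrow> nat"
    unfolding newer_span_def using assms(1) by (intro sum.remove) auto
  moreover have "(\<Sum>j\<in>{..<i} - {I}. 2 ^ j * (if (sB(I := v)) j \<noteq> 0 then 2 else 1)) =
      (\<Sum>j\<in>{..<i} - {I}. 2 ^ j * (if sB j \<noteq> 0 then 2 else (1::nat)))"
    by (rule sum.cong) auto
  ultimately show ?thesis using assms(2,3) by simp
qed

lemma sum_two_pow_Suc: "Suc (\<Sum>j<i. 2 ^ j) = (2::nat) ^ i"
  by (induction i) auto

lemma newer_span_ge: "2 ^ i \<le> Suc (newer_span sB i)"
proof -
  have "(\<Sum>j<i. 2 ^ j) \<le> newer_span sB i" unfolding newer_span_def by (rule sum_mono) auto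
  then show ?thesis using sum_two_pow_Suc[of i] by simp
qed

lemma newer_span_single: "(\<And>j. j < I \<Longrightarrow> sB j = 0) \<Longrightarrow> Suc (newer_span sB I) = 2 ^ I"
  unfolding newer_span_def using sum_two_pow_Suc[of I] by simp

text \<open>
  \<open>h z\<close> is the height of the node \<open>z\<close>, and \<open>hi z\<close> bounds the insertion numbers below \<open>z\<close>.
  If \<open>Z \<noteq> 0\<close>, then \<open>Z\<close> is a tree that is being carried to level \<open>I\<close>.
\<close>

locale forest =
  fixes n :: nat and In :: "nat set" and F c :: nat and lft rgt up sA sB ins h hi :: "nat \<Rightarrow> nat"
    and Z I :: nat
  assumes In: "In \<subseteq> {1..n}"
    and F: "n \<le> F"
    and children: "n < z \<Longrightarrow> z \<le> F \<Longrightarrow> lft z \<in> In \<union> {n<..F} \<and> rgt z \<in> In \<union> {n<..F} \<and>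
      lft z < z \<and> rgt z < z \<and> up (lft z) = z \<and> up (rgt z) = z"
    and parent: "z \<in> In \<union> {n<..F} \<Longrightarrow> up z \<noteq> 0 \<Longrightarrow> up z \<le> F \<and> n < up z \<and> z < up z \<and>
      (lft (up z) = z \<or> rgt (up z) = z) \<and> h (up z) = Suc (h z) \<and> hi z \<le> hi (up z)"
    and fresh: "z \<notin> In \<union> {n<..F} \<Longrightarrow> up z = 0"
    and leaf: "x \<in> In \<Longrightarrow> h x = 0 \<and> hi x = ins x"
    and root: "z \<in> In \<union> {n<..F} \<Longrightarrow> up z = 0 \<Longrightarrow> z = Z \<or> sA (h z) = z \<or> sB (h z) = z"
    and slotA: "sA i \<noteq> 0 \<Longrightarrow> sA i \<in> In \<union> {n<..F} \<and> up (sA i) = 0 \<and> h (sA i) = i \<and>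
      hi (sA i) + newer_span sB i + (if Z \<noteq> 0 \<and> I \<le> i then 2 ^ I else 0) \<le> c"
    and slotB: "sB i \<noteq> 0 \<Longrightarrow> sB i \<in> In \<union> {n<..F} \<and> up (sB i) = 0 \<and> h (sB i) = i \<and>
      hi (sB i) + newer_span sB i + (if Z \<noteq> 0 \<and> I \<le> i then 2 ^ I else 0) \<le> c"
    and slotAB: "sB i \<noteq> 0 \<Longrightarrow> sA i \<noteq> 0 \<and> sA i \<noteq> sB i"
    and contiguous: "sA (Suc i) \<noteq> 0 \<Longrightarrow> sA i \<noteq> 0"
    and bounded: "\<exists>L. \<forall>i\<ge>L. sA i = 0"
    and count: "F + card {i. sB i \<noteq> 0} + (if Z \<noteq> 0 then 1 else 0) \<le> n + c"
    and carried: "Z \<noteq> 0 \<Longrightarrow> Z \<in> In \<union> {n<..F} \<and> up Z = 0 \<and> h Z = I \<and> hi Z + 2 ^ I \<le> Suc c"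
    and not_slot: "Z \<noteq> 0 \<Longrightarrow> sA i \<noteq> Z \<and> sB i \<noteq> Z"
    and below: "Z \<noteq> 0 \<Longrightarrow> i < I \<Longrightarrow> sA i \<noteq> 0 \<and> sB i = 0"
begin

lemma finite_slotB: "finite {i. sB i \<noteq> 0}"
proof -
  obtain L where L: "\<forall>i\<ge>L. sA i = 0" using bounded by blast
  have "{i. sB i \<noteq> 0} \<subseteq> {..<L}"
  proof
    fix i
    assume "i \<in> {i. sB i \<noteq> 0}"
    then show "i \<in> {..<L}"
      using slotAB[of i] L by (meson lessThan_iff mem_Collect_eq not_le)
  qed
  then show ?thesis by (rule finite_subset) simp
qed

lemma node_pos: "z \<in> In \<union> {n<..F} \<Longrightarrow> z \<noteq> 0"
  using In by auto

lemma node_le: "z \<in> In \<union> {n<..F} \<Longrightarrow> z \<le> F"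
  using In F by auto

lemma sA_eq_0: "sA i = 0 \<Longrightarrow> i \<le> j \<Longrightarrow> sA j = 0"
proof (induction j)
  case (Suc j)
  then show ?case using contiguous[of j] by (cases "i = Suc j") auto
qed simp

text \<open>The new leaf is regarded as a tree carried to level 0. Raising \<open>c\<close> by one
  makes room for the term \<open>2 ^ 0\<close> in the slot bounds and for the carried tree in
  \<open>count\<close>.\<close>

lemma start:
  assumes "W \<in> {1..n}" "W \<notin> In" "Z = 0"
  shows "forest n (insert W In) F (Suc c) lft rgt up sA sB (ins(W := Suc c)) (h(W := 0))
    (hi(W := Suc c)) W 0"
proof -
  have W: "W \<notin> In \<union> {n<..F}" "up W = 0" "W \<noteq> 0" "\<not> n < W" using assms fresh by auto
  have sW: "sA i \<noteq> W" "sB i \<noteq> W" for i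
    using W slotA[of i] slotB[of i] by force+
  have nW: "up z \<noteq> W" if "z \<in> In \<union> {n<..F}" for z
    using W that parent[of z] by force
  show ?thesis
  proof (unfold_locales, goal_cases)
    case 1 then show ?case using assms In by auto
  next
    case 2 then show ?case by (rule F)
  next
    case (3 z) then show ?case using children[of z] by auto
  next
    case (4 z) then show ?case using parent[of z] W nW[of z] by (auto; metis)
  next
    case (5 z) then show ?case using fresh[of z] by auto
  next
    case (6 x) then show ?case using leaf[of x] by auto
  next
    case (7 z) then show ?case using root[of z] node_pos[of z] assms W by auto
  next
    case (8 i) then show ?case using slotA[of i] sW[of i] assms W by auto
  next
    case (9 i) then show ?case using slotB[of i] sW[of i] assms W by auto
  next
    case (10 i) then show ?case by (rule slotAB)
  next
    case (11 i) then show ?case by (rule contiguous)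
  next
    case 12 then show ?case by (rule bounded)
  next
    case 13 then show ?case using count W by simp
  next
    case 14 then show ?case using W by simp
  next
    case (15 i) then show ?case using sW by simp
  next
    case (16 i) then show ?case by simp
  qed
qed

text \<open>Every lower level has exactly one tree, so the span is \<open>2 ^ I - 1\<close>. This
  turns the bound of the carried tree into the one required of slot \<open>I\<close>, and the bounds
  of the two merged trees into the one of the new carried tree.\<close>

lemma carry:
  assumes "Z \<noteq> 0" "sB I \<noteq> 0"
  shows "forest n In (Suc F) c (lft(Suc F := sA I)) (rgt(Suc F := sB I))
    (up(sA I := Suc F, sB I := Suc F)) (sA(I := Z)) (sB(I := 0)) ins (h(Suc F := Suc I))
    (hi(Suc F := max (hi (sA I)) (hi (sB I)))) (Suc F) (Suc I)"
proof -
  let ?N = "In \<union> {n<..F}"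
  have "Suc F \<notin> In" using In F by auto
  then have fr: "Suc F \<notin> ?N" "up (Suc F) = 0" "\<not> Suc F \<le> n"
    using F fresh[of "Suc F"] by auto
  have N: "In \<union> {n<..Suc F} = insert (Suc F) ?N" using F by auto
  have sA: "sA I \<noteq> 0" "sA I \<noteq> sB I" using assms slotAB by auto
  note A = slotA[OF sA(1)] and B = slotB[OF assms(2)]
  have less: "sA I < Suc F" "sB I < Suc F" using A B node_le less_Suc_eq_le by blast+
  have span: "Suc (newer_span sB I) = 2 ^ I"
    using below assms by (intro newer_span_single) auto
  have slots: "sA i = sA j \<Longrightarrow> sA i \<noteq> 0 \<Longrightarrow> i = j" "sB i = sB j \<Longrightarrow> sB i \<noteq> 0 \<Longrightarrow> i = j"
    "sA i = sB j \<Longrightarrow> sA i \<noteq> 0 \<Longrightarrow> i = j" for i j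
    using slotA slotB by metis+
  have slots_F: "sA i \<noteq> Suc F" "sB i \<noteq> Suc F" for i
    using slotA[of i] slotB[of i] fr by force+
  \<comment> \<open>Seen from a higher slot the span loses \<open>2 ^ I\<close>, while the carried
    term grows from \<open>2 ^ I\<close> to \<open>2 ^ Suc I\<close>; the sum stays the
    same.\<close>
  have shift: "newer_span sB i = newer_span (sB(I := 0)) i + 2 ^ I" if "I < i" for i
    using newer_span_upd[of I i "sB(I := 0)" "sB I"] that assms by simp
  show ?thesis
  proof (unfold_locales, goal_cases)
    case 1 then show ?case by (rule In)
  next
    case 2 then show ?case using F by simp
  next
    case (3 z)
    show ?case
    proof (cases "z = Suc F")
      case True
      then show ?thesis unfolding N using A B sA fr less by auto
    next
      case False
      then show ?thesis unfolding N using 3 children[of z] A B by auto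
    qed
  next
    case (4 z)
    then have z: "z \<in> ?N" unfolding N using fr slots_F[of I] by auto
    consider "z = sA I" | "z = sB I" | "z \<noteq> sA I" "z \<noteq> sB I" "up z \<noteq> 0"
      using 4 by (auto split: if_splits)
    then show ?case
    proof cases
      case 3
      then have "up z \<noteq> Suc F" using parent[OF z] by auto
      then show ?thesis using 3 z parent[OF z] fr by auto
    qed (use A B z fr sA F less in auto)
  next
    case (5 z)
    then show ?case unfolding N using fresh[of z] A B by auto
  next
    case (6 x)
    then show ?case using leaf[of x] fr by auto
  next
    case (7 z)
    then show ?case unfolding N using root[of z] carried assms by (auto split: if_splits)
  next
    case (8 i)
    show ?case
    proof (cases i I rule: linorder_cases)
      case less
      then show ?thesis unfolding N using 8 slotA[of i] slots[of i I] slots_F assms by auto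
    next
      case equal
      then show ?thesis unfolding N using carried assms not_slot[of I] span fr by auto
    next
      case greater
      then show ?thesis
        unfolding N using 8 slotA[of i] slots[of i I] slots_F assms shift[of i] by auto
    qed
  next
    case (9 i)
    show ?case
    proof (cases i I rule: linorder_cases)
      case less
      then show ?thesis
        unfolding N using 9 slotB[of i] slots(2)[of i I] slots(3)[of I i] slots_F assms sA by auto
    next
      case equal
      then show ?thesis using 9 by simp
    next
      case greater
      then show ?thesis
        unfolding N using 9 slotB[of i] slots(2)[of i I] slots(3)[of I i] slots_F assms sA shift[of
          i]
        by auto
    qed
  next
    case (10 i)
    then show ?case using slotAB[of i] by (auto split: if_splits)
  next
    case (11 i)
    then show ?case using contiguous[of i] assms sA by (auto split: if_splits)
  next
    case 12
    obtain L where "\<forall>i\<ge>L. sA i = 0" using bounded by blast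
    then have "\<forall>i\<ge>max L (Suc I). (sA(I := Z)) i = 0" by auto
    then show ?case ..
  next
    \<comment> \<open>The new node is paid by the newer slot that the merger empties. This
      amortization bounds the number of nodes.\<close>
    case 13
    have "{i. (sB(I := 0)) i \<noteq> 0} = {i. sB i \<noteq> 0} - {I}" by auto
    moreover have "card {i. sB i \<noteq> 0} = Suc (card ({i. sB i \<noteq> 0} - {I}))"
      using finite_slotB assms(2) by (intro card.remove) auto
    ultimately show ?case using count assms by simp
  next
    case 14
    show ?case unfolding N using fr A B span assms slots_F by auto
  next
    case (15 i)
    then show ?case using slots_F assms carried fr by (auto; blast)
  next
    case (16 i)
    then show ?case using below[of i] assms by (auto simp: less_Suc_eq)
  qed
qed

text \<open>If the older slot of level \<open>I\<close> is empty, so are all higher levels, and no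
  bound above needs to be adjusted.\<close>

lemma place_A:
  assumes "Z \<noteq> 0" "sA I = 0"
  shows "forest n In F c lft rgt up (sA(I := Z)) sB ins h hi 0 0"
proof -
  have z: "sA i = 0" "sB i = 0" if "I \<le> i" for i
    using sA_eq_0[OF assms(2) that] slotAB[of i] by auto
  have span: "Suc (newer_span sB I) = 2 ^ I"
    using below assms by (intro newer_span_single) auto
  show ?thesis
  proof (unfold_locales, goal_cases)
    case 1 then show ?case by (rule In)
  next
    case 2 then show ?case by (rule F)
  next
    case (3 z) then show ?case by (rule children)
  next
    case (4 z) then show ?case by (rule parent)
  next
    case (5 z) then show ?case by (rule fresh)
  next
    case (6 x) then show ?case by (rule leaf)
  next
    case (7 z') then show ?case using root[of z'] carried assms z[of I] by auto
  next
    case (8 i) then show ?case using slotA[of i] carried assms z[of i] span by (cases "I \<le> i") (auto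
      split: if_splits)
  next
    case (9 i) then show ?case using slotB[of i] by auto
  next
    case (10 i) then show ?case using slotAB[of i] not_slot[of i] assms by auto
  next
    case (11 i) then show ?case using contiguous[of i] below[of i] assms by (auto split: if_splits)
  next
    case 12
    have "\<forall>i\<ge>Suc I. (sA(I := Z)) i = 0" using z by auto
    then show ?case ..
  next
    case 13 then show ?case using count assms by simp
  qed simp_all
qed

text \<open>For higher slots the span grows by \<open>2 ^ I\<close>, which is exactly the term of
  the carried tree that it replaces.\<close>

lemma place_B:
  assumes "Z \<noteq> 0" "sA I \<noteq> 0" "sB I = 0"
  shows "forest n In F c lft rgt up sA (sB(I := Z)) ins h hi 0 0"
proof -
  have span: "Suc (newer_span sB I) = 2 ^ I"
    using below assms by (intro newer_span_single) auto
  have shift: "newer_span (sB(I := Z)) i = newer_span sB i + 2 ^ I" if "I < i" for i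
    using newer_span_upd[of I i sB Z] that assms by simp
  show ?thesis
  proof (unfold_locales, goal_cases)
    case 1 then show ?case by (rule In)
  next
    case 2 then show ?case by (rule F)
  next
    case (3 z) then show ?case by (rule children)
  next
    case (4 z) then show ?case by (rule parent)
  next
    case (5 z) then show ?case by (rule fresh)
  next
    case (6 x) then show ?case by (rule leaf)
  next
    case (7 z') then show ?case using root[of z'] carried assms by auto
  next
    case (8 i) then show ?case using slotA[of i] assms shift[of i] by (cases i I rule:
      linorder_cases) auto
  next
    case (9 i) then show ?case using slotB[of i] assms shift[of i] carried span by (cases i I rule:
      linorder_cases) auto
  next
    case (10 i) then show ?case using slotAB[of i] not_slot[of i] assms by (auto split: if_splits)
  next
    case (11 i) then show ?case using contiguous[of i] by auto
  next
    case 12 then show ?case by (rule bounded)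
  next
    case 13
    have "{i. (sB(I := Z)) i \<noteq> 0} = insert I {i. sB i \<noteq> 0}" using assms by auto
    then show ?case using count assms finite_slotB by simp
  qed simp_all
qed

end

section \<open>Values in the trees and the minimum\<close>

text \<open>\<open>Al\<close> are the inserted items that are still present. \<open>X\<close> is the
  one inner node whose value may be outdated while a deletion climbs; 0 is not a node and stands for
  none.\<close>

definition vals ::
  "(nat \<times> nat) set \<Rightarrow> nat \<Rightarrow> nat set \<Rightarrow> nat set \<Rightarrow> nat \<Rightarrow> (nat \<Rightarrow> nat) \<Rightarrow> (nat \<Rightarrow> nat) \<Rightarrow> (nat \<Rightarrow> nat) \<Rightarrow>
    nat \<Rightarrow> bool" where
  "vals r n In Al F lft rgt mn X \<longleftrightarrow>
     mn 0 = 0 \<and> Al \<subseteq> In \<and> (\<forall>x\<in>In. mn x = (if x \<in> Al then x else 0)) \<and>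
     (\<forall>z. n < z \<longrightarrow> z \<le> F \<longrightarrow> z \<noteq> X \<longrightarrow> mn z = mn2 r (mn (lft z)) (mn (rgt z)))"

definition suffix_eq ::
  "(nat \<times> nat) set \<Rightarrow> (nat \<Rightarrow> nat) \<Rightarrow> (nat \<Rightarrow> nat) \<Rightarrow> (nat \<Rightarrow> nat) \<Rightarrow> (nat \<Rightarrow> nat) \<Rightarrow> nat \<Rightarrow> bool" where
  "suffix_eq r mn sA sB S i \<longleftrightarrow> S i = mn2 r (S (Suc i)) (mn2 r (mn (sA i)) (mn (sB i)))"

text \<open>Heights and age bounds exist for the analysis alone, hence the quantifier. That
  \<open>S\<close> vanishes from some level on is the base for the downward induction over the
  levels.\<close>

definition heap ::
  "(nat \<times> nat) set \<Rightarrow> nat \<Rightarrow> nat set \<Rightarrow> nat set \<Rightarrow> nat \<Rightarrow> nat \<Rightarrow> (nat \<Rightarrow> nat) \<Rightarrow> (nat \<Rightarrow> nat) \<Rightarrow> (nat \<Rightarrow> nat) \<Rightarrow>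
    (nat \<Rightarrow> nat) \<Rightarrow> (nat \<Rightarrow> nat) \<Rightarrow> (nat \<Rightarrow> nat) \<Rightarrow> (nat \<Rightarrow> nat) \<Rightarrow> (nat \<Rightarrow> nat) \<Rightarrow> bool" where
  "heap r n In Al F c ins mn lft rgt up sA sB S \<longleftrightarrow>
     (\<exists>h hi. forest n In F c lft rgt up sA sB ins h hi 0 0) \<and> vals r n In Al F lft rgt mn 0 \<and>
     (\<forall>i. suffix_eq r mn sA sB S i) \<and> (\<exists>L. \<forall>i\<ge>L. S i = 0)"

abbreviation heap_state ::
  "(nat \<times> nat) set \<Rightarrow> nat \<Rightarrow> nat set \<Rightarrow> nat set \<Rightarrow> (var \<Rightarrow> nat) \<Rightarrow> (arr \<Rightarrow> nat \<Rightarrow> nat) \<Rightarrow> bool" where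
  "heap_state r n In Al R A \<equiv> heap r n In Al (R VF) (R VC) (A AIns) (A AMn) (A ALft) (A ARgt) (A
    AUp)
     (A ASA) (A ASB) (A AS)"

lemma mn2_cases: "mn2 r a b = a \<or> mn2 r a b = b"
  by (simp add: mn2_def)

lemma mn2_le:
  assumes "strict_linear_order_on {..<n} r" "a \<le> n" "b \<le> n"
  shows "a \<noteq> 0 \<Longrightarrow> mn2 r a b = a \<or> lt r (mn2 r a b) a" "b \<noteq> 0 \<Longrightarrow> mn2 r a b = b \<or> lt r (mn2 r a b) b"
proof -
  have "(b - 1, a - 1) \<in> r" if "a \<noteq> 0" "b \<noteq> 0" "a \<noteq> b" "(a - 1, b - 1) \<notin> r"
  proof -
    have "a - 1 \<in> {..<n}" "b - 1 \<in> {..<n}" "a - 1 \<noteq> b - 1" using that assms(2,3) by auto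
    then show ?thesis
      using assms(1) that(4) unfolding strict_linear_order_on_def total_on_def by blast
  qed
  then show "a \<noteq> 0 \<Longrightarrow> mn2 r a b = a \<or> lt r (mn2 r a b) a" "b \<noteq> 0 \<Longrightarrow> mn2 r a b = b \<or> lt r (mn2 r a b)
    b"
    by (auto simp: mn2_def lt_def)
qed

lemma lt_trans: "strict_linear_order_on V r \<Longrightarrow> lt r a b \<Longrightarrow> lt r b c \<Longrightarrow> lt r a c"
  unfolding lt_def strict_linear_order_on_def by (blast dest: transD)

text \<open>Values can only become smaller along the chain from a leaf over its ancestors to a slot
  and from there through the suffix minima to level 0.\<close>

lemma heap_min:
  assumes "heap r n In Al F c ins mn lft rgt up sA sB S" and lin: "strict_linear_order_on {..<n} r"
  shows "S 0 = 0 \<or> S 0 \<in> Al" "x \<in> Al \<Longrightarrow> S 0 = x \<or> lt r (S 0) x"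
proof -
  obtain h hi L where f: "forest n In F c lft rgt up sA sB ins h hi 0 0"
    and v: "vals r n In Al F lft rgt mn 0" and s: "\<And>i. suffix_eq r mn sA sB S i"
    and L: "\<And>i. L \<le> i \<Longrightarrow> S i = 0"
    using assms(1) unfolding heap_def by blast
  interpret forest n In F c lft rgt up sA sB ins h hi 0 0
    by (rule f)
  let ?N = "In \<union> {n<..F}"
  have mn: "mn z \<in> insert 0 Al" if "z \<in> ?N" for z
    using that
  proof (induction z rule: less_induct)
    case (less z)
    show ?case
    proof (cases "z \<in> In")
      case True
      then show ?thesis using v by (auto simp: vals_def)
    next
      case False
      then have z: "n < z" "z \<le> F" using less.prems by auto
      then have "mn z = mn2 r (mn (lft z)) (mn (rgt z))" using v by (auto simp: vals_def)
      moreover have "mn (lft z) \<in> insert 0 Al" "mn (rgt z) \<in> insert 0 Al"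
        using less.IH children[OF z] by blast+
      ultimately show ?thesis by (metis mn2_cases)
    qed
  qed
  have slot: "mn (sA i) \<in> insert 0 Al" "mn (sB i) \<in> insert 0 Al" for i
  proof -
    have "mn 0 = 0" using v by (simp add: vals_def)
    then show "mn (sA i) \<in> insert 0 Al" "mn (sB i) \<in> insert 0 Al"
      using mn[of "sA i"] mn[of "sB i"] slotA[of i] slotB[of i] by (metis insertI1)+
  qed
  have S: "S i \<in> insert 0 Al" for i
  proof (induction "L - i" arbitrary: i)
    case 0
    then show ?case using L[of i] by simp
  next
    case (Suc d)
    then have "S (Suc i) \<in> insert 0 Al" by auto
    then show ?case using s[of i] slot[of i] unfolding suffix_eq_def by (metis mn2_cases)
  qed
  then show "S 0 = 0 \<or> S 0 \<in> Al" by blast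
  have Al: "a \<le> n" if "a \<in> insert 0 Al" for a
    using that In v by (force simp: vals_def)
  have step: "S i = m \<or> lt r (S i) m" if "m \<noteq> 0" "m = S (Suc i) \<or> m = mn (sA i) \<or> m = mn (sB i)" for
    i m
  proof -
    let ?m = "mn2 r (mn (sA i)) (mn (sB i))"
    have le: "?m \<le> n" "S (Suc i) \<le> n"
      using Al slot[of i] S[of "Suc i"] by (metis mn2_cases)+
    have 1: "?m = m \<or> lt r ?m m" if "m = mn (sA i) \<or> m = mn (sB i)"
      using mn2_le[OF lin, of "mn (sA i)" "mn (sB i)"] Al slot[of i] that \<open>m \<noteq> 0\<close> by blast
    show ?thesis
    proof (cases "m = S (Suc i)")
      case True
      then show ?thesis
        using mn2_le(1)[OF lin le(2,1)] s[of i] that(1) unfolding suffix_eq_def by simp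
    next
      case False
      then have m: "?m = m \<or> lt r ?m m" using 1 that by blast
      then have "?m \<noteq> 0" using that(1) by (auto simp: lt_def)
      then have "S i = ?m \<or> lt r (S i) ?m"
        using mn2_le(2)[OF lin le(2,1)] s[of i] unfolding suffix_eq_def by simp
      then show ?thesis using m lt_trans[OF lin] by metis
    qed
  qed
  have S0: "S 0 = m \<or> lt r (S 0) m" if "S i = m \<or> lt r (S i) m" "m \<noteq> 0" for i m
    using that(1)
  proof (induction i)
    case (Suc i)
    then have "S (Suc i) \<noteq> 0" using that(2) by (auto simp: lt_def)
    then show ?case using Suc step[of "S (Suc i)" i] lt_trans[OF lin] by metis
  qed
  have "S 0 = mn z \<or> lt r (S 0) (mn z)" if "z \<in> ?N" "mn z \<noteq> 0" for z
    using that
  \<comment> \<open>Parents have larger numbers than their children and do not exceed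
    \<open>F\<close>, so the measure falls on the way to the root.\<close>
  proof (induction "F + n - z" arbitrary: z rule: less_induct)
    case less
    show ?case
    proof (cases "up z = 0")
      case True
      then have "z = sA (h z) \<or> z = sB (h z)"
        using root[OF less.prems(1)] node_pos[OF less.prems(1)] by auto
      then show ?thesis using step[of "mn z" "h z"] S0[of "h z" "mn z"] less.prems(2) by metis
    next
      case False
      note p = parent[OF less.prems(1) False]
      have u: "mn (up z) = mn2 r (mn (lft (up z))) (mn (rgt (up z)))"
        using v p by (auto simp: vals_def)
      have "mn (lft (up z)) \<le> n" "mn (rgt (up z)) \<le> n"
        using children[of "up z"] p mn Al by blast+
      then have le: "mn (up z) = mn z \<or> lt r (mn (up z)) (mn z)"
        using mn2_le[OF lin, of "mn (lft (up z))" "mn (rgt (up z))"] p less.prems(2) u by metis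
      then have "mn (up z) \<noteq> 0" using less.prems(2) by (auto simp: lt_def)
      then have "S 0 = mn (up z) \<or> lt r (S 0) (mn (up z))" using p by (intro less.hyps) auto
      then show ?thesis using le lt_trans[OF lin] by metis
    qed
  qed
  moreover assume x: "x \<in> Al"
  then have "x \<in> ?N" "mn x = x" using v by (auto simp: vals_def)
  moreover have "x \<noteq> 0" using calculation node_pos by blast
  ultimately show "S 0 = x \<or> lt r (S 0) x" by metis
qed

lemma heapI:
  "forest n In F c lft rgt up sA sB ins h hi 0 0 \<Longrightarrow> vals r n In Al F lft rgt mn 0 \<Longrightarrow>
    (\<And>i. suffix_eq r mn sA sB S i) \<Longrightarrow> (\<And>i. L \<le> i \<Longrightarrow> S i = 0) \<Longrightarrow>
    heap r n In Al F c ins mn lft rgt up sA sB S"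
  unfolding heap_def by blast

section \<open>Correctness and cost of the queue operations\<close>

text \<open>Each level takes two comparisons and one tick. Entries from the starting level on keep
  their values, so \<open>S\<close> still vanishes eventually.\<close>

lemma wp_suffix_loop:
  assumes eq: "\<And>i. R VI \<le> i \<Longrightarrow> suffix_eq r (A AMn) (A ASA) (A ASB) (A AS) i"
    and post: "\<And>R' S. \<lbrakk>\<And>x. x \<notin> {VI, VT, VA, VB} \<Longrightarrow> R' x = R x;
      \<And>i. suffix_eq r (A AMn) (A ASA) (A ASB) S i; \<And>i. R VI \<le> i \<Longrightarrow> S i = A AS i\<rbrakk> \<Longrightarrow>
      Q R' (A(AS := S)) out (k + 2 * R VI) (t + R VI)"
  shows "wp r inp suffix_loop Q R A out k t"
  unfolding suffix_loop_def
proof (rule wp_Loop[where \<mu> = "\<lambda>R A. R VI" and I = "\<lambda>R' A' out' k' t'. out' = out \<and>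
      R' VI \<le> R VI \<and> k' + 2 * R' VI = k + 2 * R VI \<and> t' + R' VI = t + R VI \<and>
      (\<forall>x. x \<notin> {VI, VT, VA, VB} \<longrightarrow> R' x = R x) \<and>
      (\<exists>S. A' = A(AS := S) \<and> (\<forall>i\<ge>R' VI. suffix_eq r (A AMn) (A ASA) (A ASB) S i) \<and>
        (\<forall>i\<ge>R VI. S i = A AS i))"], goal_cases)
  case 1
  then show ?case using eq by (auto intro!: exI[of _ "A AS"])
next
  case (2 R' A' out' k' t')
  then obtain S where S: "A' = A(AS := S)" "\<forall>i\<ge>R' VI. suffix_eq r (A AMn) (A ASA) (A ASB) S i"
    "\<forall>i\<ge>R VI. S i = A AS i"
    by blast
  obtain i where i: "R' VI = Suc i" using 2(2) not0_implies_Suc by blast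
  let ?S = "S(i := mn2 r (S (Suc i)) (mn2 r (A AMn (A ASA i)) (A AMn (A ASB i))))"
  have "suffix_eq r (A AMn) (A ASA) (A ASB) ?S j" if "i \<le> j" for j
    using that S(2)[rule_format, of j] i by (cases "j = i") (auto simp: suffix_eq_def)
  then have "\<exists>S'. A(AS := ?S) = A(AS := S') \<and>
      (\<forall>j\<ge>i. suffix_eq r (A AMn) (A ASA) (A ASB) S' j) \<and> (\<forall>i\<ge>R VI. S' i = A AS i)"
    using S(3) 2(1) i by (intro exI[of _ ?S]) auto
  then show ?case using 2(1) i S(1) by simp
next
  case (3 R' A' out' k' t')
  then show ?case using post by auto
qed

context forest
begin

lemma vals_start:
  assumes "vals r n In Al F lft rgt mn 0" "W \<in> {1..n}" "W \<notin> In"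
  shows "vals r n (insert W In) (insert W Al) F lft rgt (mn(W := W)) 0"
proof -
  have "lft z \<noteq> W" "rgt z \<noteq> W" if "n < z" "z \<le> F" for z
    using children[OF that] assms by auto
  then show ?thesis using assms unfolding vals_def by auto
qed

lemma vals_carry:
  assumes "vals r n In Al F lft rgt mn 0" "a \<in> In \<union> {n<..F}" "b \<in> In \<union> {n<..F}"
  shows "vals r n In Al (Suc F) (lft(Suc F := a)) (rgt(Suc F := b))
    (mn(Suc F := mn2 r (mn a) (mn b))) 0"
proof -
  have "lft z \<noteq> Suc F" "rgt z \<noteq> Suc F" if "n < z" "z \<le> F" for z
    using children[OF that] that by auto
  moreover have "Suc F \<notin> In" "a \<noteq> Suc F" "b \<noteq> Suc F" using assms In F by auto
  ultimately show ?thesis using assms(1) unfolding vals_def by (auto simp: le_Suc_eq)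
qed

lemma slot_cases:
  assumes "z \<in> In \<union> {n<..F}" "z = sA i \<or> z = sB i"
  shows "up z = 0" "h z = i"
  using assms slotA[of i] slotB[of i] node_pos[OF assms(1)] by auto

text \<open>The equation of level \<open>i\<close> depends only on the values of roots of height
  \<open>i\<close>.\<close>

lemma suffix_eq_upd:
  assumes "suffix_eq r mn sA sB S i" "z \<in> In \<union> {n<..F}" "up z \<noteq> 0 \<or> h z \<noteq> i"
  shows "suffix_eq r (mn(z := v)) sA sB S i"
  using assms slot_cases[OF assms(2), of i] unfolding suffix_eq_def by auto

end

text \<open>Every iteration empties a newer slot, which gives termination, and creates one node.
  Expressing the cost by the growth \<open>d\<close> of \<open>VF\<close> lets it telescope over all
  insertions.\<close>

lemma wp_carry_loop:
  assumes f: "forest n In (R VF) (R VC) (A ALft) (A ARgt) (A AUp) (A ASA) (A ASB) (A AIns) h hi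
      (R VZ) (R VI)"
    and start: "R VZ \<noteq> 0" "R VB = A ASB (R VI)" "R VI = 0"
    and v: "vals r n In Al (R VF) (A ALft) (A ARgt) (A AMn) 0"
    and s: "\<And>i. R VI \<le> i \<Longrightarrow> suffix_eq r (A AMn) (A ASA) (A ASB) (A AS) i"
    and post: "\<And>R' A' h hi d. \<lbrakk>\<And>x. x \<notin> {VA, VF, VT, VL, VB, VZ, VI} \<Longrightarrow> R' x = R x;
      \<And>f. f \<notin> {ALft, ARgt, AUp, AMn, ASA, ASB} \<Longrightarrow> A' f = A f;
      forest n In (R' VF) (R' VC) (A' ALft) (A' ARgt) (A' AUp) (A' ASA) (A' ASB) (A' AIns) h hi
        (R' VZ) (R' VI);
      R' VZ \<noteq> 0; A' ASB (R' VI) = 0; vals r n In Al (R' VF) (A' ALft) (A' ARgt) (A' AMn) 0;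
      \<And>i. R' VI \<le> i \<Longrightarrow> suffix_eq r (A' AMn) (A' ASA) (A' ASB) (A' AS) i;
      R' VF = R VF + d; R' VI = d\<rbrakk> \<Longrightarrow> Q R' A' out (k + d) (t + d)"
  shows "wp r inp carry_loop Q R A out k t"
  unfolding carry_loop_def
proof (rule wp_Loop[where \<mu> = "\<lambda>R A. card {i. A ASB i \<noteq> 0}" and I = "\<lambda>R' A' out' k' t'. out' = out \<and>
      (\<forall>x. x \<notin> {VA, VF, VT, VL, VB, VZ, VI} \<longrightarrow> R' x = R x) \<and>
      (\<forall>f. f \<notin> {ALft, ARgt, AUp, AMn, ASA, ASB} \<longrightarrow> A' f = A f) \<and>
      (\<exists>h hi. forest n In (R' VF) (R' VC) (A' ALft) (A' ARgt) (A' AUp) (A' ASA) (A' ASB) (A' AIns) h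
        hi
        (R' VZ) (R' VI)) \<and>
      R' VZ \<noteq> 0 \<and> R' VB = A' ASB (R' VI) \<and> vals r n In Al (R' VF) (A' ALft) (A' ARgt) (A' AMn) 0 \<and>
      (\<forall>i\<ge>R' VI. suffix_eq r (A' AMn) (A' ASA) (A' ASB) (A' AS) i) \<and>
      R' VF = R VF + R' VI \<and> k' = k + R' VI \<and> t' = t + R' VI"], goal_cases)
  case 1
  then show ?case using f start v s by auto
next
  case (2 R' A' out' k' t')
  then obtain h hi where f: "forest n In (R' VF) (R' VC) (A' ALft) (A' ARgt) (A' AUp) (A' ASA) (A'
    ASB)
      (A' AIns) h hi (R' VZ) (R' VI)"
    by blast
  have R': "R' VZ \<noteq> 0" "R' VB = A' ASB (R' VI)" "A' ASB (R' VI) \<noteq> 0"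
    "vals r n In Al (R' VF) (A' ALft) (A' ARgt) (A' AMn) 0"
    using 2 by auto
  have s: "suffix_eq r (A' AMn) (A' ASA) (A' ASB) (A' AS) i" if "R' VI \<le> i" for i
    using 2 that by blast
  interpret forest n In "R' VF" "R' VC" "A' ALft" "A' ARgt" "A' AUp" "A' ASA" "A' ASB" "A' AIns" h
    hi
    "R' VZ" "R' VI"
    by (rule f)
  let ?I = "R' VI" and ?F = "Suc (R' VF)"
  let ?a = "A' ASA ?I" and ?b = "A' ASB ?I"
  have ab: "?a \<in> In \<union> {n<..R' VF}" "?b \<in> In \<union> {n<..R' VF}" "?a \<noteq> ?F" "?b \<noteq> ?F"
    using R' slotAB[of ?I] slotA[of ?I] slotB[of ?I] In F by auto
  have "suffix_eq r ((A' AMn)(?F := v)) ((A' ASA)(?I := y)) ((A' ASB)(?I := z)) (A' AS) i"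
    if "Suc ?I \<le> i" for i v y z
  proof -
    have "A' ASA i \<noteq> ?F" "A' ASB i \<noteq> ?F" using slotA[of i] slotB[of i] In F by force+
    then show ?thesis using s[of i] that by (simp add: suffix_eq_def)
  qed
  moreover have "card {i. ((A' ASB)(?I := 0)) i \<noteq> 0} < card {i. A' ASB i \<noteq> 0}"
    using finite_slotB R' by (intro psubset_card_mono) auto
  ultimately show ?case
    using carry[OF R'(1,3)] vals_carry[OF R'(4) ab(1,2)] ab 2(1) R' 
    by (auto simp del: fun_upd_apply simp: fun_upd_same fun_upd_other)
next
  case (3 R' A' out' k' t')
  then obtain h hi where "forest n In (R' VF) (R' VC) (A' ALft) (A' ARgt) (A' AUp) (A' ASA) (A' ASB)
      (A' AIns) h hi (R' VZ) (R' VI)"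
    by blast
  then show ?case using 3 post[of R' A' h hi "R' VI"] by auto
qed

text \<open>The carries cost \<open>d\<close> comparisons and end on level \<open>d\<close>, so the
  suffix minima cost \<open>2 * (d + 1)\<close>.\<close>

lemma wp_insert_item:
  assumes h: "heap_state r n In Al R A" and W: "R VW \<in> {1..n}" "R VW \<notin> In"
    and post: "\<And>R' A' d. \<lbrakk>\<And>x. x \<notin> {VC, VA, VF, VT, VL, VB, VZ, VI} \<Longrightarrow> R' x = R x;
      \<And>f. f \<notin> {AIns, ALft, ARgt, AUp, AMn, ASA, ASB, AS} \<Longrightarrow> A' f = A f;
      R' VC = Suc (R VC); A' AIns = (A AIns)(R VW := Suc (R VC)); R' VF = R VF + d;
      heap_state r n (insert (R VW) In) (insert (R VW) Al) R' A'\<rbrakk> \<Longrightarrow>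
      Q R' A' out (k + 3 * d + 2) (t + 2 * d + 1)"
  shows "wp r inp insert_item Q R A out k t"
proof -
  obtain h hi L where f: "forest n In (R VF) (R VC) (A ALft) (A ARgt) (A AUp) (A ASA) (A ASB) (A
    AIns) h hi 0 0"
    and v: "vals r n In Al (R VF) (A ALft) (A ARgt) (A AMn) 0"
    and s: "\<And>i. suffix_eq r (A AMn) (A ASA) (A ASB) (A AS) i" and L: "\<And>i. L \<le> i \<Longrightarrow> A AS i = 0"
    using h unfolding heap_def by blast
  interpret forest n In "R VF" "R VC" "A ALft" "A ARgt" "A AUp" "A ASA" "A ASB" "A AIns" h hi 0 0
    by (rule f)
  have "A ASA i \<noteq> R VW" "A ASB i \<noteq> R VW" for i
    using slotA[of i] slotB[of i] W by force+
  then have s': "suffix_eq r ((A AMn)(R VW := R VW)) (A ASA) (A ASB) (A AS) i" for i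
    using s[of i] unfolding suffix_eq_def by simp
  show ?thesis
    unfolding insert_item_def
  proof (simp, rule wp_carry_loop[where n = n and In = "insert (R VW) In" and
        Al = "insert (R VW) Al" and h = "h(R VW := 0)" and hi = "hi(R VW := Suc (R VC))"],
          goal_cases)
    case 1
    show ?case using start[OF W refl] by simp
  next
    case 2
    show ?case using W by simp
  next
    case 3 show ?case by simp
  next
    case 4 show ?case by simp
  next
    case 5
    show ?case using vals_start[OF v W] by simp
  next
    case (6 i)
    show ?case using s' by simp
  next
    case (7 R1 A1 h1 hi1 d)
    note R1 = 7(1) and A1 = 7(2)
    interpret f1: forest n "insert (R VW) In" "R1 VF" "R1 VC" "A1 ALft" "A1 ARgt" "A1 AUp" "A1 ASA"
      "A1 ASB"
      "A1 AIns" h1 hi1 "R1 VZ" "R1 VI"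
      by (rule 7(3))
    have 8: "R1 VC = Suc (R VC)" "A1 AS = A AS" "A1 AIns = (A AIns)(R VW := Suc (R VC))"
      "R1 VW = R VW" "R1 VF = R VF + d" "R1 VI = d"
      using R1 A1 7(8,9) by simp_all
    let ?sA = "if A1 ASA d = 0 then (A1 ASA)(d := R1 VZ) else A1 ASA"
    let ?sB = "if A1 ASA d = 0 then A1 ASB else (A1 ASB)(d := R1 VZ)"
    have f2: "forest n (insert (R VW) In) (R1 VF) (R1 VC) (A1 ALft) (A1 ARgt) (A1 AUp) ?sA ?sB
        (A1 AIns) h1 hi1 0 0"
      using f1.place_A[OF 7(4)] f1.place_B[OF 7(4)] 7(5) 8 by auto
    have s2: "suffix_eq r (A1 AMn) ?sA ?sB (A1 AS) i" if "Suc d \<le> i" for i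
      using 7(7)[of i] that 8 unfolding suffix_eq_def by auto
    have final: "Q R2 A2 out (k + 3 * d + 2) (t + 2 * d + 1)"
      if R2: "\<And>x. x \<notin> {VI, VT, VA, VB} \<Longrightarrow> R2 x = R1 x"
        and S: "\<And>i. suffix_eq r (A1 AMn) ?sA ?sB S i" "\<And>i. Suc d \<le> i \<Longrightarrow> S i = A1 AS i"
        and A2: "A2 = A1(ASA := ?sA, ASB := ?sB, AS := S)" for R2 A2 S
    proof (rule post)
      show "R2 x = R x" if "x \<notin> {VC, VA, VF, VT, VL, VB, VZ, VI}" for x
        using R2 R1[of x] that by auto
      show "A2 f = A f" if "f \<notin> {AIns, ALft, ARgt, AUp, AMn, ASA, ASB, AS}" for f
        using A1[of f] that by (auto simp: A2)
      have S0: "S i = 0" if "max L (Suc d) \<le> i" for i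
        using that S(2)[of i] L[of i] 8 by simp
      then show "heap_state r n (insert (R VW) In) (insert (R VW) Al) R2 A2"
        using heapI[OF f2 7(6) S(1), of "max L (Suc d)"] S0 R2 by (simp add: A2)
    qed (use 8 R2 in \<open>auto simp: A2\<close>)
    have "wp r inp suffix_loop Q (R1(VA := A1 ASA d, VI := Suc d)) (A1(ASA := ?sA, ASB := ?sB)) out
        (k + d) (t + d)"
    proof (rule wp_suffix_loop, goal_cases)
      case (1 i)
      then show ?case using s2[of i] by (simp del: fun_upd_apply add: fun_upd_same fun_upd_other)
    next
      case (2 R2 S)
      have "Q R2 (A1(ASA := ?sA, ASB := ?sB, AS := S)) out (k + 3 * d + 2) (t + 2 * d + 1)"
      proof (rule final)
        show "R2 x = R1 x" if "x \<notin> {VI, VT, VA, VB}" for x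
          using 2(1)[of x] that by auto
        show "suffix_eq r (A1 AMn) ?sA ?sB S i" for i
          using 2(2)[of i] by (simp del: fun_upd_apply add: fun_upd_same fun_upd_other)
        show "S i = A1 AS i" if "Suc d \<le> i" for i
          using 2(3)[of i] that by simp
      qed simp
      moreover have "k + d + 2 * (R1(VA := A1 ASA d, VI := Suc d)) VI = k + 3 * d + 2"
        "t + d + (R1(VA := A1 ASA d, VI := Suc d)) VI = t + 2 * d + 1"
        by simp_all
      ultimately show ?case by (simp only:)
    qed
    moreover have "A1(ASA := A1 ASA) = A1" "A1(ASA := f, ASB := A1 ASB) = A1(ASA := f)" for f
      by auto
    ultimately show ?case using 8 by (simp split: if_splits)
  qed
qed

text \<open>\<open>VI\<close> is the height of the node last updated and \<open>VZ\<close> its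
  parent. At the root, the slot bound leaves room for \<open>2 ^ i - 1\<close> insertions after
  number \<open>lo\<close>. The suffix equation of the level of the root may be broken by then,
  hence the exemption of level \<open>VI\<close> when \<open>VZ\<close> is 0.\<close>

lemma wp_climb_loop:
  assumes f: "forest n In F c (A ALft) (A ARgt) (A AUp) (A ASA) (A ASB) ins h hi 0 0"
    and u: "u \<in> In \<union> {n<..F}" "R VZ = A AUp u" "R VI = h u" "h u = 0" "lo \<le> hi u"
    and v: "vals r n In Al F (A ALft) (A ARgt) (A AMn) (R VZ)"
    and s: "\<And>i. (R VZ = 0 \<and> i = R VI) \<or> suffix_eq r (A AMn) (A ASA) (A ASB) (A AS) i"
    and post: "\<And>R' mn i. \<lbrakk>\<And>x. x \<notin> {VA, VB, VZ, VI} \<Longrightarrow> R' x = R x; R' VI = i; 2 ^ i + lo \<le> Suc c;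
      vals r n In Al F (A ALft) (A ARgt) mn 0;
      \<And>j. Suc i \<le> j \<Longrightarrow> suffix_eq r mn (A ASA) (A ASB) (A AS) j\<rbrakk> \<Longrightarrow> 
      Q R' (A(AMn := mn)) out (k + i) (t + i)"
  shows "wp r inp climb_loop Q R A out k t"
proof -
  interpret forest n In F c "A ALft" "A ARgt" "A AUp" "A ASA" "A ASB" ins h hi 0 0
    by (rule f)
  show ?thesis
    unfolding climb_loop_def
  proof (rule wp_Loop[where \<mu> = "\<lambda>R A. if R VZ = 0 then 0 else Suc F - R VZ" and
        I = "\<lambda>R' A' out' k' t'. out' = out \<and>
        (\<forall>x. x \<notin> {VA, VB, VZ, VI} \<longrightarrow> R' x = R x) \<and> k' = k + R' VI \<and> t' = t + R' VI \<and>
        (\<exists>z \<in> In \<union> {n<..F}. R' VZ = A AUp z \<and> R' VI = h z \<and> lo \<le> hi z) \<and>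
        (\<exists>mn. A' = A(AMn := mn) \<and> vals r n In Al F (A ALft) (A ARgt) mn (R' VZ) \<and>
          (\<forall>i. (R' VZ = 0 \<and> i = R' VI) \<or> suffix_eq r mn (A ASA) (A ASB) (A AS) i))"], goal_cases)
    case 1
    then show ?case using u v s by (auto intro!: bexI[of _ u] exI[of _ "A AMn"])
  next
    case (2 R' A' out' k' t')
    then obtain z mn where z: "z \<in> In \<union> {n<..F}" "R' VZ = A AUp z" "R' VI = h z" "lo \<le> hi z"
      and A': "A' = A(AMn := mn)" and v: "vals r n In Al F (A ALft) (A ARgt) mn (R' VZ)"
      and s0: "\<forall>i. (R' VZ = 0 \<and> i = R' VI) \<or> suffix_eq r mn (A ASA) (A ASB) (A AS) i"
      by (elim conjE exE bexE) (rule that)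
    have s: "suffix_eq r mn (A ASA) (A ASB) (A AS) i" for i
      using s0[rule_format, of i] 2(2) by simp
    let ?z = "R' VZ"
    have p: "?z \<le> F" "n < ?z" "h ?z = Suc (h z)" "hi z \<le> hi ?z"
      using parent[OF z(1)] z(2) 2(2) by auto
    let ?mn = "mn(?z := mn2 r (mn (A ALft ?z)) (mn (A ARgt ?z)))"
    have zN: "?z \<in> In \<union> {n<..F}" "?z \<notin> In" "?z \<noteq> 0" using p In by auto
    have "vals r n In Al F (A ALft) (A ARgt) ?mn (A AUp ?z)"
    proof -
      have "A ALft w \<noteq> ?z \<and> A ARgt w \<noteq> ?z" if "n < w" "w \<le> F" "w \<noteq> A AUp ?z" for w
        using children[OF that(1,2)] that(3) by metis
      moreover have "A ALft ?z \<noteq> ?z" "A ARgt ?z \<noteq> ?z" using children[OF p(2,1)] by auto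
      ultimately show ?thesis using v zN unfolding vals_def by auto
    qed
    moreover have "\<forall>i. (A AUp ?z = 0 \<and> i = h ?z) \<or> suffix_eq r ?mn (A ASA) (A ASB) (A AS) i"
    proof
      fix i
      show "(A AUp ?z = 0 \<and> i = h ?z) \<or> suffix_eq r ?mn (A ASA) (A ASB) (A AS) i"
        using suffix_eq_upd[OF s[of i] zN(1)] by metis
    qed
    moreover have "A AUp ?z \<noteq> 0 \<Longrightarrow> ?z < A AUp ?z \<and> A AUp ?z \<le> F"
      using parent[OF zN(1)] by blast
    ultimately show ?case using 2(1) z p zN A' by (auto intro!: bexI[of _ ?z] exI[of _ ?mn])
  next
    case (3 R' A' out' k' t')
    then obtain z mn where z: "z \<in> In \<union> {n<..F}" "R' VZ = A AUp z" "R' VI = h z" "lo \<le> hi z"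
      and A': "A' = A(AMn := mn)" and v0: "vals r n In Al F (A ALft) (A ARgt) mn (R' VZ)"
      and s0: "\<forall>i. (R' VZ = 0 \<and> i = R' VI) \<or> suffix_eq r mn (A ASA) (A ASB) (A AS) i"
      by (elim conjE exE bexE) (rule that)
    have v: "vals r n In Al F (A ALft) (A ARgt) mn 0" and z0: "A AUp z = 0"
      using v0 z(2) 3(2) by simp_all
    have s: "i = R' VI \<or> suffix_eq r mn (A ASA) (A ASB) (A AS) i" for i
      using s0[rule_format, of i] by blast
    have "A ASA (h z) = z \<or> A ASB (h z) = z"
      using root[OF z(1) z0] node_pos[OF z(1)] by simp
    then have "hi z + newer_span (A ASB) (h z) \<le> c"
      using slotA[of "h z"] slotB[of "h z"] node_pos[OF z(1)] by auto
    then have "2 ^ h z + lo \<le> Suc c" using newer_span_ge[of "h z" "A ASB"] z(4) by simp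
    moreover have "suffix_eq r mn (A ASA) (A ASB) (A AS) j" if "Suc (h z) \<le> j" for j
      using s[of j] z(3) that by auto
    ultimately have "Q R' (A(AMn := mn)) out (k + h z) (t + h z)"
      using 3 z(3) v by (intro post) auto
    then show ?case using 3 z(3) A' by auto
  qed
qed

text \<open>\<open>2 ^ i\<close> is at most the number of insertions from that of the deleted item
  on, its own included. A cost linear in \<open>i\<close> is thus logarithmic in its
  lifetime.\<close>

lemma wp_delete_item:
  assumes heap: "heap_state r n In Al R A" and u: "R VU \<in> Al"
    and post: "\<And>R' A' i. \<lbrakk>\<And>x. x \<notin> {VT, VA, VB, VZ, VI} \<Longrightarrow> R' x = R x;
      \<And>f. f \<notin> {AMn, AS} \<Longrightarrow> A' f = A f; 2 ^ i + A AIns (R VU) \<le> Suc (R VC);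
      heap_state r n In (Al - {R VU}) R' A'\<rbrakk> \<Longrightarrow>
      Q R' A' out (k + 3 * i + 2) (t + 2 * i + 1)"
  shows "wp r inp delete_item Q R A out k t"
proof -
  obtain h hi L where f: "forest n In (R VF) (R VC) (A ALft) (A ARgt) (A AUp) (A ASA) (A ASB) (A
    AIns) h hi 0 0"
    and v: "vals r n In Al (R VF) (A ALft) (A ARgt) (A AMn) 0"
    and s: "\<And>i. suffix_eq r (A AMn) (A ASA) (A ASB) (A AS) i" and L: "\<And>i. L \<le> i \<Longrightarrow> A AS i = 0"
    using heap unfolding heap_def by blast
  interpret forest n In "R VF" "R VC" "A ALft" "A ARgt" "A AUp" "A ASA" "A ASB" "A AIns" h hi 0 0
    by (rule f)
  let ?u = "R VU"
  have uIn: "?u \<in> In" "?u \<in> In \<union> {n<..R VF}" using u v by (auto simp: vals_def)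
  have hu: "h ?u = 0" "hi ?u = A AIns ?u" using leaf[OF uIn(1)] by auto
  have v': "vals r n In (Al - {?u}) (R VF) (A ALft) (A ARgt) ((A AMn)(?u := 0)) (A AUp ?u)"
  proof -
    have "A ALft w \<noteq> ?u \<and> A ARgt w \<noteq> ?u" if "n < w" "w \<le> R VF" "w \<noteq> A AUp ?u" for w
      using children[OF that(1,2)] that(3) by metis
    moreover have "?u \<le> n" using uIn(1) In by auto
    ultimately show ?thesis using v unfolding vals_def by auto
  qed
  have s': "(A AUp ?u = 0 \<and> i = 0) \<or> suffix_eq r ((A AMn)(?u := 0)) (A ASA) (A ASB) (A AS) i" for i
    using suffix_eq_upd[OF s uIn(2), of i 0] hu by metis
  show ?thesis
    unfolding delete_item_def
  proof (simp, rule wp_climb_loop[where u = ?u and h = h and hi = hi and n = n and In = In and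
        Al = "Al - {?u}" and F = "R VF" and c = "R VC" and ins = "A AIns" and lo = "A AIns ?u"],
          goal_cases)
    case 1 show ?case using f by simp
  next
    case 2 show ?case by (rule uIn)
  next
    case 3 show ?case by simp
  next
    case 4 show ?case using hu by simp
  next
    case 5 show ?case by (rule hu)
  next
    case 6 show ?case using hu by simp
  next
    case 7 show ?case using v' by simp
  next
    case (8 i) show ?case using s'[of i] by simp
  next
    case (9 R1 mn i)
    have v9: "vals r n In (Al - {?u}) (R VF) (A ALft) (A ARgt) mn 0" using 9(4) by simp
    have final: "Q R2 (A(AMn := mn, AS := S)) out (k + 3 * i + 2) (t + 2 * i + 1)"
      if R2: "\<And>x. x \<notin> {VI, VT, VA, VB} \<Longrightarrow> R2 x = (R1(VI := Suc i)) x"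
        and S: "\<And>j. suffix_eq r mn (A ASA) (A ASB) S j" "\<And>j. Suc i \<le> j \<Longrightarrow> S j = A AS j" for R2 S
    proof (rule post)
      have R1: "R1 x = R x" if "x \<notin> {VT, VA, VB, VZ, VI}" for x
        using 9(1)[of x] that by auto
      show "R2 x = R x" if "x \<notin> {VT, VA, VB, VZ, VI}" for x
        using R2[of x] R1[of x] that by auto
      have S0: "S j = 0" if "max L (Suc i) \<le> j" for j
        using that S(2)[of j] L[of j] by simp
      have "R2 VF = R VF" "R2 VC = R VC" using R2 R1 by auto
      then show "heap_state r n In (Al - {?u}) R2 (A(AMn := mn, AS := S))"
        using heapI[OF f v9 S(1), of "max L (Suc i)"] S0 by simp
    qed (use 9(3) in auto)
    have i: "R1 VI = i" by (rule 9(2))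
    have "wp r inp suffix_loop Q (R1(VI := Suc i)) (A(AMn := mn)) out (k + i) (t + i)"
    proof (rule wp_suffix_loop, goal_cases)
      case (1 j)
      then show ?case using 9(5)[of j] by simp
    next
      case (2 R2 S)
      have "Q R2 (A(AMn := mn, AS := S)) out (k + 3 * i + 2) (t + 2 * i + 1)"
        using 2 by (intro final) simp_all
      moreover have "k + i + 2 * (R1(VI := Suc i)) VI = k + 3 * i + 2"
        "t + i + (R1(VI := Suc i)) VI = t + 2 * i + 1"
        by simp_all
      ultimately show ?case by (simp only:)
    qed
    then show ?case using i by simp
  qed
qed

text \<open>The amortized count allows at most \<open>c\<close> inner nodes, so all carries together
  cost O(\<open>c\<close>).\<close>

lemma heap_nodes_le: "heap r n In Al F c ins mn lft rgt up sA sB S \<Longrightarrow> F \<le> n + c"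
  unfolding heap_def by (auto dest: forest.count)

lemma heap_empty: "heap r n {} {} n 0 ins (\<lambda>_. 0) (\<lambda>_. 0) (\<lambda>_. 0) (\<lambda>_. 0) (\<lambda>_. 0) (\<lambda>_. 0) (\<lambda>_. 0)"
proof (rule heapI[where L = 0])
  show "forest n {} n 0 (\<lambda>_. 0) (\<lambda>_. 0) (\<lambda>_. 0) (\<lambda>_. 0) (\<lambda>_. 0) ins (\<lambda>_. 0) (\<lambda>_. 0) 0 0"
    by unfold_locales auto
qed (auto simp: vals_def suffix_eq_def mn2_def)

section \<open>The input graph\<close>

lemma length_input_words [simp]: "length (input_words n arcs) = 2 * length arcs + 2"
  unfolding input_words_def by (induction arcs) auto

lemma nth_input_words:
  "input_words n arcs ! 0 = n" "input_words n arcs ! Suc 0 = length arcs"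
  "i < length arcs \<Longrightarrow> input_words n arcs ! (2 * i + 2) = fst (arcs ! i)"
  "i < length arcs \<Longrightarrow> input_words n arcs ! (2 * i + 3) = snd (arcs ! i)"
proof -
  have *: "concat (map (\<lambda>(v, w). [v, w]) arcs) ! (2 * i) = fst (arcs ! i) \<and>
      concat (map (\<lambda>(v, w). [v, w]) arcs) ! Suc (2 * i) = snd (arcs ! i)" if "i < length arcs" for i
    using that
  proof (induction arcs arbitrary: i)
    case (Cons a arcs)
    then show ?case by (cases i) (auto split: prod.splits)
  qed simp
  show "i < length arcs \<Longrightarrow> input_words n arcs ! (2 * i + 2) = fst (arcs ! i)"
    "i < length arcs \<Longrightarrow> input_words n arcs ! (2 * i + 3) = snd (arcs ! i)"
    using * by (auto simp: input_words_def numeral_3_eq_3)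
qed (auto simp: input_words_def)

section \<open>Arcs, adjacency lists and in-degrees\<close>

locale sorting_input =
  fixes n :: nat and arcs :: "(nat \<times> nat) list" and r :: "(nat \<times> nat) set"
  assumes consistent: "r \<in> topological_orders {..<n} (set arcs)"
begin

definition m :: nat where
  "m = length arcs"

definition inp :: "nat list" where
  "inp = input_words n arcs"

text \<open>Arcs are numbered from 1, so that 0 can end an adjacency list.\<close>

definition src :: "nat \<Rightarrow> nat" where
  "src e = Suc (fst (arcs ! (e - 1)))"

definition tgt :: "nat \<Rightarrow> nat" where
  "tgt e = Suc (snd (arcs ! (e - 1)))"

lemma lin: "strict_linear_order_on {..<n} r"
  using consistent by (simp add: topological_orders_def)

lemma trans: "lt r a b \<Longrightarrow> lt r b c \<Longrightarrow> lt r a c"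
  by (rule lt_trans[OF lin])

lemma irrefl: "\<not> lt r a a"
  using lin unfolding lt_def strict_linear_order_on_def by (meson irreflD)

lemma asym: "lt r a b \<Longrightarrow> \<not> lt r b a"
  using trans irrefl by blast

lemma total: 
  assumes "a \<in> {1..n}" "b \<in> {1..n}" "a \<noteq> b"
  shows "lt r a b \<or> lt r b a"
proof -
  have "a - 1 \<in> {..<n}" "b - 1 \<in> {..<n}" "a - 1 \<noteq> b - 1" using assms by auto
  then show ?thesis
    using lin assms unfolding lt_def strict_linear_order_on_def total_on_def by auto
qed

lemma lt_range: "lt r a b \<Longrightarrow> a \<in> {1..n} \<and> b \<in> {1..n}"
  using consistent unfolding lt_def topological_orders_def by fastforce

lemma arcs_range: "set arcs \<subseteq> {..<n} \<times> {..<n}"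
  using consistent unfolding topological_orders_def by blast

lemma arc_lt: 
  assumes "e \<in> {1..m}"
  shows "lt r (src e) (tgt e)"
proof -
  have "arcs ! (e - 1) \<in> set arcs" using assms by (intro nth_mem) (auto simp: m_def)
  then have "arcs ! (e - 1) \<in> r" using consistent by (auto simp: topological_orders_def)
  then show ?thesis by (simp add: lt_def src_def tgt_def)
qed

lemma arc_range: "e \<in> {1..m} \<Longrightarrow> src e \<in> {1..n} \<and> tgt e \<in> {1..n}"
  using arc_lt lt_range by blast

lemma arc_index:
  assumes "(u, v) \<in> set arcs"
  shows "\<exists>e\<in>{1..m}. src e = Suc u \<and> tgt e = Suc v"
proof -
  obtain i where "i < length arcs" "arcs ! i = (u, v)"
    using assms by (auto simp: in_set_conv_nth)
  then show ?thesis by (intro bexI[of _ "Suc i"]) (auto simp: src_def tgt_def m_def)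
qed

lemma ex_min:
  assumes "X \<subseteq> {1..n}" "X \<noteq> {}"
  shows "\<exists>x\<in>X. \<forall>y\<in>X. y \<noteq> x \<longrightarrow> lt r x y"
proof -
  have "finite X" by (rule finite_subset[OF assms(1)]) simp
  then show ?thesis
    using assms(2,1)
  proof (induction X rule: finite_ne_induct)
    case (insert a X)
    then obtain x where x: "x \<in> X" "\<forall>y\<in>X. y \<noteq> x \<longrightarrow> lt r x y" by auto
    then have "lt r x a \<or> lt r a x"
      using insert total[of x a] by (metis insert_subset subsetD)
    then show ?case
    proof
      assume "lt r x a"
      then show ?thesis using x by (intro bexI[of _ x]) auto
    next
      assume "lt r a x"
      then have "\<forall>y\<in>insert a X. y \<noteq> a \<longrightarrow> lt r a y"
        using x trans[OF \<open>lt r a x\<close>] \<open>lt r a x\<close> by (metis insertE)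
      then show ?thesis by blast
    qed
  qed auto
qed

text \<open>Adjacency lists are built by prepending and so run through the arcs by decreasing
  number; these values are their heads and links.\<close>

primrec last_arc :: "nat \<Rightarrow> nat \<Rightarrow> nat" where
  "last_arc v 0 = 0"
| "last_arc v (Suc e) = (if src (Suc e) = v then Suc e else last_arc v e)"

lemma last_arc_le: "last_arc v e \<le> e"
  by (induction e) auto

lemma last_arc_src: "last_arc v e \<noteq> 0 \<Longrightarrow> src (last_arc v e) = v"
  by (induction e) auto

lemma last_arc_gap: "last_arc v e < e' \<Longrightarrow> e' \<le> e \<Longrightarrow> src e' \<noteq> v"
  by (induction e) (auto simp: le_Suc_eq split: if_splits)

definition graph_ok :: "(nat \<Rightarrow> nat) \<Rightarrow> (nat \<Rightarrow> nat) \<Rightarrow> (nat \<Rightarrow> nat) \<Rightarrow> (nat \<Rightarrow> nat) \<Rightarrow> bool" where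
  "graph_ok hdl nx tg sc \<longleftrightarrow>
     (\<forall>e\<in>{1..m}. tg e = tgt e \<and> sc e = src e \<and> nx e = last_arc (src e) (e - 1)) \<and>
     (\<forall>v. hdl v = last_arc v m)"

text \<open>
  While \<open>u \<in> D\<close> is being deleted, its arcs are removed in the order of decreasing index, and
  those up to \<open>E\<close> are still pending.
\<close>

definition pend :: "nat set \<Rightarrow> nat \<Rightarrow> nat \<Rightarrow> nat set" where
  "pend D u E = {e \<in> {1..m}. src e \<notin> D \<or> (src e = u \<and> e \<le> E)}"

definition deg :: "nat set \<Rightarrow> nat \<Rightarrow> nat" where
  "deg X w = card {e \<in> X. tgt e = w}"

lemma finite_pend [simp]: "finite (pend D u E)"
  by (simp add: pend_def)

lemma pend_0: "pend D u 0 = pend D u' 0"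
  by (auto simp: pend_def)

lemma pend_empty: "pend {} u E = {1..m}"
  by (auto simp: pend_def)

text \<open>Moving \<open>u\<close> into \<open>D\<close> while all its arcs are still pending does
  not change the pending set, so the loop over these arcs can start from the invariant of the
  previous round.\<close>

lemma pend_start:
  assumes "u \<notin> D"
  shows "pend (insert u D) u (last_arc u m) = pend D u' 0"
proof -
  have "e \<le> last_arc u m" if "src e = u" "e \<le> m" for e
    using last_arc_gap[of u m e] that by (meson not_le)
  then show ?thesis using assms by (auto simp: pend_def)
qed

lemma pend_step:
  assumes "E = last_arc u e" "E \<noteq> 0" "e \<le> m" "u \<in> D"
  shows "E \<in> pend D u E" "pend D u (last_arc u (E - 1)) = pend D u E - {E}"
proof -
  have E: "src E = u" "E \<le> m" using assms last_arc_src last_arc_le le_trans by blast+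
  then show "E \<in> pend D u E" using assms by (auto simp: pend_def)
  have "e' \<le> last_arc u (E - 1)" if "src e' = u" "e' \<le> E" "e' \<noteq> E" for e'
  proof -
    have "e' \<le> E - 1" using that by simp
    then show ?thesis using last_arc_gap that(1) not_le by blast
  qed
  moreover have "last_arc u (E - 1) < E" using last_arc_le[of u "E - 1"] assms(2) by simp
  ultimately show "pend D u (last_arc u (E - 1)) = pend D u E - {E}"
    using E assms(4) by (auto simp: pend_def)
qed

lemma deg_remove:
  assumes "e \<in> X" "finite X"
  shows "deg (X - {e}) = (deg X)(tgt e := deg X (tgt e) - 1)"
proof
  fix w
  show "deg (X - {e}) w = ((deg X)(tgt e := deg X (tgt e) - 1)) w"
  proof (cases "w = tgt e")
    case True
    then have "{e' \<in> X - {e}. tgt e' = w} = {e' \<in> X. tgt e' = w} - {e}" by auto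
    then show ?thesis using True assms by (simp add: deg_def)
  next
    case False
    then have "{e' \<in> X - {e}. tgt e' = w} = {e' \<in> X. tgt e' = w}" by auto
    then show ?thesis using False by (simp add: deg_def)
  qed
qed

lemma deg_eq_0: "finite X \<Longrightarrow> deg X w = 0 \<longleftrightarrow> (\<forall>e\<in>X. tgt e \<noteq> w)"
  by (auto simp: deg_def)

lemma deg_0: "X \<subseteq> {1..m} \<Longrightarrow> deg X 0 = 0"
  unfolding deg_def tgt_def by simp

text \<open>A pending arc into the least remaining item would have a smaller remaining source. This
  keeps both topological sorts from getting stuck.\<close>

lemma avail:
  assumes "{1..n} - D \<noteq> {}"
  obtains w where "w \<in> {1..n} - D" "\<And>y. y \<in> {1..n} - D \<Longrightarrow> y \<noteq> w \<Longrightarrow> lt r w y"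
    "deg (pend D u 0) w = 0"
proof -
  obtain w where w: "w \<in> {1..n} - D" "\<forall>y\<in>{1..n} - D. y \<noteq> w \<longrightarrow> lt r w y"
    using ex_min[of "{1..n} - D"] assms by blast
  have "tgt e \<noteq> w" if "e \<in> pend D u 0" for e
  proof
    assume "tgt e = w"
    moreover have "e \<in> {1..m}" "src e \<notin> D" using that by (auto simp: pend_def)
    ultimately show False
      using arc_lt[of e] arc_range[of e] w asym irrefl by (metis DiffI)
  qed
  then show ?thesis using w that by (auto simp: deg_eq_0)
qed

end

subsection \<open>Building the adjacency lists\<close>

text \<open>There are two copies of the in-degrees because the sort by levels and the heapsort each
  consume one.\<close>

definition read_input :: com where
  "read_input = Set VI 0 ;; Inp VN VI ;; Inc VI ;; Inp VM VI ;; Inc VI ;; Set VE 0 ;; Copy VX VM ;;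
     Loop VX (Inc VE ;; Inp VU VI ;; Inc VU ;; Inc VI ;; Inp VW VI ;; Inc VW ;; Inc VI ;;
       Rd VT AHead VU ;; Wr ANxt VE VT ;; Wr AHead VU VE ;; Wr ATgt VE VW ;; Wr ASrc VE VU ;;
       Rd VT ADegA VW ;; Inc VT ;; Wr ADegA VW VT ;; Wr ADegB VW VT ;; Dec VX)"

context sorting_input
begin

lemma inp_nth:
  assumes "E < m"
  shows "inp ! (2 * E + 2) = src (Suc E) - 1" "inp ! (2 * E + 3) = tgt (Suc E) - 1"
  using assms nth_input_words(3,4)[of E arcs n] by (simp_all add: inp_def src_def tgt_def m_def)

lemma deg_insert: "E < m \<Longrightarrow> deg {1..Suc E} = (deg {1..E})(tgt (Suc E) := Suc (deg {1..E} (tgt (Suc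
  E))))"
proof
  fix w
  have "{e \<in> {1..Suc E}. tgt e = w} = (if tgt (Suc E) = w then insert (Suc E) {e \<in> {1..E}. tgt e =
    w}
      else {e \<in> {1..E}. tgt e = w})"
    by (auto simp: le_Suc_eq)
  then show "deg {1..Suc E} w = ((deg {1..E})(tgt (Suc E) := Suc (deg {1..E} (tgt (Suc E))))) w"
    by (simp add: deg_def)
qed

lemma wp_read_input:
  assumes A: "A = (\<lambda>_ _. 0)"
    and post: "\<And>R' A'. \<lbrakk>R' VN = n; R' VM = m; graph_ok (A' AHead) (A' ANxt) (A' ATgt) (A' ASrc);
      A' ADegA = deg {1..m}; A' ADegB = deg {1..m};
      \<And>f. f \<notin> {AHead, ANxt, ATgt, ASrc, ADegA, ADegB} \<Longrightarrow> A' f = (\<lambda>_. 0)\<rbrakk> \<Longrightarrow> Q R' A' out k (t + m)"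
  shows "wp r inp read_input Q R A out k t"
proof -
  have len: "length inp = 2 * m + 2" "inp ! 0 = n" "inp ! Suc 0 = m"
    using nth_input_words[where arcs = arcs] by (simp_all add: inp_def m_def)
  have suc: "Suc (src e - Suc 0) = src e" "Suc (tgt e - Suc 0) = tgt e" for e
    by (simp_all add: src_def tgt_def)
  show ?thesis
    unfolding read_input_def
  proof (simp add: len, rule wp_Loop[where \<mu> = "\<lambda>R A. R VX" and I = "\<lambda>R' A' out' k' t'.
        out' = out \<and> k' = k \<and> t' + R' VX = t + m \<and> R' VX + R' VE = m \<and> R' VI = 2 * R' VE + 2 \<and>
        R' VN = n \<and> R' VM = m \<and> A' AHead = (\<lambda>v. last_arc v (R' VE)) \<and>
        (\<forall>e\<in>{1..R' VE}. A' ATgt e = tgt e \<and> A' ASrc e = src e \<and> A' ANxt e = last_arc (src e) (e -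
          1)) \<and>
        A' ADegA = deg {1..R' VE} \<and> A' ADegB = deg {1..R' VE} \<and>
        (\<forall>f. f \<notin> {AHead, ANxt, ATgt, ASrc, ADegA, ADegB} \<longrightarrow> A' f = (\<lambda>_. 0))"], goal_cases)
    case 1
    show ?case by (auto simp: A deg_def)
  next
    case (2 R' A' out' k' t')
    define E where "E = R' VE"
    have E: "E < m" "R' VX = m - E" "R' VI = 2 * E + 2" using 2 E_def by auto
    have I: "inp ! (2 * E + 2) = src (Suc E) - 1" "inp ! Suc (2 * E + 2) = tgt (Suc E) - 1"
      using inp_nth[OF E(1)] by (simp_all add: numeral_3_eq_3)
    have hd: "(\<lambda>v. last_arc v (Suc E)) = (\<lambda>v. last_arc v E)(src (Suc E) := Suc E)" by auto
    note I' = 2(1)[folded E_def]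
    show ?case
      using I' E I
      by (simp add: len suc E_def[symmetric] hd deg_insert[OF E(1), symmetric, unfolded One_nat_def]
          del: last_arc.simps)
  next
    case (3 R' A' out' k' t')
    then have "R' VE = m" by simp
    then show ?case using 3 by (auto simp: graph_ok_def intro!: post)
  qed
qed

end

subsection \<open>Levels and a longest path\<close>

definition scan_loop :: com where
  "scan_loop = Loop VX (Rd VT ADegA VX ;; Cond VT Skip (Inc VG ;; Wr AOrd VG VX) ;; Dec VX)"

definition arcs_loopA :: com where
  "arcs_loopA = Loop VE (Rd VW ATgt VE ;; Rd VT ADegA VW ;; Dec VT ;; Wr ADegA VW VT ;;
     Cond VT Skip (Inc VG ;; Wr AOrd VG VW ;; Wr APar VW VU ;; Wr ALev VW VL) ;; Rd VE ANxt VE)"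

text \<open>Items are removed by nondecreasing level, so the arc that makes an item available comes
  from a predecessor of highest level. Hence the level assigned is the length of a longest path
  ending in the item, and \<open>APar\<close> holds its last step.\<close>

definition find_levels :: com where
  "find_levels = Set VG 0 ;; Copy VX VN ;; scan_loop ;; Set VH 0 ;; Copy VX VN ;;
     Loop VX (Inc VH ;; Rd VU AOrd VH ;; Rd VE AHead VU ;; Rd VL ALev VU ;; Inc VL ;; arcs_loopA ;;
       Dec VX)"

text \<open>The last item of the queue has the highest level. The path is followed backwards and its
  length is not known in advance, so it is written from position n downwards.\<close>

definition find_path :: com where
  "find_path = Copy VJ VN ;; Rd VU AOrd VN ;;
     Loop VU (Wr AP VJ VU ;; Wr APidx VU VJ ;; Dec VJ ;; Rd VU APar VU) ;; Copy VO VJ"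

text \<open>Computes the last path position among the direct predecessors of each item; truncated
  subtraction yields the maximum as \<open>l + (t - l)\<close>.\<close>

definition find_lower_bounds :: com where
  "find_lower_bounds = Copy VX VM ;;
     Loop VX (Rd VU ASrc VX ;; Rd VW ATgt VX ;; Rd VT APidx VU ;; Rd VL ALp VW ;; Minus VT VT VL ;;
       Plus VL VL VT ;; Wr ALp VW VL ;; Dec VX)"

section \<open>Correctness of the sort by levels\<close>

context sorting_input
begin

text \<open>
  \<open>ord\<close> holds the queue of a breadth-first topological sort at the positions \<open>1..G\<close>, of which the
  first \<open>H\<close> have been removed.
\<close>

definition queue_inv where
  "queue_inv X H G B ord par lev \<longleftrightarrow>
     H \<le> G \<and> inj_on ord {1..G} \<and> ord ` {1..G} = {w \<in> {1..n}. deg X w = 0} \<and>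
     (\<forall>a b. 1 \<le> a \<longrightarrow> a \<le> b \<longrightarrow> b \<le> G \<longrightarrow> lev (ord a) \<le> lev (ord b)) \<and>
     (\<forall>b\<in>{1..G}. lev (ord b) \<le> B) \<and>
     (\<forall>e\<in>{1..m}. tgt e \<in> ord ` {1..G} \<longrightarrow> lev (src e) < (lev (tgt e) :: nat)) \<and>
     (\<forall>w\<in>ord ` {1..G}. (par w = 0 \<and> lev w = 0) \<or>
       (lev w = Suc (lev (par w)) \<and> (\<exists>e\<in>{1..m}. src e = par w \<and> tgt e = w)))"

lemma wp_scan_loop:
  assumes "R VX = n" "R VG = 0" "A ADegA = deg {1..m}"
    and post: "\<And>R' A'. \<lbrakk>\<And>x. x \<notin> {VX, VT, VG} \<Longrightarrow> R' x = R x; \<And>f. f \<notin> {AOrd} \<Longrightarrow> A' f = A f;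
      inj_on (A' AOrd) {1..R' VG}; A' AOrd ` {1..R' VG} = {w \<in> {1..n}. deg {1..m} w = 0}\<rbrakk> \<Longrightarrow>
      Q R' A' out k (t + n)"
  shows "wp r inp scan_loop Q R A out k t"
  unfolding scan_loop_def
proof (rule wp_Loop[where \<mu> = "\<lambda>R A. R VX" and I = "\<lambda>R' A' out' k' t'.
      out' = out \<and> k' = k \<and> t' + R' VX = t + n \<and> R' VX \<le> n \<and>
      (\<forall>x. x \<notin> {VX, VT, VG} \<longrightarrow> R' x = R x) \<and> (\<forall>f. f \<notin> {AOrd} \<longrightarrow> A' f = A f) \<and>
      inj_on (A' AOrd) {1..R' VG} \<and>
      A' AOrd ` {1..R' VG} = {w \<in> {R' VX<..n}. deg {1..m} w = 0}"], goal_cases)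
  case 1
  then show ?case using assms by auto
next
  case (2 R' A' out' k' t')
  obtain v where v: "R' VX = Suc v" using 2(2) not0_implies_Suc by blast
  let ?G = "R' VG" and ?o = "A' AOrd"
  have o: "inj_on ?o {1..?G}" "?o ` {1..?G} = {w \<in> {Suc v<..n}. deg {1..m} w = 0}"
    using 2(1) v by auto
  have dA: "A' ADegA = deg {1..m}" using 2(1) assms by simp
  let ?o' = "?o(Suc ?G := Suc v)"
  have G: "{1..Suc ?G} = insert (Suc ?G) {1..?G}" by auto
  have im: "?o' ` {1..Suc ?G} = insert (Suc v) (?o ` {1..?G})"
    unfolding G by (auto simp: image_iff)
  have "inj_on ?o' {1..Suc ?G}"
  proof -
    have "inj_on ?o' {1..?G} = inj_on ?o {1..?G}" by (rule inj_on_cong) auto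
    then have "inj_on ?o' {1..?G}" using o(1) by simp
    moreover have "Suc v \<notin> ?o ` {1..?G}" unfolding o(2) by simp
    ultimately show ?thesis unfolding G inj_on_insert by (auto simp: image_iff)
  qed
  moreover have "?o' ` {1..Suc ?G} = {w \<in> {v<..n}. deg {1..m} w = 0}" if "deg {1..m} (Suc v) = 0"
    unfolding im o(2) using that 2(1) v by auto
  moreover have "{w \<in> {v<..n}. deg {1..m} w = 0} = {w \<in> {Suc v<..n}. deg {1..m} w = 0}"
    if "deg {1..m} (Suc v) \<noteq> 0"
    using that by (auto intro: Suc_lessI)
  ultimately show ?case using 2(1) v o dA by (auto simp del: One_nat_def)
next
  case (3 R' A' out' k' t')
  have "{w \<in> {0<..n}. deg {1..m} w = 0} = {w \<in> {1..n}. deg {1..m} w = 0}" by auto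
  then have "Q R' A' out k (t + n)" using 3 by (intro post) (simp_all del: One_nat_def)
  then show ?case using 3 by simp
qed

text \<open>\<open>B\<close> bounds all levels in the queue, so appending an item of level
  \<open>B\<close> keeps them monotone. All predecessors of \<open>w\<close> are among the first
  \<open>H\<close> entries and have at most the level of \<open>u\<close>, the last of these, so the
  level of \<open>w\<close> exceeds theirs.\<close>

lemma queue_inv_push:
  assumes inv: "queue_inv X H G B ord par lev" and e: "e \<in> X" "X \<subseteq> {1..m}" "tgt e = w" "deg (X -
    {e}) w = 0"
    and u: "src e = u" "u = ord H" "1 \<le> H" "B = Suc (lev u)"
    and dn: "\<And>e'. e' \<in> {1..m} \<Longrightarrow> e' \<notin> X - {e} \<Longrightarrow> src e' \<in> ord ` {1..H}"
  shows "queue_inv (X - {e}) H (Suc G) B (ord(Suc G := w)) (par(w := u)) (lev(w := B))"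
proof -
  have fin: "finite X" by (rule finite_subset[OF e(2)]) simp
  have G: "{1..Suc G} = insert (Suc G) {1..G}" by auto
  let ?o' = "ord(Suc G := w)" and ?lev = "lev(w := B)"
  note inv' = inv[unfolded queue_inv_def]
  have H: "H \<le> G" and inj: "inj_on ord {1..G}" using inv' by simp_all
  have im: "ord ` {1..G} = {w \<in> {1..n}. deg X w = 0}"
    by (rule inv'[THEN conjunct2, THEN conjunct2, THEN conjunct1])
  have mono: "lev (ord a) \<le> lev (ord b)" if "1 \<le> a" "a \<le> b" "b \<le> G" for a b
    using inv' that by blast
  have B: "lev (ord b) \<le> B" if "b \<in> {1..G}" for b
    using inv' that by blast
  have lev: "lev (src e) < lev (tgt e)" if "e \<in> {1..m}" "tgt e \<in> ord ` {1..G}" for e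
    using inv' that by blast
  have par: "(par w = 0 \<and> lev w = 0) \<or>
       (lev w = Suc (lev (par w)) \<and> (\<exists>e\<in>{1..m}. src e = par w \<and> tgt e = w))" if "w \<in> ord ` {1..G}"
         for w
    using inv'[THEN conjunct2, THEN conjunct2, THEN conjunct2, THEN conjunct2, THEN conjunct2,
        THEN conjunct2] that by (rule bspec)
  have em: "e \<in> {1..m}" using e by blast
  have "deg X w \<noteq> 0" using e fin deg_eq_0[of X w] by blast
  then have w: "w \<notin> ord ` {1..G}" "w \<in> {1..n}" using im arc_range[OF em] e(3) by auto
  have im': "?o' ` {1..Suc G} = insert w (ord ` {1..G})"
    unfolding G by (auto simp: image_iff)
  have o': "?o' b = ord b" "ord b \<noteq> w" if "b \<in> {1..G}" for b
    using that w by auto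
  have "deg (X - {e}) v = (if v = w then 0 else deg X v)" for v
    using deg_remove[OF e(1) fin] e(3,4) by auto
  then have "?o' ` {1..Suc G} = {v \<in> {1..n}. deg (X - {e}) v = 0}"
    unfolding im' im using w by auto
  moreover have "inj_on ?o' {1..Suc G}"
  proof -
    have "inj_on ?o' {1..G} = inj_on ord {1..G}" by (rule inj_on_cong) auto
    then have "inj_on ?o' {1..G}" using inj by simp
    then show ?thesis unfolding G inj_on_insert using w by (auto simp: image_iff)
  qed
  moreover have "?lev (?o' a) \<le> ?lev (?o' b)" if "1 \<le> a" "a \<le> b" "b \<le> Suc G" for a b
    using that mono[of a b] B[of a] o'[of a] o'[of b] by (cases "b = Suc G"; cases "a = Suc G") auto
  moreover have "?lev (?o' b) \<le> B" if "b \<in> {1..Suc G}" for b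
    using that B[of b] o'[of b] by (cases "b = Suc G") auto
  moreover have "?lev (src e') < ?lev (tgt e')" if "e' \<in> {1..m}" "tgt e' \<in> ?o' ` {1..Suc G}" for e'
  proof -
    have q: "src e' \<in> ord ` {1..H}" "src e' \<noteq> w"
    proof -
      have "deg (X - {e}) (tgt e') = 0" using that(2) calculation(1) by blast
      then have "e' \<notin> X - {e}" using fin by (auto simp: deg_eq_0)
      then show "src e' \<in> ord ` {1..H}" using dn that by blast
      then show "src e' \<noteq> w" using w H by (auto simp: image_iff)
    qed
    show ?thesis
    proof (cases "tgt e' = w")
      case True
      obtain a where "a \<in> {1..H}" "src e' = ord a" using q by blast
      then have "lev (src e') \<le> lev u" using mono[of a H] u H by auto
      then show ?thesis using True q u by simp
    next
      case False
      then show ?thesis using q lev[of e'] that im' by auto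
    qed
  qed
  moreover have "(par(w := u)) v = 0 \<and> ?lev v = 0 \<or> ?lev v = Suc (?lev ((par(w := u)) v)) \<and>
      (\<exists>e\<in>{1..m}. src e = (par(w := u)) v \<and> tgt e = v)" if "v \<in> ?o' ` {1..Suc G}" for v
  proof (cases "v = w")
    case True
    have "u \<noteq> w" using o'[of H] u H by auto
    then show ?thesis using True u e em by auto
  next
    case False
    then have v: "v \<in> ord ` {1..G}" using that im' by auto
    show ?thesis
    \<comment> \<open>Changing the level of \<open>w\<close> would matter if \<open>w\<close> were
      already a parent. But parents have been removed from the queue, which \<open>w\<close> enters
      only now.\<close>
    proof (cases "par v = w")
      case True
      have "par v = 0 \<or> (\<exists>e\<in>{1..m}. src e = par v \<and> tgt e = v)" using par[OF v] by blast
      then have "w \<in> ord ` {1..H}"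
      proof
        assume "par v = 0"
        then show ?thesis using True w by simp
      next
        assume "\<exists>e\<in>{1..m}. src e = par v \<and> tgt e = v"
        then obtain e' where e': "e' \<in> {1..m}" "src e' = par v" "tgt e' = v" by blast
        have "deg X v = 0" using v unfolding im by simp
        then have "e' \<notin> X" using fin e' by (auto simp: deg_eq_0)
        then show ?thesis using dn[of e'] e' True by auto
      qed
      then show ?thesis using w H by (auto simp: image_iff)
    next
      case not_w: False
      then show ?thesis using par[OF v] False by auto
    qed
  qed
  ultimately show ?thesis
    using H unfolding queue_inv_def by (intro conjI ballI allI impI) (assumption | simp)+
qed

lemma wp_arcs_loopA:
  assumes g: "graph_ok (A AHead) (A ANxt) (A ATgt) (A ASrc)"
    and start: "R VE = last_arc (R VU) m" "R VL = Suc (A ALev (R VU))" "R VU = A AOrd (R VH)"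
      "1 \<le> R VH" "R VU \<in> D"
    and D: "D = A AOrd ` {1..R VH}"
    and dA: "A ADegA = deg (pend D (R VU) (R VE))"
    and inv: "queue_inv (pend D (R VU) (R VE)) (R VH) (R VG) (R VL) (A AOrd) (A APar) (A ALev)"
    and post: "\<And>R' A' t'. \<lbrakk>\<And>x. x \<notin> {VE, VW, VT, VG} \<Longrightarrow> R' x = R x;
      \<And>f. f \<notin> {ADegA, AOrd, APar, ALev} \<Longrightarrow> A' f = A f;
      A' ADegA = deg (pend D (R VU) 0); D = A' AOrd ` {1..R VH}; R VL = Suc (A' ALev (R VU));
      A' AOrd (R VH) = R VU;
      queue_inv (pend D (R VU) 0) (R VH) (R' VG) (R VL) (A' AOrd) (A' APar) (A' ALev);
      t' + card (pend D (R VU) 0) = t + card (pend D (R VU) (R VE))\<rbrakk> \<Longrightarrow> Q R' A' out k t'"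
  shows "wp r inp arcs_loopA Q R A out k t"
  unfolding arcs_loopA_def
proof (rule wp_Loop[where \<mu> = "\<lambda>R A. R VE" and I = "\<lambda>R' A' out' k' t'.
      out' = out \<and> k' = k \<and> t' + card (pend D (R VU) (R' VE)) = t + card (pend D (R VU) (R VE)) \<and>
      (\<forall>x. x \<notin> {VE, VW, VT, VG} \<longrightarrow> R' x = R x) \<and>
      (\<forall>f. f \<notin> {ADegA, AOrd, APar, ALev} \<longrightarrow> A' f = A f) \<and>
      (\<exists>e\<le>m. R' VE = last_arc (R VU) e) \<and>
      A' ADegA = deg (pend D (R VU) (R' VE)) \<and> D = A' AOrd ` {1..R VH} \<and> R VL = Suc (A' ALev (R VU))
        \<and>
      A' AOrd (R VH) = R VU \<and>
      queue_inv (pend D (R VU) (R' VE)) (R VH) (R' VG) (R VL) (A' AOrd) (A' APar) (A' ALev)"],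
        goal_cases)
  case 1
  then show ?case using start D dA inv by auto
next
  case (2 R' A' out' k' t')
  define u E where "u = R VU" and "E = R' VE"
  define X where "X = pend D u E"
  obtain e where e: "e \<le> m" "E = last_arc u e" using 2(1) by (auto simp: u_def E_def)
  have E0: "E \<noteq> 0" using 2(2) by (simp add: E_def)
  note step = pend_step[OF e(2) E0 e(1) start(5)[folded u_def]]
  have Em: "E \<in> {1..m}" using step(1) by (auto simp: pend_def)
  have srcE: "src E = u" using last_arc_src[of u e] e E0 by simp
  have g': "A' ATgt E = tgt E" "A' ANxt E = last_arc u (E - 1)"
    using g 2(1) Em srcE by (auto simp: graph_ok_def)
  define w where "w = tgt E"
  have "X \<subseteq> {1..m}" by (auto simp: X_def pend_def)
  then have X: "finite X" "E \<in> X" "X \<subseteq> {1..m}" "pend D u (last_arc u (E - 1)) = X - {E}"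
    using step unfolding X_def by (simp_all only: finite_pend)
  have card: "card X = Suc (card (X - {E}))" using X(1,2) by (rule card.remove)
  have dA': "A' ADegA = deg X" using 2(1) by (simp add: X_def u_def E_def)
  have dw: "deg (X - {E}) = (deg X)(w := deg X w - 1)"
    using deg_remove[OF X(2,1)] by (simp add: w_def)
  have qi: "queue_inv X (R VH) (R' VG) (R VL) (A' AOrd) (A' APar) (A' ALev)"
    unfolding X_def u_def E_def using 2(1) by (elim conjE) assumption
  have HG: "R VH \<le> R' VG" using qi by (simp add: queue_inv_def)
  have less: "last_arc u (E - 1) < E" using last_arc_le[of u "E - 1"] E0 by simp
  have D': "D = A' AOrd ` {1..R VH}" "A' AOrd (R VH) = u" "R VL = Suc (A' ALev u)"
    using 2(1) by (auto simp: u_def)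
  have "t' + card X = t + card (pend D (R VU) (R VE))"
    unfolding X_def u_def E_def using 2(1) by (elim conjE) assumption
  then have base: "out' = out" "k' = k" "Suc t' + card (X - {E}) = t + card (pend D (R VU) (R VE))"
    using 2(1) card by simp_all
  have fr: "\<forall>x. x \<notin> {VE, VW, VT, VG} \<longrightarrow> R' x = R x" "\<forall>f. f \<notin> {ADegA, AOrd, APar, ALev} \<longrightarrow> A' f = A f"
    using 2(1) by simp_all
  have reg: "R' VE = E" "R' VU = u" "R' VL = R VL" using fr by (simp_all add: E_def u_def)
  have ex: "\<exists>e\<le>m. last_arc u (E - Suc 0) = last_arc u e"
    using Em by (intro exI[of _ "E - 1"]) auto
  show ?case
  proof (cases "deg X w - 1 = 0")
    case True
    then have d0: "deg (X - {E}) w = 0" by (simp add: dw)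
    have "src e' \<in> A' AOrd ` {1..R VH}" if "e' \<in> {1..m}" "e' \<notin> X - {E}" for e'
      using that D' srcE start(5) by (auto simp: X_def pend_def u_def)
    then have q: "queue_inv (X - {E}) (R VH) (Suc (R' VG)) (R VL) ((A' AOrd)(Suc (R' VG) := w))
        ((A' APar)(w := u)) ((A' ALev)(w := R VL))"
      using D' start(4)
      by (intro queue_inv_push[OF qi X(2,3) w_def[symmetric] d0 srcE]) auto
    have "deg X w \<noteq> 0" using X deg_eq_0[of X w] by (auto simp: w_def)
    moreover have "u \<in> A' AOrd ` {1..R' VG}"
      using D'(2) HG start(4) by (intro image_eqI[of _ _ "R VH"]) auto
    then have "deg X u = 0"
      using qi[unfolded queue_inv_def, THEN conjunct2, THEN conjunct2, THEN conjunct1] by simp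
    ultimately have wu: "w \<noteq> u" by auto
    have im: "D = (A' AOrd)(Suc (R' VG) := w) ` {1..R VH}"
      unfolding D'(1) using HG by (intro image_cong) auto
    have "A' AOrd (R VH) = u" "Suc (R' VG) \<noteq> R VH" using D' HG by auto
    then show ?thesis
      using base q wu D'(3) fr reg g' less ex dA' dw X(4) im True srcE
      by (simp add: w_def[symmetric] u_def[symmetric])
  next
    case False
    \<comment> \<open>A degree that was positive stays positive, so the set of available items is
      unchanged.\<close>
    have d0: "deg (X - {E}) v = 0 \<longleftrightarrow> deg X v = 0" for v
      using False by (auto simp: dw)
    then have "queue_inv (X - {E}) (R VH) (R' VG) (R VL) (A' AOrd) (A' APar) (A' ALev)"
    proof -
      have "queue_inv (X - {E}) (R VH) (R' VG) (R VL) (A' AOrd) (A' APar) (A' ALev) =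
          queue_inv X (R VH) (R' VG) (R VL) (A' AOrd) (A' APar) (A' ALev)"
        by (simp only: queue_inv_def d0)
      then show ?thesis using qi by (rule iffD2)
    qed
    then show ?thesis
      using base D' fr reg g' less ex dA' dw X(4) False
      by (simp add: w_def[symmetric] u_def[symmetric])
  qed
next
  case (3 R' A' out' k' t')
  then have "R' VE = 0" by simp
  then show ?case using 3 by (auto intro!: post)
qed

text \<open>The scan and the main loop take n ticks each. The ticks of the inner loop are charged to
  the pending arcs, each of which is removed once.\<close>

lemma wp_find_levels:
  assumes N: "R VN = n" and g: "graph_ok (A AHead) (A ANxt) (A ATgt) (A ASrc)"
    and A: "A ADegA = deg {1..m}" "A APar = (\<lambda>_. 0)" "A ALev = (\<lambda>_. 0)"
    and post: "\<And>R' A'. \<lbrakk>\<And>x. x \<notin> {VG, VX, VH, VU, VE, VL, VW, VT} \<Longrightarrow> R' x = R x;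
      \<And>f. f \<notin> {ADegA, AOrd, APar, ALev} \<Longrightarrow> A' f = A f;
      A' AOrd ` {1..n} = {1..n}; \<And>e. e \<in> {1..m} \<Longrightarrow> A' ALev (src e) < A' ALev (tgt e);
      \<And>w. w \<in> {1..n} \<Longrightarrow> A' ALev w \<le> A' ALev (A' AOrd n);
      \<And>w. w \<in> {1..n} \<Longrightarrow> (A' APar w = 0 \<and> A' ALev w = 0) \<or>
        (A' ALev w = Suc (A' ALev (A' APar w)) \<and> (\<exists>e\<in>{1..m}. src e = A' APar w \<and> tgt e = w))\<rbrakk> \<Longrightarrow>
      Q R' A' out k (t + 2 * n + m)"
  shows "wp r inp find_levels Q R A out k t"
  unfolding find_levels_def
proof (simp, rule wp_scan_loop, goal_cases)
  case 1
  show ?case using N by simp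
next
  case 2 show ?case by simp
next
  case 3 show ?case by (rule A)
next
  case (4 R1 A1)
  have R1: "R1 VN = n" and A1: "graph_ok (A1 AHead) (A1 ANxt) (A1 ATgt) (A1 ASrc)"
    "A1 ADegA = deg {1..m}" "A1 APar = (\<lambda>_. 0)" "A1 ALev = (\<lambda>_. 0)"
    using 4(1,2) N g A by simp_all
  have q1: "queue_inv {1..m} 0 (R1 VG) 0 (A1 AOrd) (A1 APar) (A1 ALev)"
    unfolding queue_inv_def using 4(3,4) A1(3,4) by (auto simp: deg_eq_0)
  show ?case
  proof (simp, rule wp_Loop[where \<mu> = "\<lambda>R A. R VX" and I = "\<lambda>R' A' out' k' t'.
        out' = out \<and> k' = k \<and> R' VH + R' VX = n \<and>
        t' + R' VX + card (pend (A' AOrd ` {1..R' VH}) 0 0) = t + 2 * n + m \<and>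
        (\<forall>x. x \<notin> {VG, VX, VH, VU, VE, VL, VW, VT} \<longrightarrow> R' x = R x) \<and>
        (\<forall>f. f \<notin> {ADegA, AOrd, APar, ALev} \<longrightarrow> A' f = A f) \<and>
        A' ADegA = deg (pend (A' AOrd ` {1..R' VH}) 0 0) \<and>
        queue_inv (pend (A' AOrd ` {1..R' VH}) 0 0) (R' VH) (R' VG)
          (if R' VH = 0 then 0 else Suc (A' ALev (A' AOrd (R' VH)))) (A' AOrd) (A' APar) (A'
            ALev)"], goal_cases)
    case 1
    show ?case using R1 A1 q1 4(1,2) by (simp add: pend_empty del: One_nat_def)
  next
    case (2 R' A' out' k' t')
    define H D where "H = R' VH" and "D = A' AOrd ` {1..H}"
    let ?G = "R' VG" and ?ord = "A' AOrd" and ?lev = "A' ALev"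
    note I = 2(1)[folded H_def, folded D_def]
    have fr: "\<forall>x. x \<notin> {VG, VX, VH, VU, VE, VL, VW, VT} \<longrightarrow> R' x = R x"
      "\<forall>f. f \<notin> {ADegA, AOrd, APar, ALev} \<longrightarrow> A' f = A f" "A' ADegA = deg (pend D 0 0)"
      "t' + R' VX + card (pend D 0 0) = t + 2 * n + m" "H + R' VX = n" "out' = out" "k' = k"
      using I by - (elim conjE, assumption)+
    have q: "queue_inv (pend D 0 0) H ?G (if H = 0 then 0 else Suc (?lev (?ord H))) ?ord (A' APar)
      ?lev"
      using I by (elim conjE) assumption
    note q' = q[unfolded queue_inv_def]
    have im: "?ord ` {1..?G} = {w \<in> {1..n}. deg (pend D 0 0) w = 0}"
      by (rule q'[THEN conjunct2, THEN conjunct2, THEN conjunct1])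
    have inj: "inj_on ?ord {1..?G}" and HG0: "H \<le> ?G" using q' by simp_all
    \<comment> \<open>Some item has not been removed yet, and the least such item is available, so
      the queue is nonempty.\<close>
    have "card D \<le> H" unfolding D_def using card_image_le[of "{1..H}" ?ord] by simp
    then have "card D < card {1..n}" using fr(5) 2(2) by simp
    then have "{1..n} - D \<noteq> {}"
      unfolding D_def by (metis Diff_eq_empty_iff card_mono finite_atLeastAtMost finite_imageI
        not_le)
    then obtain w where w: "w \<in> {1..n} - D" "deg (pend D 0 0) w = 0" by (rule avail)
    then have "w \<in> ?ord ` {1..?G}" "w \<notin> ?ord ` {1..H}" unfolding im by (auto simp: D_def)
    then have HG: "H < ?G" using HG0 by (metis le_neq_implies_less)
    define u where "u = ?ord (Suc H)"
    have "Suc H \<notin> {1..H}" "{1..H} \<subseteq> {1..?G}" "Suc H \<in> {1..?G}" using HG by auto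
    then have uD: "u \<notin> D" unfolding u_def D_def using inj by (metis inj_on_image_mem_iff)
    have D': "insert u D = ?ord ` {1..Suc H}"
    proof -
      have "{1..Suc H} = insert (Suc H) {1..H}" by auto
      then show ?thesis by (simp add: D_def u_def)
    qed
    have p: "pend (insert u D) u (last_arc u m) = pend D 0 0" by (rule pend_start[OF uD])
    have mono: "?lev (?ord a) \<le> ?lev (?ord b)" if "1 \<le> a" "a \<le> b" "b \<le> ?G" for a b
      using q' that by blast
    have B: "?lev (?ord b) \<le> Suc (?lev u)" if "b \<in> {1..?G}" for b
    proof -
      have "?lev (?ord b) \<le> (if H = 0 then 0 else Suc (?lev (?ord H)))"
        using q' that by blast
      \<comment> \<open>The bound moves from the previous head to the new one, whose level is at
        least as high.\<close>
      also have "\<dots> \<le> Suc (?lev u)" using mono[of H "Suc H"] HG by (auto simp: u_def)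
      finally show ?thesis .
    qed
    have q2: "queue_inv (pend D 0 0) (Suc H) ?G (Suc (?lev u)) ?ord (A' APar) ?lev"
      unfolding queue_inv_def
    proof (intro conjI)
      show "Suc H \<le> ?G" "inj_on ?ord {1..?G}" using HG inj by simp_all
      show "?ord ` {1..?G} = {w \<in> {1..n}. deg (pend D 0 0) w = 0}" by (rule im)
      show "\<forall>b\<in>{1..?G}. ?lev (?ord b) \<le> Suc (?lev u)" using B by blast
      show "\<forall>a b. 1 \<le> a \<longrightarrow> a \<le> b \<longrightarrow> b \<le> ?G \<longrightarrow> ?lev (?ord a) \<le> ?lev (?ord b)"
        using mono by blast
      show "\<forall>e\<in>{1..m}. tgt e \<in> ?ord ` {1..?G} \<longrightarrow> ?lev (src e) < ?lev (tgt e)"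
        using q' by - (elim conjE, assumption)
      show "\<forall>w\<in>?ord ` {1..?G}. (A' APar w = 0 \<and> ?lev w = 0) \<or>
          (?lev w = Suc (?lev (A' APar w)) \<and> (\<exists>e\<in>{1..m}. src e = A' APar w \<and> tgt e = w))"
        using q' by - (elim conjE, assumption)
    qed
    have g': "graph_ok (A' AHead) (A' ANxt) (A' ATgt) (A' ASrc)" using fr(2) g by simp
    have hd: "A' AHead u = last_arc u m" using g' by (simp add: graph_ok_def)
    show ?case
    proof (simp add: H_def[symmetric] u_def[symmetric] hd, rule wp_arcs_loopA[where D = "insert u
      D"], goal_cases)
      case 1 show ?case by (rule g')
    next
      case 2 show ?case by simp
    next
      case 3 show ?case by simp
    next
      case 4
      show ?case by (simp add: u_def)
    next
      case 5 show ?case by simp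
    next
      case 6 show ?case by simp
    next
      case 7
      show ?case using D' by simp
    next
      case 8
      show ?case using fr(3) p by simp
    next
      case 9
      show ?case using q2 p by simp
    next
      case (10 R2 A2 t2)
      have R2: "R2 VH = Suc H" "R2 VX = R' VX" "R2 VU = u" using 10(1) by simp_all
      have D2: "A2 AOrd ` {1..Suc H} = insert u D" using 10(4) by simp
      have p2: "pend (insert u D) u 0 = pend (insert u D) 0 0" by (rule pend_0)
      have "\<forall>x. x \<notin> {VG, VX, VH, VU, VE, VL, VW, VT} \<longrightarrow> R2 x = R x" using 10(1) fr(1) by simp
      moreover have "\<forall>f. f \<notin> {ADegA, AOrd, APar, ALev} \<longrightarrow> A2 f = A f"
        using 10(2) fr(2) by simp
      moreover have "R' VX = Suc (R' VX - 1)" using 2(2) by simp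
      moreover have "t2 + card (pend (insert u D) 0 0) = Suc t' + card (pend D 0 0)"
        using 10(8) p p2 by simp
      ultimately show ?case using 10(3,5,6,7) R2 D2[unfolded One_nat_def] p2 fr(4-7) by simp
    qed
  next
    case (3 R' A' out' k' t')
    let ?G = "R' VG" and ?ord = "A' AOrd" and ?lev = "A' ALev"
    define D where "D = A' AOrd ` {1..n}"
    have H: "R' VH = n" using 3 by simp
    note I = 3(1)[unfolded H, folded D_def]
    have q: "queue_inv (pend D 0 0) n ?G (if n = 0 then 0 else Suc (?lev (?ord n))) ?ord (A' APar)
      ?lev"
      using I by (elim conjE) assumption
    note q' = q[unfolded queue_inv_def]
    have im: "?ord ` {1..?G} = {w \<in> {1..n}. deg (pend D 0 0) w = 0}"
      by (rule q'[THEN conjunct2, THEN conjunct2, THEN conjunct1])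
    have inj: "inj_on ?ord {1..?G}" and HG0: "n \<le> ?G" using q' by simp_all
    have "card (?ord ` {1..?G}) \<le> card {1..n}" unfolding im by (rule card_mono) auto
    then have G: "?G = n" using card_image[OF inj] HG0 by simp
    have D: "D = {1..n}"
    proof (rule card_subset_eq)
      show "D \<subseteq> {1..n}"
      proof
        fix x
        assume "x \<in> D"
        then have "x \<in> ?ord ` {1..?G}" by (simp only: G D_def)
        then show "x \<in> {1..n}" unfolding im by simp
      qed
      show "card D = card {1..n}" unfolding D_def using card_image[OF inj] G by simp
    qed simp
    have "pend D 0 0 = {}" unfolding D pend_def using arc_range by auto
    then have t': "t' = t + 2 * n + m" using I 3(2) by simp
    have lev: "\<forall>e\<in>{1..m}. tgt e \<in> D \<longrightarrow> ?lev (src e) < ?lev (tgt e)"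
      using q' unfolding G D_def by blast
    have par: "\<forall>w\<in>D. (A' APar w = 0 \<and> ?lev w = 0) \<or>
        (?lev w = Suc (?lev (A' APar w)) \<and> (\<exists>e\<in>{1..m}. src e = A' APar w \<and> tgt e = w))"
      using q'[THEN conjunct2, THEN conjunct2, THEN conjunct2, THEN conjunct2, THEN conjunct2,
          THEN conjunct2] unfolding G D_def .
    have oD: "?ord ` {1..n} = {1..n}" using D by (simp only: D_def)
    have "Q R' A' out k (t + 2 * n + m)"
    proof (rule post)
      show "?ord ` {1..n} = {1..n}" by (rule oD)
      show "?lev (src e) < ?lev (tgt e)" if "e \<in> {1..m}" for e
        using lev that arc_range[OF that] D by blast
      show "?lev w \<le> ?lev (?ord n)" if "w \<in> {1..n}" for w
      proof -
        have "w \<in> ?ord ` {1..n}" unfolding oD by (rule that)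
        then obtain a where a: "a \<in> {1..n}" "w = ?ord a" by blast
        have "\<forall>a b. 1 \<le> a \<longrightarrow> a \<le> b \<longrightarrow> b \<le> n \<longrightarrow> ?lev (?ord a) \<le> ?lev (?ord b)"
          using q' unfolding G by - (elim conjE, assumption)
        then show ?thesis using a by simp
      qed
      show "(A' APar w = 0 \<and> ?lev w = 0) \<or>
        (?lev w = Suc (?lev (A' APar w)) \<and> (\<exists>e\<in>{1..m}. src e = A' APar w \<and> tgt e = w))"
        if "w \<in> {1..n}" for w
        using par that D by blast
    qed (use I in simp_all)
    then show ?case using I t' by simp
  qed
qed

end

section \<open>The path and the bounds derived from it\<close>

context sorting_input
begin

text \<open>\<open>J\<close> positions are still free, and \<open>L\<close> is the level of the last
  path item. Levels are consecutive along the path, which the equation with \<open>L + j\<close>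
  states without subtraction.\<close>

definition path_inv where
  "path_inv J L P pidx lev \<longleftrightarrow> J \<le> n \<and>
     (\<forall>j\<in>{J<..n}. P j \<in> {1..n} \<and> pidx (P j) = j \<and> lev (P j) + n = L + j) \<and>
     (\<forall>w. pidx w \<noteq> 0 \<longrightarrow> pidx w \<in> {J<..n} \<and> P (pidx w) = w) \<and>
     (\<forall>j. j \<notin> {J<..n} \<longrightarrow> P j = 0) \<and>
     (\<forall>j. J < j \<longrightarrow> j < n \<longrightarrow> (\<exists>e\<in>{1..m}. src e = P j \<and> tgt e = P (Suc j)))"

text \<open>Its level tells the new item from those already placed. So the path consists of distinct
  items, at most n in number, and a free position must be left.\<close>

lemma path_inv_step:
  assumes inv: "path_inv J L P pidx lev" and U: "U \<in> {1..n}" "lev U + n = L + J"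
    and arc: "J < n \<Longrightarrow> \<exists>e\<in>{1..m}. src e = U \<and> tgt e = P (Suc J)"
  shows "J \<noteq> 0" "path_inv (J - 1) L (P(J := U)) (pidx(U := J)) lev"
proof -
  have J: "J \<le> n" using inv by (simp add: path_inv_def)
  have P: "P j \<in> {1..n}" "pidx (P j) = j" "lev (P j) + n = L + j" if "j \<in> {J<..n}" for j
    using inv that by (simp_all add: path_inv_def)
  have pidx: "pidx w \<in> {J<..n}" "P (pidx w) = w" if "pidx w \<noteq> 0" for w
    using inv that unfolding path_inv_def by blast+
  have P0: "P j = 0" if "j \<notin> {J<..n}" for j
    using inv that unfolding path_inv_def by blast
  have arcs: "\<exists>e\<in>{1..m}. src e = P j \<and> tgt e = P (Suc j)" if "J < j" "j < n" for j
    using inv that unfolding path_inv_def by blast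
  have new: "P j \<noteq> U" if "j \<in> {J<..n}" for j
    using P(3)[OF that] U(2) that by auto
  have "inj_on P {J<..n}" using P(2) by (rule inj_on_inverseI)
  moreover have "U \<notin> P ` {J<..n}" using new by blast
  ultimately have "card (insert U (P ` {J<..n})) = Suc (n - J)" by (simp add: card_image)
  moreover have "card (insert U (P ` {J<..n})) \<le> card {1..n}"
    using U P(1) by (intro card_mono) auto
  ultimately show J0: "J \<noteq> 0" using J by auto
  have mem: "j \<in> {J - 1<..n} \<longleftrightarrow> j = J \<or> j \<in> {J<..n}" for j
    using J J0 by auto
  have pU: "pidx U = 0" using pidx[of U] new by blast
  show "path_inv (J - 1) L (P(J := U)) (pidx(U := J)) lev"
    unfolding path_inv_def
  proof (intro conjI ballI allI impI)
    show "J - 1 \<le> n" using J by simp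
    fix j
    assume j: "j \<in> {J - 1<..n}"
    show "(P(J := U)) j \<in> {1..n}" using j U P(1)[of j] unfolding mem by auto
    show "(pidx(U := J)) ((P(J := U)) j) = j"
      using j P(2)[of j] new[of j] unfolding mem by auto
    show "lev ((P(J := U)) j) + n = L + j" using j U P(3)[of j] unfolding mem by auto
  next
    fix w
    assume w: "(pidx(U := J)) w \<noteq> 0"
    show "(pidx(U := J)) w \<in> {J - 1<..n}" unfolding mem using w pidx(1)[of w] by auto
    show "(P(J := U)) ((pidx(U := J)) w) = w" using w pidx[of w] by auto
  next
    fix j
    assume "j \<notin> {J - 1<..n}"
    then show "(P(J := U)) j = 0" unfolding mem using P0[of j] by auto
  next
    fix j
    assume j: "J - 1 < j" "j < n"
    show "\<exists>e\<in>{1..m}. src e = (P(J := U)) j \<and> tgt e = (P(J := U)) (Suc j)"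
    proof (cases "j = J")
      case True
      then show ?thesis using arc j by simp
    next
      case False
      then show ?thesis using arcs[of j] j by simp
    qed
  qed
qed

lemma wp_find_path:
  assumes N: "R VN = n" "1 \<le> n" and A: "A AP = (\<lambda>_. 0)" "A APidx = (\<lambda>_. 0)"
    and ord: "A AOrd n \<in> {1..n}"
    and par: "\<And>w. w \<in> {1..n} \<Longrightarrow> (A APar w = 0 \<and> A ALev w = 0) \<or>
        (A ALev w = Suc (A ALev (A APar w)) \<and> (\<exists>e\<in>{1..m}. src e = A APar w \<and> tgt e = w))"
    and post: "\<And>R' A' t' off. \<lbrakk>\<And>x. x \<notin> {VJ, VU, VO} \<Longrightarrow> R' x = R x;
      \<And>f. f \<notin> {AP, APidx} \<Longrightarrow> A' f = A f; R' VJ = off; R' VO = off;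
      path_inv off (A ALev (A AOrd n)) (A' AP) (A' APidx) (A ALev);
      A ALev (A AOrd n) + off + 1 = n; t' \<le> t + n\<rbrakk> \<Longrightarrow> Q R' A' out k t'"
  shows "wp r inp find_path Q R A out k t"
  unfolding find_path_def
proof (simp add: N, rule wp_Loop[where \<mu> = "\<lambda>R A. R VJ" and I = "\<lambda>R' A' out' k' t'.
      out' = out \<and> k' = k \<and> t' + R' VJ = t + n \<and>
      (\<forall>x. x \<notin> {VJ, VU, VO} \<longrightarrow> R' x = R x) \<and> (\<forall>f. f \<notin> {AP, APidx} \<longrightarrow> A' f = A f) \<and>
      path_inv (R' VJ) (A ALev (A AOrd n)) (A' AP) (A' APidx) (A ALev) \<and>
      (R' VU \<noteq> 0 \<longrightarrow> R' VU \<in> {1..n} \<and> A ALev (R' VU) + n = A ALev (A AOrd n) + R' VJ \<and>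
        (R' VJ < n \<longrightarrow> (\<exists>e\<in>{1..m}. src e = R' VU \<and> tgt e = A' AP (Suc (R' VJ))))) \<and>
      (R' VU = 0 \<longrightarrow> A ALev (A AOrd n) + R' VJ + 1 = n)"], goal_cases)
  case 1
  have "path_inv n (A ALev (A AOrd n)) (A AP) (A APidx) (A ALev)"
    unfolding path_inv_def A by simp
  moreover have "A AOrd n \<noteq> 0" using ord by auto
  ultimately show ?case using ord by simp
next
  case (2 R' A' out' k' t')
  define U J L where "U = R' VU" and "J = R' VJ" and "L = A ALev (A AOrd n)"
  have fr: "out' = out" "k' = k" "t' + R' VJ = t + n" "\<forall>x. x \<notin> {VJ, VU, VO} \<longrightarrow> R' x = R x"
    "\<forall>f. f \<notin> {AP, APidx} \<longrightarrow> A' f = A f" "path_inv (R' VJ) (A ALev (A AOrd n)) (A' AP) (A' APidx) (A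
      ALev)"
    using 2(1) by - (elim conjE, assumption)+
  have U: "U \<in> {1..n}" "A ALev U + n = L + J" "J < n \<Longrightarrow> \<exists>e\<in>{1..m}. src e = U \<and> tgt e = A' AP (Suc J)"
    using 2 by (simp_all add: U_def J_def L_def)
  have inv: "path_inv J L (A' AP) (A' APidx) (A ALev)" unfolding J_def L_def by (rule fr)
  note step = path_inv_step[OF inv U]
  have par': "A' APar U = A APar U" using fr(5) by simp
  have "A APar U \<noteq> 0 \<Longrightarrow> A APar U \<in> {1..n} \<and> A ALev (A APar U) + n = L + (J - 1) \<and>
      (\<exists>e\<in>{1..m}. src e = A APar U \<and> tgt e = U)"
    using par[OF U(1)] U(2) step(1) arc_range by force
  moreover have "A APar U = 0 \<Longrightarrow> L + (J - 1) + 1 = n"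
    using par[OF U(1)] U(2) step(1) arc_range by force
  moreover have "Suc (J - 1) = J" using step(1) by simp
  ultimately show ?case
    using fr(1-5) step par' N(2)
    by (simp add: U_def[symmetric] J_def[symmetric] L_def[symmetric] del: One_nat_def)
next
  case (3 R' A' out' k' t')
  have fr: "out' = out" "k' = k" "t' + R' VJ = t + n" "\<forall>x. x \<notin> {VJ, VU, VO} \<longrightarrow> R' x = R x"
    "\<forall>f. f \<notin> {AP, APidx} \<longrightarrow> A' f = A f" "path_inv (R' VJ) (A ALev (A AOrd n)) (A' AP) (A' APidx) (A
      ALev)"
    using 3(1) by - (elim conjE, assumption)+
  have "A ALev (A AOrd n) + R' VJ + 1 = n" using 3 by blast
  then have "Q (R'(VO := R' VJ)) A' out k t'"
    using fr by (intro post[of _ _ "R' VJ"]) simp_all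
  then show ?case using fr by simp
qed

lemma wp_find_lower_bounds:
  assumes M: "R VM = m" and g: "graph_ok (A AHead) (A ANxt) (A ATgt) (A ASrc)" and A: "A ALp = (\<lambda>_.
    0)"
    and post: "\<And>R' A'. \<lbrakk>\<And>x. x \<notin> {VX, VU, VW, VT, VL} \<Longrightarrow> R' x = R x;
      \<And>f. f \<notin> {ALp} \<Longrightarrow> A' f = A f; \<And>e. e \<in> {1..m} \<Longrightarrow> A APidx (src e) \<le> A' ALp (tgt e);
      \<And>w. A' ALp w = 0 \<or> (\<exists>e\<in>{1..m}. tgt e = w \<and> A' ALp w = A APidx (src e))\<rbrakk> \<Longrightarrow>
      Q R' A' out k (t + m)"
  shows "wp r inp find_lower_bounds Q R A out k t"
  unfolding find_lower_bounds_def
proof (simp add: M, rule wp_Loop[where \<mu> = "\<lambda>R A. R VX" and I = "\<lambda>R' A' out' k' t'.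
      out' = out \<and> k' = k \<and> t' + R' VX = t + m \<and> R' VX \<le> m \<and>
      (\<forall>x. x \<notin> {VX, VU, VW, VT, VL} \<longrightarrow> R' x = R x) \<and> (\<forall>f. f \<notin> {ALp} \<longrightarrow> A' f = A f) \<and>
      (\<forall>e\<in>{R' VX<..m}. A APidx (src e) \<le> A' ALp (tgt e)) \<and>
      (\<forall>w. A' ALp w = 0 \<or> (\<exists>e\<in>{1..m}. tgt e = w \<and> A' ALp w = A APidx (src e)))"], goal_cases)
  case 1
  show ?case using M by (simp add: A)
next
  case (2 R' A' out' k' t')
  define x where "x = R' VX"
  have fr: "out' = out" "k' = k" "t' + x = t + m" "x \<le> m" "\<forall>x. x \<notin> {VX, VU, VW, VT, VL} \<longrightarrow> R' x = R
    x"
    "\<forall>f. f \<notin> {ALp} \<longrightarrow> A' f = A f" "\<forall>e\<in>{x<..m}. A APidx (src e) \<le> A' ALp (tgt e)"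
    "\<forall>w. A' ALp w = 0 \<or> (\<exists>e\<in>{1..m}. tgt e = w \<and> A' ALp w = A APidx (src e))"
    using 2(1)[folded x_def] by - (elim conjE, assumption)+
  have x: "x \<in> {1..m}" "x \<noteq> 0" using 2(2) fr(4) by (auto simp: x_def)
  have g': "A' ASrc x = src x" "A' ATgt x = tgt x" "A' APidx = A APidx"
    using g fr(6) x by (simp_all add: graph_ok_def)
  let ?v = "A' ALp (tgt x) + (A APidx (src x) - A' ALp (tgt x))"
  have v: "?v = max (A' ALp (tgt x)) (A APidx (src x))" by simp
  let ?lp = "(A' ALp)(tgt x := ?v)"
  have 1: "A APidx (src e) \<le> ?lp (tgt e)" if "e \<in> {x - 1<..m}" for e
  proof (cases "e = x")
    case False
    then have "A APidx (src e) \<le> A' ALp (tgt e)" using fr(7) that by auto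
    then show ?thesis unfolding v by auto
  qed (simp add: v)
  have 2: "?lp w = 0 \<or> (\<exists>e\<in>{1..m}. tgt e = w \<and> ?lp w = A APidx (src e))" for w
  proof (cases "w = tgt x \<and> A' ALp (tgt x) \<le> A APidx (src x)")
    case True
    then show ?thesis using x by auto
  next
    case False
    then have "?lp w = A' ALp w" by auto
    then show ?thesis using fr(8) by presburger
  qed
  have "Suc (t' + (x - 1)) = t + m" "x - 1 \<le> m" "x - 1 < x" using fr(3,4) x by auto
  then show ?case
    using fr(1,2,5,6) g' 1 2 
    by (simp add: x_def[symmetric] del: fun_upd_apply add: fun_upd_same fun_upd_other)
next
  case (3 R' A' out' k' t')
  have "Q R' A' out k (t + m)" using 3 by (intro post) auto
  then show ?case using 3 by simp
qed

end

text \<open>\<open>lp_arc\<close> says that \<open>lp\<close> is attained, so a search that starts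
  there starts at a true lower bound. \<open>lev_path\<close> gives every item outside the path its
  counterpart on the same level.\<close>

locale path_input = sorting_input +
  fixes off :: nat and P pidx lp lev :: "nat \<Rightarrow> nat"
  assumes off: "off < n"
    and P: "j \<in> {off<..n} \<Longrightarrow> P j \<in> {1..n} \<and> pidx (P j) = j"
    and pidx: "pidx w \<noteq> 0 \<Longrightarrow> pidx w \<in> {off<..n} \<and> P (pidx w) = w"
    and P_0: "j \<notin> {off<..n} \<Longrightarrow> P j = 0"
    and path_arc: "off < j \<Longrightarrow> j < n \<Longrightarrow> \<exists>e\<in>{1..m}. src e = P j \<and> tgt e = P (Suc j)"
    and lev: "e \<in> {1..m} \<Longrightarrow> lev (src e) < lev (tgt e)"
    and lev_path: "w \<in> {1..n} \<Longrightarrow> \<exists>j\<in>{off<..n}. lev (P j) = lev w"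
    and lp: "e \<in> {1..m} \<Longrightarrow> pidx (src e) \<le> lp (tgt e)"
    and lp_arc: "lp w = 0 \<or> (\<exists>e\<in>{1..m}. tgt e = w \<and> lp w = pidx (src e))"

lemma (in sorting_input) path_inputI:
  assumes "path_inv off L P pidx lev" "L + off + 1 = n"
    and "\<And>e. e \<in> {1..m} \<Longrightarrow> lev (src e) < lev (tgt e)" "\<And>w. w \<in> {1..n} \<Longrightarrow> lev w \<le> L"
    and "\<And>e. e \<in> {1..m} \<Longrightarrow> pidx (src e) \<le> lp (tgt e)"
    and "\<And>w. lp w = 0 \<or> (\<exists>e\<in>{1..m}. tgt e = w \<and> lp w = pidx (src e))"
  shows "path_input n arcs r off P pidx lp lev"
proof
  show "off < n" using assms by simp
  note inv = assms(1)[unfolded path_inv_def]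
  show "P j \<in> {1..n} \<and> pidx (P j) = j" if "j \<in> {off<..n}" for j
    using inv that by blast
  show "pidx w \<in> {off<..n} \<and> P (pidx w) = w" if "pidx w \<noteq> 0" for w
    using inv that by blast
  show "P j = 0" if "j \<notin> {off<..n}" for j
    using inv that by blast
  show "\<exists>e\<in>{1..m}. src e = P j \<and> tgt e = P (Suc j)" if "off < j" "j < n" for j
    using inv that by blast
  show "\<exists>j\<in>{off<..n}. lev (P j) = lev w" if "w \<in> {1..n}" for w
  proof
    have "lev w \<le> L" using assms(4) that by blast
    \<comment> \<open>The path has one item on each of the levels from 0 to \<open>L\<close>, the
      last one at position n.\<close>
    then show "n + lev w - L \<in> {off<..n}" using assms(2) by auto
    then have "lev (P (n + lev w - L)) + n = L + (n + lev w - L)" using inv by blast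
    then show "lev (P (n + lev w - L)) = lev w" using assms(2) by simp
  qed
qed (use assms in auto)

context path_input
begin

definition K :: "nat set" where
  "K = {v \<in> {1..n}. pidx v = 0}"

lemma P_in: "j \<in> {off<..n} \<Longrightarrow> P j \<in> {1..n}" and pidx_P: "j \<in> {off<..n} \<Longrightarrow> pidx (P j) = j"
  using P by blast+

lemma inj_P: "inj_on P {off<..n}"
  using pidx_P by (rule inj_on_inverseI)

lemma path_image: "P ` {off<..n} = {1..n} - K"
proof
  show "P ` {off<..n} \<subseteq> {1..n} - K" using P by (fastforce simp: K_def)
  show "{1..n} - K \<subseteq> P ` {off<..n}"
  proof
    fix w
    assume "w \<in> {1..n} - K"
    then have "pidx w \<noteq> 0" by (simp add: K_def)
    then show "w \<in> P ` {off<..n}" using pidx[of w] by (metis imageI)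
  qed
qed

lemma K_sub: "K \<subseteq> {1..n}"
  by (auto simp: K_def)

lemma finite_K [simp]: "finite K"
  by (rule finite_subset[OF K_sub]) simp

text \<open>The path fills the positions after \<open>off\<close> with distinct items, so the free
  positions are as many as the items outside it.\<close>

lemma card_K: "card K = off"
proof -
  have "card ({1..n} - K) = n - off" using card_image[OF inj_P] unfolding path_image by simp
  moreover have "card ({1..n} - K) = n - card K" using K_sub by (simp add: card_Diff_subset)
  moreover have "card K \<le> n" using card_mono[OF _ K_sub] by simp
  ultimately show ?thesis using off by linarith
qed

lemma pidx_le: "pidx w \<le> n"
  using pidx[of w] by (cases "pidx w = 0") auto

lemma P_less: "off < i \<Longrightarrow> i < j \<Longrightarrow> j \<le> n \<Longrightarrow> lt r (P i) (P j)"
proof (induction j)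
  case (Suc j)
  then have "lt r (P j) (P (Suc j))"
    using path_arc[of j] arc_lt by (metis Suc_le_lessD less_Suc_eq order.strict_trans)
  then show ?case using Suc trans by (cases "i = j") auto
qed simp

lemma P_less_iff:
  assumes "i \<in> {off<..n}" "j \<in> {off<..n}"
  shows "lt r (P i) (P j) \<longleftrightarrow> i < j"
proof (cases i j rule: linorder_cases)
  case less
  then show ?thesis using P_less[of i j] assms by simp
next
  case equal
  then show ?thesis using irrefl by simp
next
  case greater
  then show ?thesis using P_less[of j i] assms asym by auto
qed

text \<open>Successive path items are joined by distinct arcs, told apart by their targets. Ticks
  linear in n can thus be charged to the arcs and to \<open>off\<close>.\<close>

lemma n_le: "n \<le> m + off + 1"
proof -
  have "\<forall>j\<in>{off<..<n}. \<exists>e. e \<in> {1..m} \<and> tgt e = P (Suc j)" using path_arc by fastforce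
  then obtain f where f: "\<And>j. j \<in> {off<..<n} \<Longrightarrow> f j \<in> {1..m} \<and> tgt (f j) = P (Suc j)"
    by metis
  have "inj_on f {off<..<n}"
  proof (rule inj_on_inverseI)
    fix j
    assume "j \<in> {off<..<n}"
    then show "pidx (tgt (f j)) - 1 = j" using f[of j] P[of "Suc j"] by simp
  qed
  then have "card {off<..<n} \<le> card {1..m}" using f by (intro card_inj_on_le) auto
  then show ?thesis by simp
qed

definition T :: nat where
  "T = card (topological_orders {..<n} (set arcs))"

text \<open>Items are numbered from 0 in the counting lemmas and from 1 in the program; this links
  the two versions of \<open>K\<close>.\<close>

lemma Suc_K: "Suc ` {v. v < n \<and> Suc v \<in> K} = K"
proof -
  have "w \<in> Suc ` {v. v < n \<and> Suc v \<in> K}" if "w \<in> K" for w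
  proof -
    have "w \<in> {1..n}" using that K_sub by blast
    then show ?thesis using that by (intro image_eqI[of _ _ "w - 1"]) auto
  qed
  then show ?thesis by auto
qed

lemma card_K0: "card {v. v < n \<and> Suc v \<in> K} = card K"
  using card_image[of Suc "{v. v < n \<and> Suc v \<in> K}"] Suc_K by simp

lemma prod_K0: "(\<Prod>v\<in>{v. v < n \<and> Suc v \<in> K}. f (Suc v)) = (\<Prod>v\<in>K. f v)"
  using prod.reindex[of Suc "{v. v < n \<and> Suc v \<in> K}" f] Suc_K by (simp add: comp_def)

lemma two_pow_off_le: "2 ^ off \<le> T"
proof -
  have "2 ^ card {v. v < n \<and> Suc v \<in> K} \<le> T"
    unfolding T_def
  proof (rule two_pow_le_card_topological_orders[where lev = "\<lambda>v. lev (Suc v)"])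
    show "set arcs \<subseteq> {..<n} \<times> {..<n}" by (rule arcs_range)
    show "lev (Suc u) < lev (Suc v)" if "(u, v) \<in> set arcs" for u v
      using arc_index[OF that] lev by metis
    show "\<exists>y<n. y \<notin> {v. v < n \<and> Suc v \<in> K} \<and> lev (Suc y) = lev (Suc x)"
      if x: "x \<in> {v. v < n \<and> Suc v \<in> K}" for x
    proof -
      obtain j where j: "j \<in> {off<..n}" "lev (P j) = lev (Suc x)"
        using lev_path[of "Suc x"] x by auto
      then have "P j \<in> {1..n}" "P j \<notin> K" using P[of j] by (auto simp: K_def)
      then show ?thesis using j by (intro exI[of _ "P j - 1"]) auto
    qed
  qed auto
  then show ?thesis by (simp add: card_K0 card_K)
qed

lemma prod_lifetimes:
  fixes a b :: "nat \<Rightarrow> nat"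
  assumes KK: "\<And>e. e \<in> {1..m} \<Longrightarrow> tgt e \<in> K \<Longrightarrow> b (src e) < a (tgt e)"
    and P: "\<And>e. e \<in> {1..m} \<Longrightarrow> tgt e \<notin> K \<Longrightarrow> b (src e) \<le> b (tgt e)"
    and b: "\<And>x. x \<in> K \<Longrightarrow> b x \<le> off"
  shows "(\<Prod>x\<in>K. Suc (b x) - a x) \<le> T * 2 ^ (2 * off)"
proof -
  have "(\<Prod>v\<in>{v. v < n \<and> Suc v \<in> K}. Suc (b (Suc v)) - a (Suc v)) \<le> T * 2 ^ (2 * card {v. v < n \<and> Suc
    v \<in> K})"
    unfolding T_def
  proof (rule prod_lifetimes_le[where p = "\<lambda>v. pidx (Suc v)"])
    show "set arcs \<subseteq> {..<n} \<times> {..<n}" by (rule arcs_range)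
    fix u v
    assume uv: "(u, v) \<in> set arcs"
    then have range: "u < n" "v < n" using arcs_range by auto
    obtain e where e: "e \<in> {1..m}" "src e = Suc u" "tgt e = Suc v"
      using arc_index[OF uv] by blast
    show "b (Suc u) < a (Suc v)" if "v \<in> {v. v < n \<and> Suc v \<in> K}"
      using KK[OF e(1)] e that by simp
    then show "b (Suc u) < a (Suc v)" if "v \<in> {v. v < n \<and> Suc v \<in> K}" using that by blast
    show le: "b (Suc u) \<le> b (Suc v)" if "v \<notin> {v. v < n \<and> Suc v \<in> K}"
      using P[OF e(1)] e that range by simp
    show "b (Suc u) \<le> b (Suc v) \<and> pidx (Suc u) < pidx (Suc v)"
      if "u \<notin> {v. v < n \<and> Suc v \<in> K}" "v \<notin> {v. v < n \<and> Suc v \<in> K}"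
    proof
      have "pidx (Suc u) \<noteq> 0" "pidx (Suc v) \<noteq> 0" using that range by (auto simp: K_def)
      then show "pidx (Suc u) < pidx (Suc v)"
        using pidx[of "Suc u"] pidx[of "Suc v"] arc_lt[OF e(1)] P_less_iff e by metis
    qed (rule le[OF that(2)])
  qed (use b pidx_le in \<open>auto simp: card_K0 card_K\<close>)
  then show ?thesis by (simp add: card_K0 card_K prod_K0[of "\<lambda>v. Suc (b v) - a v"])
qed

lemma prod_gaps:
  fixes a b q :: "nat \<Rightarrow> nat"
  assumes KK: "\<And>e. e \<in> {1..m} \<Longrightarrow> src e \<in> K \<Longrightarrow> tgt e \<in> K \<Longrightarrow> q (src e) < q (tgt e) \<and> b (src e) \<le> a (tgt
    e)"
    and KP: "\<And>e. e \<in> {1..m} \<Longrightarrow> src e \<in> K \<Longrightarrow> tgt e \<notin> K \<Longrightarrow> b (src e) < pidx (tgt e)"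
    and a: "\<And>x. x \<in> K \<Longrightarrow> lp x \<le> a x \<and> off \<le> a x \<and> b x \<le> n"
    and q: "\<And>x. x \<in> K \<Longrightarrow> 1 \<le> q x \<and> q x \<le> k"
  shows "(\<Prod>x\<in>K. Suc (b x) - a x) \<le> T"
proof -
  have "(\<Prod>v\<in>{v. v < n \<and> Suc v \<in> K}. Suc (b (Suc v)) - a (Suc v)) \<le> T"
    unfolding T_def
  proof (rule prod_gaps_le[where p = "\<lambda>v. pidx (Suc v)" and q = "\<lambda>v. q (Suc v)" and m = k])
    show "set arcs \<subseteq> {..<n} \<times> {..<n}" by (rule arcs_range)
    fix u v
    assume uv: "(u, v) \<in> set arcs"
    then have range: "u < n" "v < n" using arcs_range by auto
    obtain e where e: "e \<in> {1..m}" "src e = Suc u" "tgt e = Suc v"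
      using arc_index[OF uv] by blast
    show "q (Suc u) < q (Suc v) \<and> b (Suc u) \<le> a (Suc v)"
      if "u \<in> {v. v < n \<and> Suc v \<in> K}" "v \<in> {v. v < n \<and> Suc v \<in> K}"
      using KK[OF e(1)] e that by simp
    show "b (Suc u) < pidx (Suc v)"
      if "u \<in> {v. v < n \<and> Suc v \<in> K}" "v \<notin> {v. v < n \<and> Suc v \<in> K}"
      using KP[OF e(1)] e that range by simp
    show "pidx (Suc u) \<le> a (Suc v)" if "v \<in> {v. v < n \<and> Suc v \<in> K}"
      using lp[OF e(1)] a[of "Suc v"] that e by simp
    show "pidx (Suc u) < pidx (Suc v)"
      if "u \<notin> {v. v < n \<and> Suc v \<in> K}" "v \<notin> {v. v < n \<and> Suc v \<in> K}"
    proof -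
      have "pidx (Suc u) \<noteq> 0" "pidx (Suc v) \<noteq> 0" using that range by (auto simp: K_def)
      then show "pidx (Suc u) < pidx (Suc v)"
        using pidx[of "Suc u"] pidx[of "Suc v"] arc_lt[OF e(1)] P_less_iff e by metis
    qed
  next
    fix x j
    assume x: "x \<in> {v. v < n \<and> Suc v \<in> K}" and j: "a (Suc x) < j" "j \<le> b (Suc x)"
    then have "j \<in> {off<..n}" using a[of "Suc x"] by auto
    then have "P j \<in> {1..n}" "pidx (P j) = j" using P by auto
    then show "\<exists>y<n. y \<notin> {v. v < n \<and> Suc v \<in> K} \<and> pidx (Suc y) = j"
      using j by (intro exI[of _ "P j - 1"]) (auto simp: K_def)
  qed (use q in auto)
  then show ?thesis by (simp add: prod_K0[of "\<lambda>v. Suc (b v) - a v"])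
qed

end

section \<open>Sorting the items outside the path\<close>

text \<open>In-degree plus path index vanishes exactly for the available items outside the path, so
  one test covers both conditions.\<close>

definition seed_loop :: com where
  "seed_loop = Loop VX (Rd VT ADegB VX ;; Rd VL APidx VX ;; Plus VT VT VL ;;
     Cond VT Skip (Copy VW VX ;; insert_item) ;; Dec VX)"

definition arcs_loopB :: com where
  "arcs_loopB = Loop VE (Rd VW ATgt VE ;; Rd VT ADegB VW ;; Dec VT ;; Wr ADegB VW VT ;;
     Rd VL APidx VW ;; Plus VT VT VL ;; Cond VT Skip insert_item ;; Rd VE ANxt VE)"

text \<open>The arrays \<open>AIns\<close> and \<open>ADel\<close> are never read: they record the lifetimes for the analysis.\<close>

definition release :: com where
  "release = Wr ADel VU VC ;; Rd VE AHead VU ;; arcs_loopB ;; Dec VX"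

definition heapsort :: com where
  "heapsort = Set VT 1 ;; Set VZ 0 ;; Wr ADegB VZ VT ;; Copy VF VN ;; Set VC 0 ;; Copy VX VN ;;
     seed_loop ;; Set VK 0 ;; Copy VX VN ;;
     Loop VX (Copy VT VJ ;; Inc VT ;; Rd VU AP VT ;; Rd VT ADegB VU ;;
       Cond VT (Set VI 0 ;; Rd VU AS VI ;; delete_item ;; Inc VK ;; Wr AQ VK VU) (Inc VJ) ;;
       release)"

section \<open>Invariant of the queue phase\<close>

context path_input
begin

definition static :: "(arr \<Rightarrow> nat \<Rightarrow> nat) \<Rightarrow> bool" where
  "static A \<longleftrightarrow> graph_ok (A AHead) (A ANxt) (A ATgt) (A ASrc) \<and> A AP = P \<and> A APidx = pidx \<and> A ALp =
    lp"

definition ready :: "nat set \<Rightarrow> nat set \<Rightarrow> nat set" where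
  "ready X V = {v \<in> K \<inter> V. deg X v = 0}"

text \<open>
  \<open>X\<close> are the pending arcs, \<open>V\<close> the items considered so far, and \<open>D\<close> the deleted items.  The entry 1
  for null makes the end of the path look like an item that is not available.
\<close>

definition hs_inv where
  "hs_inv X V D F c degb ins del mn lft rgt up sA sB S \<longleftrightarrow>
     heap r n (ready X V) (ready X V - D) F c ins mn lft rgt up sA sB S \<and>
     degb = (deg X)(0 := 1) \<and> c = card (ready X V) \<and>
     (\<forall>x\<in>ready X V. 1 \<le> ins x \<and> ins x \<le> c) \<and>
     (\<forall>e\<in>{1..m}. tgt e \<in> ready X V \<longrightarrow> src e \<in> D \<and> del (src e) < ins (tgt e)) \<and>
     (\<forall>u\<in>D. del u \<le> c)"

abbreviation hs_state where
  "hs_state X V D R A \<equiv> hs_inv X V D (R VF) (R VC) (A ADegB) (A AIns) (A ADel) (A AMn) (A ALft)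
     (A ARgt) (A AUp) (A ASA) (A ASB) (A AS)"

lemma hs_invD:
  assumes "hs_inv X V D F c degb ins del mn lft rgt up sA sB S"
  shows "heap r n (ready X V) (ready X V - D) F c ins mn lft rgt up sA sB S"
    "degb = (deg X)(0 := 1)" "c = card (ready X V)"
    "x \<in> ready X V \<Longrightarrow> 1 \<le> ins x \<and> ins x \<le> c"
    "e \<in> {1..m} \<Longrightarrow> tgt e \<in> ready X V \<Longrightarrow> src e \<in> D \<and> del (src e) < ins (tgt e)"
    "u \<in> D \<Longrightarrow> del u \<le> c"
  using assms unfolding hs_inv_def by blast+

text \<open>All predecessors of \<open>w\<close> have deletion times at most \<open>c\<close>, while
  \<open>w\<close> gets insertion number \<open>c + 1\<close>. This is what makes the lifetimes of
  comparable items disjoint.\<close>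

lemma wp_insert_hs:
  assumes h: "heap_state r n In (In - D) R A" and c: "R VC = card In"
    and ins: "\<And>x. x \<in> In \<Longrightarrow> 1 \<le> A AIns x \<and> A AIns x \<le> R VC"
    and arc: "\<And>e. e \<in> {1..m} \<Longrightarrow> tgt e \<in> In \<Longrightarrow> src e \<in> D \<and> A ADel (src e) < A AIns (tgt e)"
    and del: "\<And>u. u \<in> D \<Longrightarrow> A ADel u \<le> R VC"
    and degb: "A ADegB = (deg X)(0 := 1)"
    and w: "R VW = w" "w \<notin> In" "w \<notin> D" "ready X V = insert w In"
      "\<And>e. e \<in> {1..m} \<Longrightarrow> tgt e = w \<Longrightarrow> src e \<in> D"
    and post: "\<And>R' A' d. \<lbrakk>\<And>x. x \<notin> {VC, VA, VF, VT, VL, VB, VZ, VI} \<Longrightarrow> R' x = R x;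
      \<And>f. f \<notin> {AIns, ALft, ARgt, AUp, AMn, ASA, ASB, AS} \<Longrightarrow> A' f = A f;
      R' VC = Suc (R VC); R' VF = R VF + d; \<And>x. x \<noteq> w \<Longrightarrow> A' AIns x = A AIns x;
      hs_state X V D R' A'\<rbrakk> \<Longrightarrow>
      Q R' A' out (k + 3 * d + 2) (t + 2 * d + 1)"
  shows "wp r inp insert_item Q R A out k t"
proof (rule wp_insert_item[OF h], goal_cases)
  case 1
  have "w \<in> K" using w(4) by (auto simp: ready_def)
  then show ?case using K_sub w(1) by blast
next
  case 2
  then show ?case using w by simp
next
  case (3 R' A' d)
  have fin: "finite In" using w(4) finite_subset[of In K] by (auto simp: ready_def)
  have ins': "A' AIns x = A AIns x" if "x \<in> In" for x
    using 3(4) that w(1,2) by auto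
  have insw: "A' AIns w = Suc (R VC)" using 3(4) w(1) by simp
  have del': "A' ADel = A ADel" "A' ADegB = A ADegB" using 3(2) by simp_all
  have "insert w In - D = insert w (In - D)" using w(3) by blast
  then have h': "heap_state r n (insert w In) (insert w In - D) R' A'"
    using 3(6) w(1) by simp
  have ins2: "\<forall>x\<in>insert w In. 1 \<le> A' AIns x \<and> A' AIns x \<le> R' VC"
    using ins ins' insw 3(3) by fastforce
  have arc2: "\<forall>e\<in>{1..m}. tgt e \<in> insert w In \<longrightarrow> src e \<in> D \<and> A' ADel (src e) < A' AIns (tgt e)"
  proof (intro ballI impI)
    fix e
    assume e: "e \<in> {1..m}" "tgt e \<in> insert w In"
    show "src e \<in> D \<and> A' ADel (src e) < A' AIns (tgt e)"
    proof (cases "tgt e = w")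
      case True
      then have "src e \<in> D" using w(5) e by blast
      then show ?thesis using del[of "src e"] True insw del' by simp
    next
      case False
      then show ?thesis using arc[of e] e ins' del' by auto
    qed
  qed
  have "hs_state X V D R' A'"
    unfolding hs_inv_def w(4)
    using h' degb del' ins2 arc2 del 3(3) c fin w(2) by (auto intro: le_SucI)
  moreover have "A' AIns x = A AIns x" if "x \<noteq> w" for x
    using 3(4) that w(1) by simp
  ultimately show ?case using 3 by (intro post)
qed

text \<open>\<open>VF\<close> starts at n, so \<open>3 * VF - 3 * n\<close> accounts for the carries
  and \<open>2 * VC\<close> for the fixed part of the insertions. The main phase continues with
  bounds of the same form.\<close>

lemma wp_seed_loop:
  assumes R: "R VX = n" "R VF = n" "R VC = 0"
    and A: "A ADegB = (deg {1..m})(0 := 1)" "A APidx = pidx" "A AMn = (\<lambda>_. 0)" "A ALft = (\<lambda>_. 0)"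
      "A ARgt = (\<lambda>_. 0)" "A AUp = (\<lambda>_. 0)" "A ASA = (\<lambda>_. 0)" "A ASB = (\<lambda>_. 0)" "A AS = (\<lambda>_. 0)"
    and post: "\<And>R' A' k' t'. \<lbrakk>\<And>x. x \<notin> {VX, VW, VC, VA, VF, VT, VL, VB, VZ, VI} \<Longrightarrow> R' x = R x;
      \<And>f. f \<notin> {AIns, ALft, ARgt, AUp, AMn, ASA, ASB, AS} \<Longrightarrow> A' f = A f;
      hs_state {1..m} {1..n} {} R' A';
      k' + 3 * n = k + 3 * R' VF + 2 * R' VC; t' + n = t + 2 * R' VF + R' VC\<rbrakk> \<Longrightarrow>
      Q R' A' out k' t'"
  shows "wp r inp seed_loop Q R A out k t"
  unfolding seed_loop_def
proof (rule wp_Loop[where \<mu> = "\<lambda>R A. R VX" and I = "\<lambda>R' A' out' k' t'. out' = out \<and> R' VX \<le> n \<and>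
      (\<forall>x. x \<notin> {VX, VW, VC, VA, VF, VT, VL, VB, VZ, VI} \<longrightarrow> R' x = R x) \<and>
      (\<forall>f. f \<notin> {AIns, ALft, ARgt, AUp, AMn, ASA, ASB, AS} \<longrightarrow> A' f = A f) \<and>
      hs_state {1..m} {R' VX<..n} {} R' A' \<and>
      k' + 3 * n = k + 3 * R' VF + 2 * R' VC \<and> t' + n + R' VX = t + 2 * R' VF + R' VC"], goal_cases)
  case 1
  have "ready {1..m} {n<..n} = {}" by (simp add: ready_def)
  then have "hs_state {1..m} {n<..n} {} R A" using A R heap_empty by (simp add: hs_inv_def)
  then show ?case using R by simp
next
  case (2 R' A' out' k' t')
  define x where "x = R' VX"
  have fr: "out' = out" "x \<le> n" "\<forall>x. x \<notin> {VX, VW, VC, VA, VF, VT, VL, VB, VZ, VI} \<longrightarrow> R' x = R x"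
    "\<forall>f. f \<notin> {AIns, ALft, ARgt, AUp, AMn, ASA, ASB, AS} \<longrightarrow> A' f = A f"
    "hs_state {1..m} {x<..n} {} R' A'"
    "k' + 3 * n = k + 3 * R' VF + 2 * R' VC" "t' + n + x = t + 2 * R' VF + R' VC"
    using 2(1)[folded x_def] by - (elim conjE, assumption)+
  have x: "x \<in> {1..n}" "x \<noteq> 0" using 2(2) fr(2) by (auto simp: x_def)
  have A': "A' ADegB = (deg {1..m})(0 := 1)" "A' APidx = pidx" using fr(4) A by simp_all
  note hs = hs_invD[OF fr(5)]
  show ?case
  proof (cases "deg {1..m} x = 0 \<and> pidx x = 0")
    case True
    have new: "ready {1..m} {x - 1<..n} = insert x (ready {1..m} {x<..n})"
      using True x by (auto simp: ready_def K_def)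
    have "wp r inp insert_item (wp r inp (Dec VX) (\<lambda>R'a A'a out' k' t'. (out' = out \<and> R'a VX \<le> n \<and>
        (\<forall>x. x \<notin> {VX, VW, VC, VA, VF, VT, VL, VB, VZ, VI} \<longrightarrow> R'a x = R x) \<and>
        (\<forall>f. f \<notin> {AIns, ALft, ARgt, AUp, AMn, ASA, ASB, AS} \<longrightarrow> A'a f = A f) \<and>
        hs_state {1..m} {R'a VX<..n} {} R'a A'a \<and>
        k' + 3 * n = k + 3 * R'a VF + 2 * R'a VC \<and> t' + n + R'a VX = t + 2 * R'a VF + R'a VC) \<and>
        R'a VX < R' VX)) (R'(VL := 0, VT := 0, VW := x)) A' out' k' (Suc t')"
    proof (rule wp_insert_hs[where In = "ready {1..m} {x<..n}" and D = "{}" and w = x and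
          X = "{1..m}" and V = "{x - 1<..n}"], goal_cases)
      case 1
      then show ?case using hs(1) by simp
    next
      case 2
      then show ?case using hs(3) by simp
    next
      case (3 y)
      then show ?case using hs(4)[of y] by simp
    next
      case (4 e)
      then show ?case using hs(5)[of e] by simp
    next
      case 5 then show ?case by simp
    next
      case 6 then show ?case by (rule A')
    next
      case 7 then show ?case by simp
    next
      case 8
      then show ?case by (simp add: ready_def)
    next
      case 9 then show ?case by simp
    next
      case 10 then show ?case by (rule new)
    next
      case (11 e)
      then show ?case using True by (simp add: deg_eq_0)
    next
      case (12 R2 A2 d)
      have "R2 VX = x" using 12(1) by (simp add: x_def)
      moreover have "\<forall>x. x \<notin> {VX, VW, VC, VA, VF, VT, VL, VB, VZ, VI} \<longrightarrow> R2 x = R x"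
        using 12(1) fr(3) by simp
      moreover have "\<forall>f. f \<notin> {AIns, ALft, ARgt, AUp, AMn, ASA, ASB, AS} \<longrightarrow> A2 f = A f"
        using 12(2) fr(4) by simp
      ultimately show ?case using 12(3,4,6) fr(1,2,6,7) x by (simp add: x_def[symmetric])
    qed
    then show ?thesis using True A' x by (simp add: x_def[symmetric])
  next
    case False
    have same: "ready {1..m} {x - 1<..n} = ready {1..m} {x<..n}"
    proof -
      have iff: "v \<in> {x - 1<..n} \<longleftrightarrow> v = x \<or> v \<in> {x<..n}" for v
        using x by auto
      show ?thesis
      proof (rule set_eqI)
        fix v
        show "v \<in> ready {1..m} {x - 1<..n} \<longleftrightarrow> v \<in> ready {1..m} {x<..n}"
          unfolding ready_def K_def mem_Collect_eq Int_iff iff using False by metis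
      qed
    qed
    have "hs_state {1..m} {x - 1<..n} {} R' A'"
      using fr(5) unfolding hs_inv_def same .
    moreover have "deg {1..m} x + pidx x \<noteq> 0" using False by simp
    ultimately show ?thesis using fr(1-4,6,7) A' x by (simp add: x_def[symmetric])
  qed
next
  case (3 R' A' out' k' t')
  have n0: "{0<..n} = {1..n}" by auto
  have fr: "out' = out" "\<forall>x. x \<notin> {VX, VW, VC, VA, VF, VT, VL, VB, VZ, VI} \<longrightarrow> R' x = R x"
    "\<forall>f. f \<notin> {AIns, ALft, ARgt, AUp, AMn, ASA, ASB, AS} \<longrightarrow> A' f = A f"
    "hs_state {1..m} {1..n} {} R' A'"
    "k' + 3 * n = k + 3 * R' VF + 2 * R' VC" "t' + n + 0 = t + 2 * R' VF + R' VC"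
    using 3(1)[unfolded 3(2) n0] by - (elim conjE, assumption)+
  have "Q R' A' out k' t'"
    by (rule post) (use fr in blast, use fr in blast, rule fr, rule fr, use fr(6) in simp)
  then show ?case using fr(1) by simp
qed

lemma wp_arcs_loopB:
  assumes st: "static A" and u: "u \<in> D" "R VE = last_arc u m"
    and hs: "hs_state (pend D u (R VE)) {1..n} D R A"
    and closed: "\<And>e. e \<in> {1..m} \<Longrightarrow> tgt e \<in> D \<Longrightarrow> e \<notin> pend D u (R VE)"
    and post: "\<And>R' A' k' t'. \<lbrakk>\<And>x. x \<notin> {VE, VW, VC, VA, VF, VT, VL, VB, VZ, VI} \<Longrightarrow> R' x = R x;
      \<And>f. f \<notin> {ADegB, AIns, ALft, ARgt, AUp, AMn, ASA, ASB, AS} \<Longrightarrow> A' f = A f;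
      hs_state (pend D u 0) {1..n} D R' A'; \<And>x. x \<in> D \<Longrightarrow> A' AIns x = A AIns x;
      k' + 3 * R VF + 2 * R VC = k + 3 * R' VF + 2 * R' VC;
      t' + 2 * R VF + R VC + card (pend D u 0) = t + 2 * R' VF + R' VC + card (pend D u (R VE))\<rbrakk> \<Longrightarrow>
      Q R' A' out k' t'"
  shows "wp r inp arcs_loopB Q R A out k t"
  unfolding arcs_loopB_def
proof (rule wp_Loop[where \<mu> = "\<lambda>R A. R VE" and I = "\<lambda>R' A' out' k' t'. out' = out \<and>
      (\<forall>x. x \<notin> {VE, VW, VC, VA, VF, VT, VL, VB, VZ, VI} \<longrightarrow> R' x = R x) \<and>
      (\<forall>f. f \<notin> {ADegB, AIns, ALft, ARgt, AUp, AMn, ASA, ASB, AS} \<longrightarrow> A' f = A f) \<and>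
      hs_state (pend D u (R' VE)) {1..n} D R' A' \<and> (\<forall>x\<in>D. A' AIns x = A AIns x) \<and>
      (\<exists>e\<le>m. R' VE = last_arc u e) \<and> R' VE \<le> R VE \<and>
      k' + 3 * R VF + 2 * R VC = k + 3 * R' VF + 2 * R' VC \<and>
      t' + 2 * R VF + R VC + card (pend D u (R' VE)) =
        t + 2 * R' VF + R' VC + card (pend D u (R VE))"], goal_cases)
  case 1
  then show ?case using u hs by auto
next
  case (2 R' A' out' k' t')
  define E where "E = R' VE"
  define X where "X = pend D u E"
  have fr: "out' = out" "\<forall>x. x \<notin> {VE, VW, VC, VA, VF, VT, VL, VB, VZ, VI} \<longrightarrow> R' x = R x"
    "\<forall>f. f \<notin> {ADegB, AIns, ALft, ARgt, AUp, AMn, ASA, ASB, AS} \<longrightarrow> A' f = A f"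
    "hs_state X {1..n} D R' A'" "\<forall>x\<in>D. A' AIns x = A AIns x" "\<exists>e\<le>m. E = last_arc u e" "E \<le> R VE"
    "k' + 3 * R VF + 2 * R VC = k + 3 * R' VF + 2 * R' VC"
    "t' + 2 * R VF + R VC + card X = t + 2 * R' VF + R' VC + card (pend D u (R VE))"
    using 2(1)[folded E_def, folded X_def] by - (elim conjE, assumption)+
  obtain e where e: "e \<le> m" "E = last_arc u e" using fr(6) by blast
  have E0: "E \<noteq> 0" using 2(2) by (simp add: E_def)
  note step = pend_step[OF e(2) E0 e(1) u(1)]
  have Em: "E \<in> {1..m}" using step(1) by (auto simp: pend_def)
  have srcE: "src E = u" using last_arc_src[of u e] e E0 by simp
  have st': "static A'" using st fr(3) by (simp add: static_def)
  define w where "w = tgt E"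
  have g': "A' ATgt E = w" "A' ANxt E = last_arc u (E - 1)" "A' APidx = pidx"
    using st' Em srcE by (auto simp: static_def graph_ok_def w_def)
  have "X \<subseteq> {1..m}" by (auto simp: X_def pend_def)
  then have X: "finite X" "E \<in> X" "X \<subseteq> {1..m}" "pend D u (last_arc u (E - 1)) = X - {E}"
    using step unfolding X_def by (simp_all only: finite_pend)
  have card: "card X = Suc (card (X - {E}))" using X(1,2) by (rule card.remove)
  note hs' = hs_invD[OF fr(4)]
  have degb: "A' ADegB = (deg X)(0 := 1)" by (rule hs'(2))
  have dw: "deg (X - {E}) = (deg X)(w := deg X w - 1)"
    using deg_remove[OF X(2,1)] by (simp add: w_def)
  have w: "w \<in> {1..n}" "w \<noteq> 0" using arc_range[OF Em] by (auto simp: w_def)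
  \<comment> \<open>A deleted item has no pending incoming arc, whereas the arc \<open>E\<close>
    into \<open>w\<close> has been pending since the start of the loop.\<close>
  have wD: "w \<notin> D"
  proof
    assume "w \<in> D"
    then have "E \<notin> pend D u (R VE)" using closed[OF Em] by (simp add: w_def)
    moreover have "src E = u" "E \<le> R VE" "E \<in> {1..m}" using srcE fr(7) Em by auto
    ultimately show False
      by (simp add: pend_def)
  qed
  have dXw: "deg X w \<noteq> 0" using X(1,2) by (auto simp: deg_eq_0 w_def)
  have degb': "(A' ADegB)(w := deg X w - 1) = (deg (X - {E}))(0 := 1)"
    unfolding degb dw using w(2) by (intro fun_upd_twist) simp
  have less: "last_arc u (E - 1) < E" using last_arc_le[of u "E - 1"] E0 by simp
  have ex: "\<exists>e\<le>m. last_arc u (E - Suc 0) = last_arc u e"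
    using Em by (intro exI[of _ "E - 1"]) auto
  have reg: "R' VE = E" by (simp add: E_def)
  let ?A = "A'(ADegB := (A' ADegB)(w := deg X w - 1))"
  show ?case
  proof (cases "deg X w - 1 = 0 \<and> pidx w = 0")
    case True
    let ?B = "A'(ADegB := (deg X)(0 := 1, w := 0))"
    have degB: "(deg X)(0 := 1, w := 0) = (deg (X - {E}))(0 := 1)"
      using degb' True unfolding degb by simp
    have new: "ready (X - {E}) {1..n} = insert w (ready X {1..n})"
      using True w dXw by (auto simp: ready_def K_def dw)
    have "wp r inp insert_item (wp r inp (Rd VE ANxt VE) (\<lambda>R2 A2 out' k' t'. (out' = out \<and>
      (\<forall>x. x \<notin> {VE, VW, VC, VA, VF, VT, VL, VB, VZ, VI} \<longrightarrow> R2 x = R x) \<and>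
      (\<forall>f. f \<notin> {ADegB, AIns, ALft, ARgt, AUp, AMn, ASA, ASB, AS} \<longrightarrow> A2 f = A f) \<and>
      hs_state (pend D u (R2 VE)) {1..n} D R2 A2 \<and> (\<forall>x\<in>D. A2 AIns x = A AIns x) \<and>
      (\<exists>e\<le>m. R2 VE = last_arc u e) \<and> R2 VE \<le> R VE \<and>
      k' + 3 * R VF + 2 * R VC = k + 3 * R2 VF + 2 * R2 VC \<and>
      t' + 2 * R VF + R VC + card (pend D u (R2 VE)) =
        t + 2 * R2 VF + R2 VC + card (pend D u (R VE))) \<and> R2 VE < R' VE))
      (R'(VW := w, VL := 0, VT := 0)) ?B out' k' (Suc t')"
    proof (rule wp_insert_hs[where In = "ready X {1..n}" and D = D and w = w and
          X = "X - {E}" and V = "{1..n}"], goal_cases)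
      case 1
      then show ?case using hs'(1) by simp
    next
      case 2
      then show ?case using hs'(3) by simp
    next
      case (3 y)
      then show ?case using hs'(4)[of y] by simp
    next
      case (4 e)
      then show ?case using hs'(5)[of e] by simp
    next
      case (5 v)
      then show ?case using hs'(6)[of v] by simp
    next
      case 6
      then show ?case using degB by simp
    next
      case 7 then show ?case by simp
    next
      case 8
      then show ?case using dXw by (simp add: ready_def)
    next
      case 9 then show ?case by (rule wD)
    next
      case 10 then show ?case by (rule new)
    next
      case (11 e)
      then have "e \<notin> X - {E}" using True dw X(1) deg_eq_0[of "X - {E}" w] by auto
      then show ?case using 11 srcE u by (auto simp: X_def pend_def)
    next
      case (12 R2 A2 d)
      have "R2 VE = E" using 12(1) by (simp add: reg)
      moreover have "\<forall>x. x \<notin> {VE, VW, VC, VA, VF, VT, VL, VB, VZ, VI} \<longrightarrow> R2 x = R x"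
        using 12(1) fr(2) by simp
      moreover have "\<forall>f. f \<notin> {ADegB, AIns, ALft, ARgt, AUp, AMn, ASA, ASB, AS} \<longrightarrow> A2 f = A f"
        using 12(2) fr(3) by simp
      moreover have "A2 ANxt = A' ANxt" using 12(2) by simp
      moreover have "\<forall>x\<in>D. A2 AIns x = A AIns x"
      proof
        fix x
        assume "x \<in> D"
        moreover from this have "x \<noteq> w"
          using wD by blast
        ultimately show "A2 AIns x = A AIns x" using 12(5)[of x] fr(5) by simp
      qed
      ultimately show ?case using 12(3,4,6) fr(1,7,8,9) card X(4) g' less ex by (simp add: reg)
    qed
    then show ?thesis using True g' degb w by (simp add: reg)
  next
    case False
    have same: "ready (X - {E}) {1..n} = ready X {1..n}"
      using False dXw by (auto simp: ready_def K_def dw)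
    have "hs_state (X - {E}) {1..n} D R' ?A"
      unfolding hs_inv_def same using hs' degb' by simp
    moreover have "deg X w - 1 + pidx w \<noteq> 0" using False by simp
    ultimately show ?thesis using fr(1-3,5,7,8,9) g' degb w card X(4) less ex by (simp add: reg)
  qed
next
  case (3 R' A' out' k' t')
  have fr: "out' = out" "\<forall>x. x \<notin> {VE, VW, VC, VA, VF, VT, VL, VB, VZ, VI} \<longrightarrow> R' x = R x"
    "\<forall>f. f \<notin> {ADegB, AIns, ALft, ARgt, AUp, AMn, ASA, ASB, AS} \<longrightarrow> A' f = A f"
    "hs_state (pend D u 0) {1..n} D R' A'" "\<forall>x\<in>D. A' AIns x = A AIns x"
    "k' + 3 * R VF + 2 * R VC = k + 3 * R' VF + 2 * R' VC"
    "t' + 2 * R VF + R VC + card (pend D u 0) = t + 2 * R' VF + R' VC + card (pend D u (R VE))"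
    using 3(1)[unfolded 3(2)] by - (elim conjE, assumption)+
  have "Q R' A' out k' t'"
    by (rule post) (use fr in blast, use fr in blast, rule fr, use fr in blast, rule fr, rule fr)
  then show ?case using fr(1) by simp
qed

end

section \<open>Rounds of the topological heapsort\<close>

context path_input
begin

text \<open>\<open>\<Lambda>\<close> is the sum of the heights climbed by deletions, tied to the
  lifetimes by an exponential inequality. \<open>x\<close> is the number of remaining rounds, and
  \<open>k0\<close> and \<open>t0\<close> are the counters on entry. Deletion times do not decrease
  along arcs into path items, as the counting of lifetimes requires.\<close>

definition main_inv where
  "main_inv X x D \<Lambda> k0 t0 R A k t \<longleftrightarrow>
     R VN = n \<and> R VO = off \<and> static A \<and> hs_state X {1..n} D R A \<and>
     D \<subseteq> {1..n} \<and> card D + x = n \<and> off \<le> R VJ \<and> R VJ \<le> n \<and>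
     D - K = P ` {off<..R VJ} \<and> D \<inter> K = A AQ ` {1..R VK} \<and> R VK = card (D \<inter> K) \<and>
     (\<forall>i j. 1 \<le> i \<longrightarrow> i < j \<longrightarrow> j \<le> R VK \<longrightarrow> lt r (A AQ i) (A AQ j)) \<and>
     (\<forall>a\<in>D \<inter> K. \<forall>b\<in>{1..n} - D. lt r a b) \<and>
     (\<forall>e\<in>{1..m}. tgt e \<in> D \<longrightarrow> src e \<in> D) \<and>
     (\<forall>e\<in>{1..m}. tgt e \<in> D - K \<longrightarrow> A ADel (src e) \<le> A ADel (tgt e)) \<and>
     2 ^ \<Lambda> \<le> (\<Prod>x\<in>D \<inter> K. Suc (A ADel x) - A AIns x) \<and>
     k + 3 * n = k0 + 3 * R VF + 2 * R VC + 3 * \<Lambda> + 2 * card (D \<inter> K) \<and>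
     t + x + card X = t0 + 2 * R VF + R VC + 2 * \<Lambda> + card (D \<inter> K) + (m :: nat)"

lemma main_invD:
  assumes "main_inv X x D \<Lambda> k0 t0 R A k t"
  shows "R VN = n" "R VO = off" "static A" "hs_state X {1..n} D R A"
     "D \<subseteq> {1..n}" "card D + x = n" "off \<le> R VJ" "R VJ \<le> n"
     "D - K = P ` {off<..R VJ}" "D \<inter> K = A AQ ` {1..R VK}" "R VK = card (D \<inter> K)"
     "\<forall>i j. 1 \<le> i \<longrightarrow> i < j \<longrightarrow> j \<le> R VK \<longrightarrow> lt r (A AQ i) (A AQ j)"
     "\<forall>a\<in>D \<inter> K. \<forall>b\<in>{1..n} - D. lt r a b"
     "\<forall>e\<in>{1..m}. tgt e \<in> D \<longrightarrow> src e \<in> D"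
     "\<forall>e\<in>{1..m}. tgt e \<in> D - K \<longrightarrow> A ADel (src e) \<le> A ADel (tgt e)"
     "2 ^ \<Lambda> \<le> (\<Prod>x\<in>D \<inter> K. Suc (A ADel x) - A AIns x)"
     "k + 3 * n = k0 + 3 * R VF + 2 * R VC + 3 * \<Lambda> + 2 * card (D \<inter> K)"
     "t + x + card X = t0 + 2 * R VF + R VC + 2 * \<Lambda> + card (D \<inter> K) + m"
  using assms unfolding main_inv_def by - (elim conjE, assumption)+

lemma main_invI:
  assumes "R VN = n" "R VO = off" "static A" "hs_state X {1..n} D R A"
     "D \<subseteq> {1..n}" "card D + x = n" "off \<le> R VJ" "R VJ \<le> n"
     "D - K = P ` {off<..R VJ}" "D \<inter> K = A AQ ` {1..R VK}" "R VK = card (D \<inter> K)"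
     "\<And>i j. 1 \<le> i \<Longrightarrow> i < j \<Longrightarrow> j \<le> R VK \<Longrightarrow> lt r (A AQ i) (A AQ j)"
     "\<And>a b. a \<in> D \<inter> K \<Longrightarrow> b \<in> {1..n} - D \<Longrightarrow> lt r a b"
     "\<And>e. e \<in> {1..m} \<Longrightarrow> tgt e \<in> D \<Longrightarrow> src e \<in> D"
     "\<And>e. e \<in> {1..m} \<Longrightarrow> tgt e \<in> D - K \<Longrightarrow> A ADel (src e) \<le> A ADel (tgt e)"
     "2 ^ \<Lambda> \<le> (\<Prod>x\<in>D \<inter> K. Suc (A ADel x) - A AIns x)"
     "k + 3 * n = k0 + 3 * R VF + 2 * R VC + 3 * \<Lambda> + 2 * card (D \<inter> K)"
     "t + x + card X = t0 + 2 * R VF + R VC + 2 * \<Lambda> + card (D \<inter> K) + m"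
   shows "main_inv X x D \<Lambda> k0 t0 R A k t"
  unfolding main_inv_def by (intro conjI ballI allI impI; (rule assms; assumption)?)

lemma main_inv_cong:
  assumes "R' VN = R VN" "R' VO = R VO" "R' VF = R VF" "R' VC = R VC" "R' VJ = R VJ" "R' VK = R VK"
  shows "main_inv X x D \<Lambda> k0 t0 R' A k t = main_inv X x D \<Lambda> k0 t0 R A k t"
  unfolding main_inv_def assms ..

lemma ready_closed: "e \<in> {1..m} \<Longrightarrow> tgt e = v \<Longrightarrow> deg (pend D u 0) v = 0 \<Longrightarrow> src e \<in> D"
  by (auto simp: deg_eq_0 pend_def)

text \<open>The invariant is assumed with \<open>u\<close> already counted as deleted but with its
  arcs still pending; by \<open>pend_start\<close> this is the same set of arcs as before the
  deletion.\<close>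

lemma wp_release:
  assumes inv: "main_inv (pend D 0 0) x (insert u D) \<Lambda> k0 t0 R (A(ADel := (A ADel)(u := R VC))) k t"
    and u: "R VU = u" "u \<notin> D" "R VX = Suc x"
    and closed: "\<And>e. e \<in> {1..m} \<Longrightarrow> tgt e \<in> insert u D \<Longrightarrow> src e \<in> D"
  shows "wp r inp release (\<lambda>R' A' out' k' t'. out' = out \<and>
    main_inv (pend (insert u D) 0 0) (R' VX) (insert u D) \<Lambda> k0 t0 R' A' k' t' \<and> R' VX = x) R A out k
      t"
proof -
  let ?A = "A(ADel := (A ADel)(u := R VC))" and ?D = "insert u D"
  note i = main_invD[OF inv]
  have p: "pend ?D u (last_arc u m) = pend D 0 0" by (rule pend_start[OF u(2)])
  have hd: "A AHead u = last_arc u m" using i(3) by (simp add: static_def graph_ok_def)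
  have "wp r inp arcs_loopB (wp r inp (Dec VX) (\<lambda>R' A' out' k' t'. out' = out \<and>
    main_inv (pend (insert u D) 0 0) (R' VX) (insert u D) \<Lambda> k0 t0 R' A' k' t' \<and> R' VX = x))
    (R(VE := last_arc u m)) ?A out k t"
  proof (rule wp_arcs_loopB[where D = ?D and u = u], goal_cases)
    case 1 show ?case by (rule i(3))
  next
    case 2 show ?case by simp
  next
    case 3 show ?case by simp
  next
    case 4
    show ?case using i(4) by (simp add: p)
  next
    case (5 e)
    then show ?case using closed[of e] by (simp add: p) (simp add: pend_def)
  next
    case (6 R' A' k' t')
    have R': "R' VN = R VN" "R' VO = R VO" "R' VJ = R VJ" "R' VK = R VK" "R' VX = R VX"
      using 6(1) by simp_all
    have A': "A' AQ = ?A AQ" "A' ADel = ?A ADel"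
      using 6(2) by (simp_all del: fun_upd_apply add: fun_upd_other)
    have st: "static A'" using i(3) 6(2) by (simp add: static_def)
    have ins: "(\<Prod>x\<in>?D \<inter> K. Suc (A' ADel x) - A' AIns x) = (\<Prod>x\<in>?D \<inter> K. Suc (?A ADel x) - ?A AIns x)"
      unfolding A' by (rule prod.cong) (use 6(4) in auto)
    have p0: "pend ?D u 0 = pend ?D 0 0" by (rule pend_0)
    have "main_inv (pend ?D 0 0) x ?D \<Lambda> k0 t0 R' A' k' t'"
    proof (rule main_invI, goal_cases)
      case 1 show ?case unfolding R' A' by (rule i(1))
    next
      case 2 show ?case unfolding R' A' by (rule i(2))
    next
      case 3 show ?case by (rule st)
    next
      case 5 show ?case unfolding R' A' by (rule i(5))
    next
      case 6 show ?case unfolding R' A' by (rule i(6))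
    next
      case 7 show ?case unfolding R' A' by (rule i(7))
    next
      case 8 show ?case unfolding R' A' by (rule i(8))
    next
      case 9 show ?case unfolding R' A' by (rule i(9))
    next
      case 10 show ?case unfolding R' A' by (rule i(10))
    next
      case 11 show ?case unfolding R' A' by (rule i(11))
    next
      case (12 i' j')
      then show ?case using i(12) unfolding R' A' by blast
    next
      case (13 a b)
      then show ?case using i(13) by blast
    next
      case (14 e)
      then show ?case using i(14) by blast
    next
      case (15 e)
      then show ?case using i(15) unfolding A' by blast
    next
      case 4
      then show ?case
        using 6(3) unfolding p0 .
    next
      case 16
      then show ?case unfolding ins by (rule i(16))
    next
      case 17
      then show ?case using 6(5) i(17) by simp
    next
      case 18
      then show ?case using 6(6) i(18) by (simp add: p p0)
    qed
    then have "main_inv (pend ?D 0 0) x ?D \<Lambda> k0 t0 (R'(VX := x)) A' k' t'"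
      by (subst main_inv_cong[where R = R']) simp_all
    then show ?case using R'(5) u(3) by simp
  qed
  then show ?thesis unfolding release_def using u(1) hd by simp
qed

text \<open>A path item costs no comparison and leaves the product of lifetimes alone, since it is
  outside \<open>K\<close>.\<close>

lemma main_path_step:
  assumes inv: "main_inv (pend D 0 0) (Suc x) D \<Lambda> k0 t0 R A k t"
    and p: "p = P (Suc (R VJ))" "p \<noteq> 0" "deg (pend D 0 0) p = 0"
    and R1: "R1 VJ = Suc (R VJ)" "\<And>y. y \<in> {VN, VO, VF, VC, VK} \<Longrightarrow> R1 y = R y"
  shows "p \<notin> D" "\<And>e. e \<in> {1..m} \<Longrightarrow> tgt e \<in> insert p D \<Longrightarrow> src e \<in> D"
    "main_inv (pend D 0 0) x (insert p D) \<Lambda> k0 t0 R1 (A(ADel := (A ADel)(p := R1 VC))) k (Suc t)"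
proof -
  let ?A = "A(ADel := (A ADel)(p := R1 VC))"
  note i = main_invD[OF inv]
  have R1': "R1 VN = R VN" "R1 VO = R VO" "R1 VF = R VF" "R1 VC = R VC" "R1 VK = R VK"
    using R1(2) by simp_all
  have j: "Suc (R VJ) \<in> {off<..n}" using P_0[of "Suc (R VJ)"] p(1,2) by argo
  have pn: "p \<in> {1..n}" "p \<notin> K" using P_in[OF j] pidx_P[OF j] p(1) by (auto simp: K_def)
  have "p \<notin> P ` {off<..R VJ}"
  proof
    assume "p \<in> P ` {off<..R VJ}"
    then obtain j' where j': "j' \<in> {off<..R VJ}" "p = P j'" by blast
    then have "pidx p = j'" using pidx_P[of j'] i(8) by simp
    then show False
      using pidx_P[OF j] j' p(1) by simp
  qed
  then show pD: "p \<notin> D" using i(9) pn by blast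
  show closed: "src e \<in> D" if "e \<in> {1..m}" "tgt e \<in> insert p D" for e
    using that i(14) ready_closed[OF that(1) _ p(3)] by blast
  have IK: "insert p D \<inter> K = D \<inter> K" "insert p D - K = insert p (D - K)" using pn by auto
  have del: "?A ADel y = A ADel y" if "y \<in> D" for y
    using that pD by auto
  note hs = hs_invD[OF i(4)]
  have pr: "p \<notin> ready (pend D 0 0) {1..n}" using pn by (simp add: ready_def)
  have fin: "finite D" by (rule finite_subset[OF i(5)]) simp
  show "main_inv (pend D 0 0) x (insert p D) \<Lambda> k0 t0 R1 ?A k (Suc t)"
  proof (rule main_invI, goal_cases)
    case 1 show ?case using i(1) R1' by simp
  next
    case 2 show ?case using i(2) R1' by simp
  next
    case 3 show ?case using i(3) by (simp add: static_def)
  next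
    case 4
    have "ready (pend D 0 0) {1..n} - insert p D = ready (pend D 0 0) {1..n} - D"
      using pr by blast
    moreover have "\<forall>e\<in>{1..m}. tgt e \<in> ready (pend D 0 0) {1..n} \<longrightarrow>
        src e \<in> insert p D \<and> ?A ADel (src e) < A AIns (tgt e)"
      using hs(5) del by (metis insertCI)
    moreover have "\<forall>u\<in>insert p D. ?A ADel u \<le> R VC" using hs(6) del R1' by auto
    ultimately show ?case unfolding hs_inv_def using hs(1-4) R1' by simp
  next
    case 5 show ?case using i(5) pn by blast
  next
    case 6 show ?case using i(6) pD fin by simp
  next
    case 7 show ?case using i(7) R1 by simp
  next
    case 8 show ?case using j R1 by simp
  next
    case 9
    have eq: "{off<..Suc (R VJ)} = insert (Suc (R VJ)) {off<..R VJ}" using i(7) by auto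
    show ?case by (simp only: IK R1(1) eq image_insert i(9) p(1)[symmetric])
  next
    case 10 show ?case using i(10) by (simp add: IK R1')
  next
    case 11 show ?case using i(11) by (simp add: IK R1')
  next
    case (12 i' j') then show ?case using i(12) by (simp add: R1')
  next
    case (13 a b) then show ?case using i(13) IK by blast
  next
    case (14 e) then show ?case using closed by blast
  next
    case (15 e)
    then have s: "src e \<in> D" using closed by blast
    show ?case
    proof (cases "tgt e = p")
      case True
      \<comment> \<open>Earlier deletion times are at most the current counter, which is the
        deletion time of \<open>p\<close>.\<close>
      then show ?thesis using hs(6)[OF s] s pD R1' by auto
    next
      case False
      then have "tgt e \<in> D - K" using 15 by blast
      then show ?thesis using i(15) 15 del[OF s] del[of "tgt e"] by simp
    qed
  next
    case 16
    have "(\<Prod>x\<in>D \<inter> K. Suc (?A ADel x) - ?A AIns x) = (\<Prod>x\<in>D \<inter> K. Suc (A ADel x) - A AIns x)"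
      using del by (intro prod.cong) auto
    then show ?case using i(16) unfolding IK by simp
  next
    case 17 show ?case using i(17) by (simp add: IK R1')
  next
    case 18 show ?case using i(18) by (simp add: IK R1')
  qed
qed

text \<open>The least remaining item is available. If it were on the path, the next path item would
  remain and not be larger, hence be the same item and available, against the hypothesis. So it is
  in the queue, where it must be the minimum.\<close>

lemma main_heap_step:
  assumes inv: "main_inv (pend D 0 0) (Suc x) D \<Lambda> k0 t0 R A k t"
    and p: "P (Suc (R VJ)) = 0 \<or> deg (pend D 0 0) (P (Suc (R VJ))) \<noteq> 0"
  shows "A AS 0 \<in> ready (pend D 0 0) {1..n} - D" "\<And>y. y \<in> {1..n} - D \<Longrightarrow> y \<noteq> A AS 0 \<Longrightarrow> lt r (A AS 0) y"
proof -
  note i = main_invD[OF inv]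
  have "card D < card {1..n}" using i(6) by simp
  then have "{1..n} - D \<noteq> {}"
    using card_mono[OF finite_subset[OF i(5)]] i(5) by (metis Diff_eq_empty_iff finite_atLeastAtMost
      not_le)
  then obtain w where w: "w \<in> {1..n} - D" "\<And>y. y \<in> {1..n} - D \<Longrightarrow> y \<noteq> w \<Longrightarrow> lt r w y"
    "deg (pend D 0 0) w = 0"
    by (rule avail[where u = 0]) blast
  have wK: "w \<in> K"
  proof (rule ccontr)
    assume "w \<notin> K"
    then have "w \<in> P ` {off<..n}" using w path_image by blast
    then obtain j where j: "j \<in> {off<..n}" "w = P j" by blast
    have "j \<notin> {off<..R VJ}" using w(1) j i(9) \<open>w \<notin> K\<close> by blast
    then have jJ: "R VJ < j" using j by auto
    show False
    proof (cases "j = Suc (R VJ)")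
      case True
      then show False
        using p w j by auto
    next
      case False
      then have j': "Suc (R VJ) \<in> {off<..n}" "Suc (R VJ) < j" using jJ j i(7) by auto
      have "P (Suc (R VJ)) \<notin> P ` {off<..R VJ}"
      proof
        assume "P (Suc (R VJ)) \<in> P ` {off<..R VJ}"
        then obtain j'' where j'': "j'' \<in> {off<..R VJ}" "P (Suc (R VJ)) = P j''" by blast
        then have "pidx (P (Suc (R VJ))) = j''" using pidx_P[of j''] i(8) by simp
        then show False
          using pidx_P[OF j'(1)] j'' by simp
      qed
      moreover have "P (Suc (R VJ)) \<in> {1..n} - K" using path_image j' by blast
      ultimately have "P (Suc (R VJ)) \<in> {1..n} - D" using i(9) by blast
      moreover have lt: "lt r (P (Suc (R VJ))) w"
        using P_less[of "Suc (R VJ)" j] j j' by simp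
      ultimately show False
        using w(2)[of "P (Suc (R VJ))"] asym irrefl by metis
    qed
  qed
  then have wr: "w \<in> ready (pend D 0 0) {1..n} - D" using w by (auto simp: ready_def)
  note min = heap_min[OF hs_invD(1)[OF i(4)] lin]
  have "A AS 0 = w"
  proof (rule ccontr)
    assume "A AS 0 \<noteq> w"
    then have l: "lt r (A AS 0) w" using min(2)[OF wr] by blast
    then have "A AS 0 \<in> ready (pend D 0 0) {1..n} - D" using min(1) by (auto simp: lt_def)
    then have "A AS 0 \<in> {1..n} - D" by (auto simp: ready_def)
    then show False
      using w(2) \<open>A AS 0 \<noteq> w\<close> l asym by blast
  qed
  then show "A AS 0 \<in> ready (pend D 0 0) {1..n} - D" "\<And>y. y \<in> {1..n} - D \<Longrightarrow> y \<noteq> A AS 0 \<Longrightarrow> lt r (A AS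
    0) y"
    using wr w by auto
qed

text \<open>The lifetime of \<open>u\<close> ends at the current counter and has length at least
  \<open>2 ^ i\<close>, so it pays for a climb of height \<open>i\<close>. As \<open>u\<close> is
  less than everything that remains, the recorded sequence stays sorted.\<close>

lemma main_heap_delete:
  assumes inv: "main_inv (pend D 0 0) (Suc x) D \<Lambda> k0 t0 R A k t"
    and u: "u \<in> ready (pend D 0 0) {1..n} - D" "\<And>y. y \<in> {1..n} - D \<Longrightarrow> y \<noteq> u \<Longrightarrow> lt r u y"
    and h: "heap_state r n (ready (pend D 0 0) {1..n}) (ready (pend D 0 0) {1..n} - D - {u}) R1 A1"
    and i': "2 ^ i + A AIns u \<le> Suc (R VC)"
    and R1: "R1 VK = Suc (R VK)" "\<And>y. y \<in> {VN, VO, VF, VC, VJ} \<Longrightarrow> R1 y = R y"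
    and A1: "A1 AQ = (A AQ)(Suc (R VK) := u)" "\<And>f. f \<notin> {AMn, AS, AQ} \<Longrightarrow> A1 f = A f"
  shows "u \<notin> D" "\<And>e. e \<in> {1..m} \<Longrightarrow> tgt e \<in> insert u D \<Longrightarrow> src e \<in> D"
    "main_inv (pend D 0 0) x (insert u D) (\<Lambda> + i) k0 t0 R1 (A1(ADel := (A1 ADel)(u := R1 VC)))
       (k + 3 * i + 2) (Suc t + 2 * i + 1)"
proof -
  let ?A = "A1(ADel := (A1 ADel)(u := R1 VC))"
  note inv' = main_invD[OF inv]
  have R1': "R1 VN = R VN" "R1 VO = R VO" "R1 VF = R VF" "R1 VC = R VC" "R1 VJ = R VJ"
    using R1(2) by simp_all
  have A1': "A1 AIns = A AIns" "A1 ADel = A ADel" "A1 ADegB = A ADegB"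
    using A1(2) by simp_all
  have un: "u \<in> {1..n}" "u \<in> K" "deg (pend D 0 0) u = 0" using u by (auto simp: ready_def)
  show uD: "u \<notin> D" using u by blast
  show closed: "src e \<in> D" if "e \<in> {1..m}" "tgt e \<in> insert u D" for e
    using that inv'(14) ready_closed[OF that(1) _ un(3)] by blast
  have IK: "insert u D \<inter> K = insert u (D \<inter> K)" "insert u D - K = D - K" using un by auto
  have del: "?A ADel y = A ADel y" if "y \<in> D" for y
    using that uD A1' by auto
  note hs = hs_invD[OF inv'(4)]
  have fin: "finite D" by (rule finite_subset[OF inv'(5)]) simp
  have insu: "1 \<le> A AIns u" "A AIns u \<le> R VC" using hs(4) u by blast+
  show "main_inv (pend D 0 0) x (insert u D) (\<Lambda> + i) k0 t0 R1 ?A (k + 3 * i + 2) (Suc t + 2 * i +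
    1)"
  proof (rule main_invI, goal_cases)
    case 1 show ?case using inv'(1) R1' by simp
  next
    case 2 show ?case using inv'(2) R1' by simp
  next
    case 3 show ?case using inv'(3) A1(2) by (simp add: static_def)
  next
    case 4
    have "ready (pend D 0 0) {1..n} - insert u D = ready (pend D 0 0) {1..n} - D - {u}"
      by blast
    moreover have "\<forall>e\<in>{1..m}. tgt e \<in> ready (pend D 0 0) {1..n} \<longrightarrow>
        src e \<in> insert u D \<and> ?A ADel (src e) < A AIns (tgt e)"
      using hs(5) del by (metis insertCI)
    moreover have "\<forall>v\<in>insert u D. ?A ADel v \<le> R VC" using hs(6) del R1' by auto
    ultimately show ?case unfolding hs_inv_def using h hs(2-4) R1' A1' by simp
  next
    case 5 show ?case using inv'(5) un by blast
  next
    case 6 show ?case using inv'(6) uD fin by simp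
  next
    case 7 show ?case using inv'(7) R1' by simp
  next
    case 8 show ?case using inv'(8) R1' by simp
  next
    case 9 show ?case using inv'(9) by (simp add: IK R1')
  next
    case 10
    have eq: "{1..Suc (R VK)} = insert (Suc (R VK)) {1..R VK}" by auto
    have im: "(A AQ)(Suc (R VK) := u) ` {1..R VK} = A AQ ` {1..R VK}"
      by (rule image_cong) auto
    have Q: "?A AQ = (A AQ)(Suc (R VK) := u)" using A1(1) by simp
    show ?case by (simp only: Q R1(1) eq image_insert im IK inv'(10)) simp
  next
    case 11 show ?case using inv'(11) R1(1) uD fin by (simp add: IK)
  next
    case (12 i' j')
    show ?case
    proof (cases "j' = Suc (R VK)")
      case True
      then have "i' \<in> {1..R VK}" using 12 by auto
      then have "A AQ i' \<in> D \<inter> K" unfolding inv'(10) by (rule imageI)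
      then have "lt r (A AQ i') u" using inv'(13) un uD by blast
      then show ?thesis using True 12 A1(1) by simp
    next
      case False
      then show ?thesis using 12 inv'(12) A1(1) R1(1) by simp
    qed
  next
    case (13 a b)
    then show ?case using inv'(13) u(2)[of b] IK by blast
  next
    case (14 e) then show ?case using closed by blast
  next
    case (15 e)
    then have s: "src e \<in> D" using closed by blast
    have "tgt e \<in> D - K" using 15 IK by blast
    then show ?case using inv'(15) 15 del[OF s] del[of "tgt e"] by simp
  next
    case 16
    have "(\<Prod>x\<in>D \<inter> K. Suc (?A ADel x) - ?A AIns x) = (\<Prod>x\<in>D \<inter> K. Suc (A ADel x) - A AIns x)"
      using del A1' by (intro prod.cong) auto
    moreover have "2 ^ i \<le> Suc (?A ADel u) - ?A AIns u" using i' insu A1' R1' by simp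
    ultimately have "2 ^ i * 2 ^ \<Lambda> \<le> (Suc (?A ADel u) - ?A AIns u) * (\<Prod>x\<in>D \<inter> K. Suc (?A ADel x) - ?A
      AIns x)"
      using inv'(16) by (intro mult_le_mono) simp_all
    moreover have "(\<Prod>x\<in>insert u (D \<inter> K). Suc (?A ADel x) - ?A AIns x) =
        (Suc (?A ADel u) - ?A AIns u) * (\<Prod>x\<in>D \<inter> K. Suc (?A ADel x) - ?A AIns x)"
      using fin uD by (intro prod.insert) auto
    ultimately show ?case unfolding IK by (simp only: power_add mult.commute[of "2 ^ i"])
  next
    case 17 show ?case using inv'(17) fin uD by (simp add: IK R1')
  next
    case 18 show ?case using inv'(18) fin uD by (simp add: IK R1')
  qed
qed

lemma wp_heapsort:
  assumes R: "R VN = n" "R VO = off" "R VJ = off"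
    and A: "graph_ok (A AHead) (A ANxt) (A ATgt) (A ASrc)" "A AP = P" "A APidx = pidx" "A ALp = lp"
      "A ADegB = deg {1..m}" "\<And>f. f \<in> {AMn, ALft, ARgt, AUp, ASA, ASB, AS} \<Longrightarrow> A f = (\<lambda>_. 0)"
    and post: "\<And>R' A' \<Lambda> k' t'. \<lbrakk>R' VN = n; R' VO = off; R' VK = off; static A'; A' AQ ` {1..off} =
      K;
      \<And>i j. 1 \<le> i \<Longrightarrow> i < j \<Longrightarrow> j \<le> off \<Longrightarrow> lt r (A' AQ i) (A' AQ j); 2 ^ \<Lambda> \<le> T * 2 ^ (2 * off);
      k' \<le> k + 7 * off + 3 * \<Lambda>; t' \<le> t + 2 * n + 4 * off + 2 * \<Lambda> + m\<rbrakk> \<Longrightarrow> Q R' A' out k' t'"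
  shows "wp r inp heapsort Q R A out k t"
  unfolding heapsort_def
proof (simp add: R, rule wp_seed_loop, goal_cases)
  case 4
  have "deg {1..m} 0 = 0" by (rule deg_0) simp
  then show ?case using A by simp
next
  case (13 R1 A1 k1 t1)
  note R1 = 13(1) and A1 = 13(2)
  have st1: "static A1" using A A1 by (simp add: static_def)
  have main1: "main_inv {1..m} n {} 0 k t (R1(VK := 0, VX := n)) A1 k1 t1"
  proof (rule main_invI, goal_cases)
    case 4
    show ?case using 13(3) by (simp del: One_nat_def)
  qed (use R R1 st1 13(4,5) off in auto)
  show ?case
  proof (simp add: R1 R, rule wp_Loop[where \<mu> = "\<lambda>R A. R VX" and I = "\<lambda>R' A' out' k' t'. out' = out
    \<and>
        (\<exists>D \<Lambda>. main_inv (pend D 0 0) (R' VX) D \<Lambda> k t R' A' k' t')"], goal_cases)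
    case 1
    have "main_inv (pend {} 0 0) ((R1(VK := 0, VX := n)) VX) {} 0 k t (R1(VK := 0, VX := n)) A1 k1
      t1"
      using main1 by (simp add: pend_empty del: One_nat_def)
    then show ?case by blast
  next
    case (2 R' A' out' k' t')
    obtain x where x: "R' VX = Suc x" using 2(2) not0_implies_Suc by blast
    obtain D \<Lambda> where inv: "main_inv (pend D 0 0) (Suc x) D \<Lambda> k t R' A' k' t'"
      using 2(1) x by auto
    note i = main_invD[OF inv]
    have P': "A' AP = P" using i(3) by (simp add: static_def)
    have degb: "A' ADegB = (deg (pend D 0 0))(0 := 1)" by (rule hs_invD(2)[OF i(4)])
    let ?p = "P (Suc (R' VJ))"
    have goal: "wp r inp release (\<lambda>R'a A' out' k' t'. out' = out \<and>
        (\<exists>D \<Lambda>. main_inv (pend D 0 0) (R'a VX) D \<Lambda> k t R'a A' k' t') \<and> R'a VX < R' VX) R2 A2 out k2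
          t2"
      if "main_inv (pend D 0 0) x (insert u D) \<Lambda>' k t R2 (A2(ADel := (A2 ADel)(u := R2 VC))) k2 t2"
        "R2 VU = u" "u \<notin> D" "R2 VX = Suc x" "\<And>e. e \<in> {1..m} \<Longrightarrow> tgt e \<in> insert u D \<Longrightarrow> src e \<in> D"
      for R2 A2 k2 t2 u \<Lambda>'
      by (rule wp_mono[OF wp_release[OF that]]) (use x in auto)
    show ?case
    proof (cases "?p \<noteq> 0 \<and> deg (pend D 0 0) ?p = 0")
      case True
      let ?R = "R'(VU := ?p, VT := 0, VJ := Suc (R' VJ))"
      have "wp r inp release (\<lambda>R'a A' out' k' t'. out' = out \<and>
        (\<exists>D \<Lambda>. main_inv (pend D 0 0) (R'a VX) D \<Lambda> k t R'a A' k' t') \<and> R'a VX < R' VX) ?R A' out k'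
          (Suc t')"
        by (rule goal, rule main_path_step(3)[OF inv refl], use True in simp, use True in simp,
          simp, force,
            simp, rule main_path_step(1)[OF inv refl, where ?R1.0 = ?R], use True in simp, use True
              in simp,
            simp, force, use x in simp,
            rule main_path_step(2)[OF inv refl, where ?R1.0 = ?R], use True in simp, use True in
              simp,
            simp, force)
      then show ?thesis using True 2(1) P' degb by simp
    next
      case False
      define u where "u = A' AS 0"
      have uu: "u \<in> ready (pend D 0 0) {1..n} - D" "\<And>y. y \<in> {1..n} - D \<Longrightarrow> y \<noteq> u \<Longrightarrow> lt r u y"
      proof -
        have ns: "?p = 0 \<or> deg (pend D 0 0) ?p \<noteq> 0" using False by simp
        show "u \<in> ready (pend D 0 0) {1..n} - D"
          unfolding u_def by (rule main_heap_step(1)[OF inv ns])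
        show "lt r u y" if "y \<in> {1..n} - D" "y \<noteq> u" for y
          using that unfolding u_def by (rule main_heap_step(2)[OF inv ns])
      qed
      let ?T = "((deg (pend D 0 0))(0 := 1)) ?p"
      let ?R = "R'(VT := ?T, VI := 0, VU := u)"
      let ?Q = "\<lambda>R'a A' out' k' t'. out' = out \<and>
        (\<exists>D \<Lambda>. main_inv (pend D 0 0) (R'a VX) D \<Lambda> k t R'a A' k' t') \<and> R'a VX < R' VX"
      have "wp r inp delete_item (wp r inp (Inc VK ;; Wr AQ VK VU) (wp r inp release ?Q)) ?R A' out
        k' (Suc t')"
      proof (rule wp_delete_item[where n = n and In = "ready (pend D 0 0) {1..n}" and
            Al = "ready (pend D 0 0) {1..n} - D"], goal_cases)
        case 1
        show ?case using hs_invD(1)[OF i(4)] by simp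
      next
        case 2
        show ?case using uu by simp
      next
        case (3 R2 A2 j)
        let ?R2 = "R2(VK := Suc (R2 VK))" and ?A2 = "A2(AQ := (A2 AQ)(Suc (R2 VK) := u))"
        have R2: "R2 VK = R' VK" "R2 VU = u" "R2 VX = Suc x" using 3(1) x by simp_all
        have 4: "heap_state r n (ready (pend D 0 0) {1..n}) (ready (pend D 0 0) {1..n} - D - {u})
          ?R2 ?A2"
          using 3(4) by simp
        have 5: "2 ^ j + A' AIns u \<le> Suc (R' VC)" using 3(3) by simp
        have 6: "?R2 VK = Suc (R' VK)" "?A2 AQ = (A' AQ)(Suc (R' VK) := u)"
          using 3(2) R2 by simp_all
        have 7: "?R2 y = R' y" if "y \<in> {VN, VO, VF, VC, VJ}" for y
          using 3(1)[of y] that by auto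
        have 8: "?A2 f = A' f" if "f \<notin> {AMn, AS, AQ}" for f
          using 3(2)[of f] that by simp
        note step = main_heap_delete[OF inv uu 4 5 6(1) 7 6(2) 8]
        have "wp r inp release ?Q ?R2 ?A2 out (k' + 3 * j + 2) (Suc t' + 2 * j + 1)"
          by (rule goal[OF step(3)]) (use R2 step(1,2) in auto)
        then show ?case using R2 by simp
      qed
      moreover have "?T \<noteq> 0" using False by auto
      ultimately show ?thesis using 2(1) P' degb by (simp add: u_def)
    qed
  next
    case (3 R' A' out' k' t')
    then obtain D \<Lambda> where inv: "main_inv (pend D 0 0) 0 D \<Lambda> k t R' A' k' t'" by auto
    note i = main_invD[OF inv]
    have D: "D = {1..n}" using i(5,6) by (intro card_subset_eq) auto
    have DK: "D \<inter> K = K" using D K_sub by blast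
    have "src e \<in> {1..n}" "src e \<noteq> 0" if "e \<in> {1..m}" for e
      using arc_range[OF that] by auto
    then have pend: "pend D 0 0 = {}" unfolding D pend_def by (simp del: atLeastAtMost_iff)
    have ready: "ready (pend D 0 0) {1..n} = K"
      unfolding pend ready_def using K_sub by (auto simp: deg_def)
    note hs = hs_invD[OF i(4), unfolded ready]
    have VC: "R' VC = off" using hs(3) card_K by simp
    \<comment> \<open>There is exactly one insertion for each of the \<open>off\<close> items
      outside the path, so this bounds all carries of the phase.\<close>
    have VF: "R' VF \<le> n + off" using heap_nodes_le[OF hs(1)] VC by simp
    have "(\<Prod>x\<in>K. Suc (A' ADel x) - A' AIns x) \<le> T * 2 ^ (2 * off)"
    proof (rule prod_lifetimes)
      show "A' ADel (src e) < A' AIns (tgt e)" if "e \<in> {1..m}" "tgt e \<in> K" for e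
        using hs(5) that by blast
      show "A' ADel (src e) \<le> A' ADel (tgt e)" if "e \<in> {1..m}" "tgt e \<notin> K" for e
        using i(15) that arc_range[of e] D by blast
      show "A' ADel x \<le> off" if "x \<in> K" for x
        using hs(6)[of x] VC that D K_sub by auto
    qed
    then have "2 ^ \<Lambda> \<le> T * 2 ^ (2 * off)" using i(16) unfolding DK by linarith
    moreover have "R' VK = off" "A' AQ ` {1..off} = K"
      using i(10,11) unfolding DK card_K by simp_all
    \<comment> \<open>Of the 7 comparisons per item, 3 are due to inner nodes, 2 to the insertion
      and 2 to the deletion.\<close>
    moreover have "k' \<le> k + 7 * off + 3 * \<Lambda>" "t' \<le> t + 2 * n + 4 * off + 2 * \<Lambda> + m"
      using i(17,18) VC VF unfolding DK card_K pend by simp_all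
    ultimately have "Q R' A' out k' t'"
      using i(12) by (intro post[OF i(1,2) _ i(3)]) simp_all
    then show ?case using 3(1) by simp
  qed
qed (use A R in simp_all)

end

section \<open>Merging with the path\<close>

text \<open>The powers of two are stored because the RAM cannot halve and the downward search needs
  them again. Behind the end of the path \<open>AP\<close> reads null, for which \<open>Less\<close>
  answers no, so the end needs no separate test.\<close>

definition gallop_up :: com where
  "gallop_up = Rd VL APw VI ;; Plus VT VA VL ;; Rd VW AP VT ;; Less VT VW VU ;;
     Loop VT (Inc VI ;; Plus VL VL VL ;; Wr APw VI VL ;; Plus VT VA VL ;; Rd VW AP VT ;; Less VT VW
       VU)"

definition gallop_down :: com where
  "gallop_down = Loop VI (Dec VI ;; Rd VL APw VI ;; Plus VT VA VL ;; Rd VW AP VT ;; Less VT VW VU ;;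
     Cond VT (Plus VA VA VL) Skip)"

definition flush :: com where
  "flush = Minus VT VA VJ ;; Loop VT (Inc VJ ;; Rd VW AP VJ ;; Pr VW ;; Dec VT)"

definition merge_path :: com where
  "merge_path = Set VT 1 ;; Set VI 0 ;; Wr APw VI VT ;; Copy VJ VO ;; Copy VA VO ;; Set VH 0 ;;
     Copy VX VK ;;
     Loop VX (Inc VH ;; Rd VU AQ VH ;; Rd VL ALp VU ;; Minus VT VL VA ;; Plus VA VA VT ;; Set VI 0
       ;;
       gallop_up ;; gallop_down ;; flush ;; Pr VU ;; Dec VX) ;;
     Copy VA VN ;; flush"

section \<open>Exponential search for a position on the path\<close>

context path_input
begin

definition pos :: "nat \<Rightarrow> nat" where
  "pos q = Max (insert off {j \<in> {off<..n}. lt r (P j) q})"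

lemma pos_bounds: "off \<le> pos q" "pos q \<le> n"
  unfolding pos_def using off by (auto intro: Max_ge)

text \<open>The smaller path items form an initial segment. Positions beyond n are included, both
  sides being false there, so that the search may overshoot.\<close>

lemma less_iff_pos:
  assumes "off < j"
  shows "lt r (P j) q \<longleftrightarrow> j \<le> pos q"
proof
  assume l: "lt r (P j) q"
  then have "P j \<noteq> 0" by (simp add: lt_def)
  then have "j \<in> {off<..n}" using P_0 by metis
  then show "j \<le> pos q" unfolding pos_def using l by (intro Max_ge) auto
next
  assume j: "j \<le> pos q"
  have "pos q \<in> insert off {j \<in> {off<..n}. lt r (P j) q}"
    unfolding pos_def by (rule Max_in) auto
  then have p: "lt r (P (pos q)) q" "pos q \<in> {off<..n}" using j assms by auto
  show "lt r (P j) q"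
  proof (cases "j = pos q")
    case False
    then have "lt r (P j) (P (pos q))" using P_less assms j p(2) by simp
    then show ?thesis using p trans by metis
  qed (use p in simp)
qed

lemma pos_mono: "lt r q q' \<Longrightarrow> pos q \<le> pos q'"
proof (cases "pos q = off")
  case False
  assume l: "lt r q q'"
  have "off < pos q" using False pos_bounds[of q] by simp
  then have "lt r (P (pos q)) q'" using less_iff_pos l trans by blast
  then show ?thesis using less_iff_pos \<open>off < pos q\<close> by simp
qed (use pos_bounds in simp)

lemma less_P:
  assumes "x \<in> K" "pos x < j" "j \<le> n"
  shows "lt r x (P j)"
proof -
  have j: "j \<in> {off<..n}" using assms pos_bounds[of x] by auto
  then have "P j \<in> {1..n} - K" using path_image by blast
  moreover have "\<not> lt r (P j) x" using less_iff_pos j assms by auto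
  ultimately show ?thesis using total[of x "P j"] assms K_sub by blast
qed

text \<open>A positive \<open>lp\<close> is the position of an actual predecessor, which is smaller
  than \<open>x\<close>.\<close>

lemma lp_le_pos: "lp x \<le> pos x"
proof (cases "lp x = 0")
  case False
  then obtain e where e: "e \<in> {1..m}" "tgt e = x" "lp x = pidx (src e)"
    using lp_arc by metis
  then have p: "lp x \<in> {off<..n}" "P (lp x) = src e" using pidx[of "src e"] False by auto
  then have "lt r (P (lp x)) x" using arc_lt[OF e(1)] e by simp
  then show ?thesis using less_iff_pos[of "lp x" x] p(1) by auto
qed simp

text \<open>The final power is twice the last one that succeeded, which is at most the distance to
  be covered. The \<open>Suc\<close> in the range covers a search that fails at once.\<close>

lemma wp_gallop_up:
  assumes AP: "A AP = P" and pw: "A APw 0 = 1" and R: "R VI = 0" "R VU = q" "R VA = a" "off \<le> a" "a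
    \<le> pos q"
    and post: "\<And>R' A' i. \<lbrakk>\<And>x. x \<notin> {VL, VT, VW, VI} \<Longrightarrow> R' x = R x; \<And>f. f \<noteq> APw \<Longrightarrow> A' f = A f;
      \<And>j. j \<le> i \<Longrightarrow> A' APw j = 2 ^ j; R' VI = i; pos q < a + 2 ^ i; 2 ^ i \<le> 2 * (Suc (pos q) - a)\<rbrakk> \<Longrightarrow>
      Q R' A' out (k + i + 1) (t + i)"
  shows "wp r inp gallop_up Q R A out k t"
proof -
  have test: "lt r (P (a + 2 ^ i)) q \<longleftrightarrow> a + 2 ^ i \<le> pos q" for i
    by (intro less_iff_pos le_less_trans[OF R(4)]) simp
  show ?thesis
    unfolding gallop_up_def
  proof (simp add: R AP pw split del: if_split, rule wp_Loop[where \<mu> = "\<lambda>R A. Suc n - 2 ^ R VI" and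
    I = "\<lambda>R' A' out' k' t'.
        out' = out \<and> (\<forall>x. x \<notin> {VL, VT, VW, VI} \<longrightarrow> R' x = R x) \<and> (\<forall>f. f \<noteq> APw \<longrightarrow> A' f = A f) \<and>
        (\<forall>j\<le>R' VI. A' APw j = 2 ^ j) \<and> R' VL = 2 ^ R' VI \<and>
        (R' VT \<noteq> 0 \<longleftrightarrow> a + 2 ^ R' VI \<le> pos q) \<and> (R' VI = 0 \<or> 2 ^ R' VI \<le> 2 * (pos q - a)) \<and>
        k' = k + R' VI + 1 \<and> t' = t + R' VI"], goal_cases)
    case 1
    show ?case using R pw test[of 0] by simp
  next
    case (2 R' A' out' k' t')
    define i where "i = R' VI"
    have fr: "out' = out" "\<forall>x. x \<notin> {VL, VT, VW, VI} \<longrightarrow> R' x = R x" "\<forall>f. f \<noteq> APw \<longrightarrow> A' f = A f"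
      "\<forall>j\<le>i. A' APw j = 2 ^ j" "R' VL = 2 ^ i" "R' VT \<noteq> 0 \<longleftrightarrow> a + 2 ^ i \<le> pos q"
      "k' = k + i + 1" "t' = t + i"
      using 2(1)[folded i_def] by - (elim conjE, assumption)+
    have le: "a + 2 ^ i \<le> pos q" using fr(6) 2(2) by blast
    then have "2 ^ i \<le> n" using pos_bounds[of q] by simp
    \<comment> \<open>Powers that succeed are at most n, so the truncated difference really
      decreases.\<close>
    then have mu: "Suc n - 2 * 2 ^ i < Suc n - 2 ^ i" by (intro diff_less_mono2) auto
    have "lt r (P (a + (2 ^ i + 2 ^ i))) q \<longleftrightarrow> a + 2 * 2 ^ i \<le> pos q"
      using test[of "Suc i"] by (simp add: mult_2)
    then show ?case using fr R AP le mu by (simp add: i_def[symmetric] le_Suc_eq mult_2)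
  next
    case (3 R' A' out' k' t')
    define i where "i = R' VI"
    have fr: "out' = out" "\<forall>x. x \<notin> {VL, VT, VW, VI} \<longrightarrow> R' x = R x" "\<forall>f. f \<noteq> APw \<longrightarrow> A' f = A f"
      "\<forall>j\<le>i. A' APw j = 2 ^ j" "R' VT \<noteq> 0 \<longleftrightarrow> a + 2 ^ i \<le> pos q"
      "i = 0 \<or> 2 ^ i \<le> 2 * (pos q - a)" "k' = k + i + 1" "t' = t + i"
      using 3(1)[folded i_def] by - (elim conjE, assumption)+
    have "2 ^ i \<le> 2 * (Suc (pos q) - a)" using fr(6) R(5) by auto
    then have "Q R' A' out (k + i + 1) (t + i)"
      using fr 3(2) by (intro post) (auto simp: i_def)
    then show ?case using fr by simp
  qed
qed

text \<open>The position sought stays in the interval of length \<open>2 ^ VI\<close> that starts at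
  \<open>VA\<close>; in the end the length is 1.\<close>

lemma wp_gallop_down:
  assumes AP: "A AP = P" and pw: "\<And>j. j \<le> e \<Longrightarrow> A APw j = 2 ^ j"
    and R: "R VI = e" "R VU = q" "R VA = a" "off \<le> a" "a \<le> pos q" "pos q < a + 2 ^ e"
    and post: "\<And>R'. \<lbrakk>\<And>x. x \<notin> {VL, VT, VW, VI, VA} \<Longrightarrow> R' x = R x; R' VA = pos q\<rbrakk> \<Longrightarrow>
      Q R' A out (k + e) (t + e)"
  shows "wp r inp gallop_down Q R A out k t"
proof -
  show ?thesis
    unfolding gallop_down_def
  proof (rule wp_Loop[where \<mu> = "\<lambda>R A. R VI" and I = "\<lambda>R' A' out' k' t'.
        out' = out \<and> A' = A \<and> (\<forall>x. x \<notin> {VL, VT, VW, VI, VA} \<longrightarrow> R' x = R x) \<and> R' VI \<le> e \<and>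
        off \<le> R' VA \<and> R' VA \<le> pos q \<and> pos q < R' VA + 2 ^ R' VI \<and>
        k' + R' VI = k + e \<and> t' + R' VI = t + e"], goal_cases)
    case 1
    show ?case using R by simp
  next
    case (2 R' A' out' k' t')
    obtain i where i: "R' VI = Suc i" using 2(2) not0_implies_Suc by blast
    have fr: "off \<le> R' VA" "R' VA \<le> pos q" "pos q < R' VA + 2 * 2 ^ i" "Suc i \<le> e"
      using 2(1) i by simp_all
    have "off < R' VA + 2 ^ i" using fr(1) by (rule le_less_trans) simp
    then have "lt r (P (R' VA + 2 ^ i)) q \<longleftrightarrow> R' VA + 2 ^ i \<le> pos q" by (rule less_iff_pos)
    then show ?case using 2(1) i fr R AP pw[of i] by simp
  next
    case (3 R' A' out' k' t')
    then have "Q R' A out (k + e) (t + e)" by (intro post) auto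
    then show ?case using 3 by simp
  qed
qed

section \<open>Merged output and total search cost\<close>

definition printed_upto :: "(nat \<Rightarrow> nat) \<Rightarrow> nat \<Rightarrow> nat \<Rightarrow> nat list \<Rightarrow> bool" where
  "printed_upto q b i out \<longleftrightarrow> (\<exists>xs. out = map (\<lambda>x. x - 1) xs \<and> sorted_wrt (lt r) xs \<and>
     set xs = P ` {off<..b} \<union> q ` {1..i})"

text \<open>The printed items outside the path have \<open>pos\<close> at most \<open>b\<close>, so
  they lie before the path item of position \<open>b + 1\<close>.\<close>

lemma printed_upto_P:
  assumes "printed_upto q b i out" "off \<le> b" "b < n" "\<And>j. j \<in> {1..i} \<Longrightarrow> q j \<in> K \<and> pos (q j) \<le> b"
  shows "printed_upto q (Suc b) i (out @ [P (Suc b) - 1])"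
proof -
  obtain xs where xs: "out = map (\<lambda>x. x - 1) xs" "sorted_wrt (lt r) xs"
    "set xs = P ` {off<..b} \<union> q ` {1..i}"
    using assms(1) unfolding printed_upto_def by blast
  have "lt r x (P (Suc b))" if "x \<in> set xs" for x
  proof -
    consider j where "j \<in> {off<..b}" "x = P j" | j where "j \<in> {1..i}" "x = q j"
      using \<open>x \<in> set xs\<close> unfolding xs(3) by blast
    then show ?thesis
    proof cases
      case 1
      then show ?thesis using P_less[of j "Suc b"] assms(3) by simp
    next
      case 2
      then show ?thesis using assms(4)[OF 2(1)] less_P[of x "Suc b"] assms(3) by simp
    qed
  qed
  moreover have "{off<..Suc b} = insert (Suc b) {off<..b}" using assms(2) by auto
  ultimately show ?thesis
    unfolding printed_upto_def using xs
    by (intro exI[of _ "xs @ [P (Suc b)]"]) (simp add: sorted_wrt_append)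
qed

lemma printed_upto_q:
  assumes "printed_upto q b i out" "b = pos (q (Suc i))" "\<And>j. j \<in> {1..i} \<Longrightarrow> lt r (q j) (q (Suc i))"
  shows "printed_upto q b (Suc i) (out @ [q (Suc i) - 1])"
proof -
  obtain xs where xs: "out = map (\<lambda>x. x - 1) xs" "sorted_wrt (lt r) xs"
    "set xs = P ` {off<..b} \<union> q ` {1..i}"
    using assms(1) unfolding printed_upto_def by blast
  have "lt r x (q (Suc i))" if "x \<in> set xs" for x
  proof -
    consider j where "j \<in> {off<..b}" "x = P j" | j where "j \<in> {1..i}" "x = q j"
      using \<open>x \<in> set xs\<close> unfolding xs(3) by blast
    then show ?thesis
    proof cases
      case 1
      then show ?thesis using less_iff_pos[of j "q (Suc i)"] assms(2) by simp
    next
      case 2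
      then show ?thesis using assms(3) by blast
    qed
  qed
  moreover have "{1..Suc i} = insert (Suc i) {1..i}" by auto
  ultimately show ?thesis
    unfolding printed_upto_def using xs
    by (intro exI[of _ "xs @ [q (Suc i)]"]) (simp add: sorted_wrt_append del: One_nat_def)
qed

lemma wp_flush:
  assumes AP: "A AP = P" and R: "R VJ = b" "R VA = a" "off \<le> b" "b \<le> a" "a \<le> n"
    and pr: "printed_upto q b i out" and q: "\<And>j. j \<in> {1..i} \<Longrightarrow> q j \<in> K \<and> pos (q j) \<le> b"
    and post: "\<And>R' out'. \<lbrakk>\<And>x. x \<notin> {VT, VJ, VW} \<Longrightarrow> R' x = R x; R' VJ = a; printed_upto q a i out'\<rbrakk> \<Longrightarrow>
      Q R' A out' k (t + (a - b))"
  shows "wp r inp flush Q R A out k t"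
  unfolding flush_def
proof (simp add: R, rule wp_Loop[where \<mu> = "\<lambda>R A. R VT" and I = "\<lambda>R' A' out' k' t'.
      A' = A \<and> k' = k \<and> (\<forall>x. x \<notin> {VT, VJ, VW} \<longrightarrow> R' x = R x) \<and> R' VJ + R' VT = a \<and> b \<le> R' VJ \<and>
      t' + R' VT = t + (a - b) \<and> printed_upto q (R' VJ) i out'"], goal_cases)
  case 1
  show ?case using R pr by simp
next
  case (2 R' A' out' k' t')
  have "printed_upto q (Suc (R' VJ)) i (out' @ [P (Suc (R' VJ)) - 1])"
  proof (rule printed_upto_P)
    show "q j \<in> K \<and> pos (q j) \<le> R' VJ" if "j \<in> {1..i}" for j
      using q[OF that] 2(1) le_trans by blast
  qed (use 2 R in auto)
  then show ?case using 2 AP by simp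
next
  case (3 R' A' out' k' t')
  then have "Q R' A out' k (t + (a - b))" by (intro post) auto
  then show ?case using 3 by simp
qed

context
  fixes q :: "nat \<Rightarrow> nat"
  assumes q_image: "q ` {1..off} = K"
    and q_sorted: "\<And>i j. 1 \<le> i \<Longrightarrow> i < j \<Longrightarrow> j \<le> off \<Longrightarrow> lt r (q i) (q j)"
begin

text \<open>The position that the search for the next item inherits from the previous one; index 0
  stands for no item merged so far.\<close>

definition prev :: "nat \<Rightarrow> nat" where
  "prev i = (if i = 0 then off else pos (q i))"

lemma q_in: "i \<in> {1..off} \<Longrightarrow> q i \<in> K"
  using q_image by blast

lemma prev_mono: "i \<le> j \<Longrightarrow> j \<le> off \<Longrightarrow> prev i \<le> prev j"
  using pos_bounds pos_mono q_sorted unfolding prev_def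
  by (cases "i = j"; cases "i = 0") auto

lemma prev_bounds: "off \<le> prev i" "prev i \<le> n"
  using pos_bounds off unfolding prev_def by auto

lemma q_inj: "inj_on q {1..off}"
proof (rule inj_onI)
  fix i j
  assume "i \<in> {1..off}" "j \<in> {1..off}" "q i = q j"
  then show "i = j"
    using q_sorted[of i j] q_sorted[of j i] irrefl by (cases i j rule: linorder_cases) auto
qed

text \<open>Successive ranges overlap at most in an endpoint, each starts no earlier than the path
  predecessors of its item and ends before the path successors. Ordering the items in one gap by
  their rank \<open>idx\<close> thus meets the conditions for independent choices.\<close>

lemma prod_search_ranges:
  "(\<Prod>i\<in>{1..off}. Suc (pos (q i)) - max (prev (i - 1)) (lp (q i))) \<le> T"
proof -
  define idx where "idx = inv_into {1..off} q"
  have idx: "idx x \<in> {1..off}" "q (idx x) = x" if "x \<in> K" for x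
    using that q_image unfolding idx_def by (metis inv_into_into, metis f_inv_into_f)
  have "(\<Prod>x\<in>K. Suc (pos x) - max (prev (idx x - 1)) (lp x)) \<le> T"
  proof (rule prod_gaps[where q = idx and k = off])
    fix e
    assume e: "e \<in> {1..m}" "src e \<in> K" "tgt e \<in> K"
    have less: "idx (src e) < idx (tgt e)"
    proof (rule ccontr)
      assume "\<not> ?thesis"
      then have "src e = tgt e \<or> lt r (tgt e) (src e)"
        using idx[OF e(2)] idx[OF e(3)] q_sorted[of "idx (tgt e)" "idx (src e)"]
        by (metis atLeastAtMost_iff linorder_neqE_nat)
      then show False
        using arc_lt[OF e(1)] asym irrefl by metis
    qed
    have "prev (idx (src e)) \<le> prev (idx (tgt e) - 1)"
      using less idx[OF e(3)] by (intro prev_mono) auto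
    moreover have "prev (idx (src e)) = pos (src e)"
      using idx[OF e(2)] by (simp add: prev_def)
    ultimately show "idx (src e) < idx (tgt e) \<and> pos (src e) \<le> max (prev (idx (tgt e) - 1)) (lp (tgt
      e))"
      using less by simp
  next
    fix e
    assume e: "e \<in> {1..m}" "src e \<in> K" "tgt e \<notin> K"
    then have "pidx (tgt e) \<noteq> 0" using arc_range[OF e(1)] by (simp add: K_def)
    then have p: "pidx (tgt e) \<in> {off<..n}" "P (pidx (tgt e)) = tgt e" using pidx by blast+
    have "\<not> lt r (P (pidx (tgt e))) (src e)" using arc_lt[OF e(1)] p asym by metis
    then show "pos (src e) < pidx (tgt e)"
      using less_iff_pos[of "pidx (tgt e)" "src e"] p(1) by auto
  next
    fix x
    show "lp x \<le> max (prev (idx x - 1)) (lp x) \<and> off \<le> max (prev (idx x - 1)) (lp x) \<and> pos x \<le> n"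
      using pos_bounds prev_bounds[of "idx x - 1"] by auto
  next
    fix x
    assume "x \<in> K"
    then show "1 \<le> idx x \<and> idx x \<le> off" using idx by auto
  qed
  moreover have "(\<Prod>x\<in>K. Suc (pos x) - max (prev (idx x - 1)) (lp x)) =
      (\<Prod>i\<in>{1..off}. Suc (pos (q i)) - max (prev (idx (q i) - 1)) (lp (q i)))"
    unfolding q_image[symmetric] by (subst prod.reindex[OF q_inj]) (simp add: comp_def)
  moreover have "idx (q i) = i" if "i \<in> {1..off}" for i
    using q_inj that unfolding idx_def by (rule inv_into_f_f)
  ultimately show ?thesis by simp
qed

text \<open>A search with exponent \<open>e\<close> takes \<open>2 * e + 1\<close> comparisons, and
  \<open>2 ^ e\<close> is at most twice the range; over all items the twos give
  \<open>2 ^ off\<close>. Printing takes \<open>n - off\<close> ticks for the path, and the rounds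
  add the other \<open>off\<close>.\<close>

lemma wp_merge_path:
  assumes R: "R VN = n" "R VO = off" "R VK = off" and A: "static A" "A AQ = q" and out: "out = []"
    and post: "\<And>R' A' out' \<Lambda>. \<lbrakk>lists_in_order {..<n} r out'; 2 ^ \<Lambda> \<le> 2 ^ off * T\<rbrakk> \<Longrightarrow>
      Q R' A' out' (k + 2 * \<Lambda> + off) (t + n + 2 * \<Lambda>)"
  shows "wp r inp merge_path Q R A out k t"
  unfolding merge_path_def
proof (simp add: R out, rule wp_Loop[where \<mu> = "\<lambda>R A. R VX" and I = "\<lambda>R' A' out' k' t'.
      R' VN = n \<and> static A' \<and> A' AQ = q \<and> A' APw 0 = 1 \<and> R' VH + R' VX = off \<and>
      R' VJ = prev (R' VH) \<and> R' VA = prev (R' VH) \<and> printed_upto q (prev (R' VH)) (R' VH) out' \<and>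
      (\<exists>\<Lambda>. 2 ^ \<Lambda> \<le> 2 ^ R' VH * (\<Prod>i\<in>{1..R' VH}. Suc (pos (q i)) - max (prev (i - 1)) (lp (q i))) \<and>
        k' = k + 2 * \<Lambda> + R' VH \<and> t' + off = t + R' VH + 2 * \<Lambda> + prev (R' VH))"], goal_cases)
  case 1
  have "printed_upto q off 0 []" by (simp add: printed_upto_def)
  moreover have "static (A(APw := (A APw)(0 := Suc 0)))" using A by (simp add: static_def)
  moreover have "prev 0 = off" by (simp add: prev_def)
  ultimately show ?case using R A by (auto intro!: exI[of _ 0])
next
  case (2 R' A' out' k' t')
  define i where "i = R' VH"
  let ?G = "\<lambda>i. Suc (pos (q i)) - max (prev (i - 1)) (lp (q i))"
  have fr: "R' VN = n" "static A'" "A' AQ = q" "A' APw 0 = 1" "i + R' VX = off"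
      "R' VJ = prev i" "R' VA = prev i" "printed_upto q (prev i) i out'"
      "\<exists>\<Lambda>. 2 ^ \<Lambda> \<le> 2 ^ i * (\<Prod>i\<in>{1..i}. ?G i) \<and> k' = k + 2 * \<Lambda> + i \<and> t' + off = t + i + 2 * \<Lambda> + prev
        i"
    using 2(1)[folded i_def] by - (elim conjE, assumption)+
  obtain \<Lambda> where L: "2 ^ \<Lambda> \<le> 2 ^ i * (\<Prod>i\<in>{1..i}. ?G i)" "k' = k + 2 * \<Lambda> + i"
    "t' + off = t + i + 2 * \<Lambda> + prev i"
    using fr(9) by blast
  have A': "A' AP = P" "A' ALp = lp" using fr(2) by (simp_all add: static_def)
  have i: "Suc i \<le> off" using 2(2) fr(5) by simp
  define x a where "x = q (Suc i)" and "a = prev i + (lp x - prev i)"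
  have a: "a = max (prev i) (lp x)" by (simp add: a_def)
  have prevS: "prev (Suc i) = pos x" by (simp add: prev_def x_def)
  have "prev i \<le> pos x" using prev_mono[of i "Suc i"] i prevS by simp
  then have ax: "off \<le> a" "a \<le> pos x" "prev i \<le> pos x"
    using lp_le_pos[of x] prev_bounds[of i] by (auto simp: a)
  have done_q: "q j \<in> K \<and> pos (q j) \<le> prev i" if "j \<in> {1..i}" for j
    using that q_in[of j] prev_mono[of j i] i by (auto simp: prev_def split: if_splits)
  have q_less: "lt r (q j) (q (Suc i))" if "j \<in> {1..i}" for j
    using that q_sorted[of j "Suc i"] i by auto
  show ?case
  proof (simp add: i_def[symmetric] fr A' x_def[symmetric] a_def[symmetric],
      rule wp_gallop_up[where q = x and a = a], goal_cases)
    case (8 R1 A1 e)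
    have R1: "R1 VU = x" "R1 VA = a" "R1 VJ = prev i" "R1 VN = n" "R1 VH = Suc i" "R1 VX = R' VX"
      using 8(1) fr by simp_all
    have A1: "static A1" "A1 AQ = q" "A1 AP = P" "A1 APw 0 = 1"
      using 8(2) 8(3)[of 0] fr by (simp_all add: static_def)
    show ?case
      unfolding wp_simps(14)
    proof (rule wp_gallop_down[where e = e and q = x and a = a], goal_cases)
      case (9 R2)
      have R2: "R2 VU = x" "R2 VJ = prev i" "R2 VN = n" "R2 VH = Suc i" "R2 VX = R' VX"
        using 9(1) R1 by simp_all
      show ?case
      proof (rule wp_flush[where b = "prev i" and a = "pos x" and q = q and i = i], goal_cases)
        case (9 R3 out3)
        have R3: "R3 VU = x" "R3 VN = n" "R3 VH = Suc i" "R3 VX = R' VX" "R3 VA = pos x"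
          using 9(1) R2 \<open>R2 VA = pos x\<close> by simp_all
        have "printed_upto q (pos x) (Suc i) (out3 @ [x - 1])"
          using printed_upto_q[OF 9(3)] q_less unfolding x_def by simp
        moreover have "2 ^ (\<Lambda> + e) \<le> 2 ^ Suc i * (\<Prod>i\<in>{1..Suc i}. ?G i)"
        proof -
          have "{1..Suc i} = insert (Suc i) {1..i}" by auto
          then have "(\<Prod>i\<in>{1..Suc i}. ?G i) = ?G (Suc i) * (\<Prod>i\<in>{1..i}. ?G i)" by simp
          moreover have "2 ^ e \<le> 2 * ?G (Suc i)"
            using 8(6) by (simp add: x_def[symmetric] a)
          then have "2 ^ \<Lambda> * 2 ^ e \<le> 2 ^ i * (\<Prod>i\<in>{1..i}. ?G i) * (2 * ?G (Suc i))"
            using L(1) by (intro mult_le_mono)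
          ultimately show ?thesis by (simp only: power_add power_Suc mult_ac)
        qed
        moreover have "k' + e + 1 + e = k + 2 * (\<Lambda> + e) + Suc i" using L(2) by simp
        moreover have "Suc t' + e + e + (pos x - prev i) + off = t + Suc i + 2 * (\<Lambda> + e) + pos x"
          using L(3) ax(3) by simp
        ultimately show ?case
          using R3 A1 9(2) prevS fr(5) 2(2) by (auto simp: i_def[symmetric] intro!: exI[of _ "\<Lambda> +
            e"])
      qed (use R2 A1 \<open>R2 VA = pos x\<close> prev_bounds pos_bounds ax fr(8) done_q in auto)
    qed (use 8 R1 A1 ax in auto)
  qed (use fr A' ax in auto)
next
  case (3 R' A' out' k' t')
  have H: "R' VH = off" using 3 by simp
  let ?G = "\<lambda>i. Suc (pos (q i)) - max (prev (i - 1)) (lp (q i))"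
  have fr: "R' VN = n" "static A'"  "R' VJ = prev off" "printed_upto q (prev off) off out'"
      "\<exists>\<Lambda>. 2 ^ \<Lambda> \<le> 2 ^ off * (\<Prod>i\<in>{1..off}. ?G i) \<and> k' = k + 2 * \<Lambda> + off \<and> t' + off = t + off + 2 * \<Lambda>
        + prev off"
    using 3(1)[unfolded H] by - (elim conjE, assumption)+
  obtain \<Lambda> where L: "2 ^ \<Lambda> \<le> 2 ^ off * (\<Prod>i\<in>{1..off}. ?G i)" "k' = k + 2 * \<Lambda> + off"
    "t' + off = t + off + 2 * \<Lambda> + prev off"
    using fr(5) by blast
  have A': "A' AP = P" using fr(2) by (simp add: static_def)
  have done_q: "q j \<in> K \<and> pos (q j) \<le> prev off" if "j \<in> {1..off}" for j
    using that q_in[of j] prev_mono[of j off] by (auto simp: prev_def split: if_splits)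
  show ?case
  proof (simp, rule wp_flush[where b = "prev off" and a = n and q = q and i = off], goal_cases)
    case (9 R3 out3)
    obtain xs where xs: "out3 = map (\<lambda>x. x - 1) xs" "sorted_wrt (lt r) xs"
      "set xs = P ` {off<..n} \<union> q ` {1..off}"
      using 9(3) unfolding printed_upto_def by blast
    have set: "set xs = {1..n}" unfolding xs(3) path_image q_image using K_sub by blast
    have "set out3 = {..<n}"
    proof -
      have "y \<in> (\<lambda>x. x - 1) ` {1..n}" if "y < n" for y
        using that by (intro image_eqI[of _ _ "Suc y"]) auto
      then show ?thesis unfolding xs(1) set_map set by auto
    qed
    moreover have "sorted_wrt (\<lambda>x y. (x, y) \<in> r) out3"
      unfolding xs(1) sorted_wrt_map
      by (rule sorted_wrt_mono_rel[OF _ xs(2)]) (simp add: lt_def)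
    ultimately have "lists_in_order {..<n} r out3" by (simp add: lists_in_order_def)
    moreover have "2 ^ \<Lambda> \<le> 2 ^ off * T"
      using L(1) prod_search_ranges by (meson le_trans mult_le_mono2)
    ultimately have "Q R3 A' out3 (k + 2 * \<Lambda> + off) (t + n + 2 * \<Lambda>)" by (rule post)
    moreover have "t' + (n - prev off) = t + n + 2 * \<Lambda>"
      using L(3) prev_bounds[of off] by simp
    ultimately show ?case using L(2) by simp
  qed (use fr A' prev_bounds done_q in auto)
qed

end

end

section \<open>The sorting program\<close>

definition main_program :: com where
  "main_program = read_input ;; find_levels ;; find_path ;; find_lower_bounds ;; heapsort ;;
    merge_path"

text \<open>The prologue puts 1 into register 6, reads m from cell 1 and computes
  \<open>2 * m + 2\<close>, the length of the input, in register 5. Register 7 is 0 from the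
  start.\<close>

definition ram_program :: "instr list" where
  "ram_program = [Const 6 1, Load 5 6, Add 5 5 5, Add 5 5 6, Add 5 5 6] @ code 5 main_program"

text \<open>With p for OPT, \<open>off\<close> is at most p, so the exponents of heapsort and merge
  are at most 3 * p and 2 * p. The comparisons are at most 8 * off + 3 * (3 * p) + 2 * (2 * p),
  hence 21 * p. The ticks sum to at most 4 * m + 6 * n + 4 * off plus twice both exponents, where n
  is at most m + 2 * p.\<close>

lemma (in sorting_input) wp_main_program:
  assumes "2 \<le> card (topological_orders {..<n} (set arcs))"
  shows "wp r inp main_program (\<lambda>R A out k t. lists_in_order {..<n} r out \<and>
    k \<le> 21 * OPT {..<n} (set arcs) \<and> t \<le> 10 * m + 26 * OPT {..<n} (set arcs))
    (\<lambda>_. 0) (\<lambda>_ _. 0) [] 0 0"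
proof -
  let ?T = "card (topological_orders {..<n} (set arcs))" and ?p = "OPT {..<n} (set arcs)"
  have T: "?T \<le> 2 ^ ?p" by (rule card_topological_orders_le) simp
  have p: "1 \<le> ?p" using T assms by (cases ?p) auto
  have n: "1 \<le> n"
  proof (rule ccontr)
    assume "\<not> ?thesis"
    then have "topological_orders {..<n} (set arcs) \<subseteq> {{}}"
      by (auto simp: topological_orders_def)
    then have "?T \<le> card {{} :: (nat \<times> nat) set}" by (intro card_mono) auto
    then show False
      using assms by simp
  qed
  show ?thesis
    unfolding main_program_def wp_simps(14)
  proof (rule wp_read_input, goal_cases)
    case (2 R1 A1)
    note 1 = 2
    show ?case
    proof (rule wp_find_levels, goal_cases)
      case (6 R2 A2)
      note 2 = 6
      have f2: "A2 f = (\<lambda>_. 0)" if "f \<notin> {AHead, ANxt, ATgt, ASrc, ADegA, ADegB, AOrd, APar, ALev}"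
        for f
        using 2(2)[of f] 1(6)[of f] that by simp
      show ?case
      proof (rule wp_find_path, goal_cases)
        case (7 R3 A3 t3 off)
        note 3 = 7
        show ?case
        proof (rule wp_find_lower_bounds, goal_cases)
          case (4 R4 A4)
          note 4 = 4
          have A4: "A4 AP = A3 AP" "A4 APidx = A3 APidx" "graph_ok (A4 AHead) (A4 ANxt) (A4 ATgt)
            (A4 ASrc)"
            "A4 ADegB = deg {1..m}"
            using 4(2) 3(2) 2(2) 1(3,5) by simp_all
          have f4: "A4 f = (\<lambda>_. 0)" if "f \<in> {AMn, ALft, ARgt, AUp, ASA, ASB, AS}" for f
            using 4(2)[of f] 3(2)[of f] f2[of f] that by auto
          have R4: "R4 VN = n" "R4 VO = off" "R4 VJ = off"
            using 4(1) 3(1,3,4) 2(1) 1(1) by simp_all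
          interpret path_input n arcs r off "A3 AP" "A3 APidx" "A4 ALp" "A2 ALev"
            by (rule path_inputI[OF 3(5,6)]) (use 2(4,5) 4(3,4) in auto)
          have offp: "off \<le> ?p"
          proof -
            have "(2::nat) ^ off \<le> 2 ^ ?p"
              using two_pow_off_le T unfolding T_def by linarith
            then show ?thesis by (simp add: power_increasing_iff)
          qed
          show ?case
          proof (rule wp_heapsort[OF R4 A4(3,1,2) refl A4(4) f4], goal_cases)
            case 1
            then show ?case .
          next
            case (2 R5 A5 \<Lambda> k5 t5)
            note 5 = 2
            show ?case
            proof (rule wp_merge_path[OF 5(5,6) 5(1,2,3,4) refl refl], goal_cases)
              case 1 then show ?case by simp
            next
              case 2 then show ?case by simp
            next
              case 3 then show ?case by simp
            next
              case (4 R6 A6 out \<Lambda>')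
              have "(2::nat) ^ \<Lambda> \<le> 2 ^ (?p + 2 * off)"
              proof -
                have "T * 2 ^ (2 * off) \<le> 2 ^ ?p * 2 ^ (2 * off)"
                  using T unfolding T_def by (rule mult_le_mono1)
                then show ?thesis using le_trans[OF 5(7)] by (simp only: power_add)
              qed
              then have "\<Lambda> \<le> ?p + 2 * off" by (simp add: power_increasing_iff)
              moreover have "(2::nat) ^ \<Lambda>' \<le> 2 ^ (off + ?p)"
              proof -
                have "2 ^ off * T \<le> 2 ^ off * 2 ^ ?p"
                  using T unfolding T_def by (rule mult_le_mono2)
                then show ?thesis using le_trans[OF 4(2)] by (simp only: power_add)
              qed
              then have "\<Lambda>' \<le> off + ?p" by (simp add: power_increasing_iff)
              ultimately show ?case using 4(1) offp p n_le 5(8,9) 3(7) by auto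
            qed
          qed
        qed (use 1 2 3 f2 in auto)
      qed (use 1 2 n f2 in auto)
    qed (use 1 in auto)
  qed simp
qed

theorem theorem1p1:
  shows "\<exists>(P :: instr list) (C :: nat).
    \<forall>(n :: nat) (arcs :: (nat \<times> nat) list) (r :: (nat \<times> nat) set).
      r \<in> topological_orders {..<n} (set arcs) \<longrightarrow>
      2 \<le> card (topological_orders {..<n} (set arcs)) \<longrightarrow>
      (\<exists>t \<le> C * (length arcs + OPT {..<n} (set arcs)).
        let c = run P r t (initial n arcs) in
          halted P c \<and>
          lists_in_order {..<n} r (printed c) \<and>
          comparisons c \<le> C * OPT {..<n} (set arcs))"
proof (rule exI[of _ ram_program], rule exI[of _ "27 * weight main_program + 26"], intro allI impI)
  fix n :: nat and arcs :: "(nat \<times> nat) list" and r :: "(nat \<times> nat) set"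
  let ?W = "weight main_program" and ?p = "OPT {..<n} (set arcs)"
  assume r: "r \<in> topological_orders {..<n} (set arcs)"
    and two: "2 \<le> card (topological_orders {..<n} (set arcs))"
  interpret sorting_input n arcs r
    by unfold_locales (rule r)
  let ?P = ram_program and ?c = "run ram_program r 5 (initial n arcs)"
  obtain R A out k t where s: "big r inp main_program (\<lambda>_. 0, \<lambda>_ _. 0, [], 0, 0) (R, A, out, k, t)"
    "lists_in_order {..<n} r out" "k \<le> 21 * ?p" "t \<le> 10 * m + 26 * ?p"
    using wp_main_program[OF two] unfolding wp_def by blast
  have "2 \<le> (2::nat) ^ ?p"
    using two card_topological_orders_le[of "{..<n}" "set arcs"] by simp
  then have p: "1 \<le> ?p" by (cases ?p) auto
  have inp: "length inp = 2 * m + 2" "input_words n arcs = inp" "input_words n arcs ! Suc 0 = m"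
    by (simp_all add: inp_def m_def nth_input_words)
  have c: "?c = (initial n arcs)\<lparr>pc := 5, reg := (\<lambda>_. 0)(6 := 1, 5 := 2 * m + 2)\<rparr>"
  proof -
    have 5: "(5::nat) = Suc (Suc (Suc (Suc (Suc 0))))" by simp
    have "(\<lambda>_. 0)(6 := 1, 5 := 2 * m + 2) = (\<lambda>_::nat. 0)(6 := 1, 5 := m + m + 1 + 1)"
      by (simp add: mult_2)
    moreover have "run ram_program r (Suc (Suc (Suc (Suc (Suc 0))))) (initial n arcs) =
        (initial n arcs)\<lparr>pc := Suc (Suc (Suc (Suc (Suc 0)))), reg := (\<lambda>_. 0)(6 := 1, 5 := m + m + 1
          + 1)\<rparr>"
      using inp by (simp add: ram_program_def initial_def)
    ultimately show ?thesis by (simp only: 5[symmetric])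
  qed
  have "rel inp (\<lambda>_. 0, \<lambda>_ _. 0, [], 0, 0) ?c"
    unfolding c rel_def using inp by (simp add: initial_def)
  moreover have "code_at ?P 5 (code 5 main_program)"
    by (simp add: ram_program_def code_at_def nth_append)
  moreover have "pc ?c = 5" by (simp add: c)
  ultimately have "reaches ?P r inp ?c (?W * (t + 1)) (5 + length (code 5 main_program)) (R, A, out,
    k, t)"
    using code_correct[OF s(1)] by simp
  then obtain i where i: "i \<le> ?W * (t + 1)" "pc (run ?P r i ?c) = length ?P"
    "rel inp (R, A, out, k, t) (run ?P r i ?c)"
    unfolding reaches_def by (auto simp: ram_program_def)
  have e: "run ?P r (5 + i) (initial n arcs) = run ?P r i ?c" by (rule run_add)
  \<comment> \<open>The extra 1 is absorbed by \<open>1 \<le> ?p\<close>. The summand 26 of the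
    constant covers the five instructions of the prologue and also the comparisons, which are at
    most 21 times OPT.\<close>
  have "t + 1 \<le> 27 * (m + ?p)" using s(4) p by simp
  then have "i \<le> ?W * (27 * (m + ?p))" using i(1) by (meson le_trans mult_le_mono2)
  moreover have "5 \<le> 26 * (m + ?p)" using p by simp
  ultimately have "5 + i \<le> (27 * ?W + 26) * (length arcs + ?p)"
    by (simp add: algebra_simps m_def)
  moreover have "comparisons (run ?P r i ?c) \<le> (27 * ?W + 26) * ?p"
  proof -
    have "comparisons (run ?P r i ?c) \<le> k" using i(3) by (simp add: rel_def)
    also have "\<dots> \<le> (27 * ?W + 26) * ?p" using s(3) by (simp add: algebra_simps)
    finally show ?thesis .
  qed
  moreover have "printed (run ?P r i ?c) = out" using i(3) by (simp add: rel_def)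
  ultimately show "\<exists>t \<le> (27 * weight main_program + 26) * (length arcs + ?p).
      let c = run ?P r t (initial n arcs) in
        halted ?P c \<and> lists_in_order {..<n} r (printed c) \<and>
        comparisons c \<le> (27 * weight main_program + 26) * ?p"
    using s(2) i(2) by (intro exI[of _ "5 + i"]) (simp add: Let_def e halted_def)
qed

end
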